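(* Let $n\ge 2$ and $0\le p\le n$, and work over $\mathbb{R}^n$. Let $\mathcal{Q}:\mathcal{S}_p\to\mathcal{S}_p$ be the linear map defined by its restrictions, for $k\in\mathbb{N}$, $$\mathcal{Q}|_{\mathcal{S}^k_p}=\mathrm{id}_{\mathcal{S}^k_p}+\sum_{l=1}^k \mathcal{Q}_{l,p},\qquad \mathcal{Q}_{l,p}=\mathcal{Q}'_{l,p}+\mathcal{Q}''_{l,p},$$ where $$\mathcal{Q}'_{l,p}=\Big(\frac{1}{n+1}\Big)^l\Big(\prod_{1\le j\le l}\frac{1}{\alpha^k_p-\alpha^{k-j}_p}\Big)(\delta\circ(\eta\partial)\circ\delta^* )^l,$$ $$\mathcal{Q}''_{l,p}=\Big(\frac{1}{n+1}\Big)^l\Big(\prod_{1\le j\le l}\frac{1}{\beta^k_p-\beta^{k-j}_p}\Big)(\delta^*\circ(\eta\partial)\circ\delta)^l,$$ with $$\alpha^k_p=\frac{(k+n+1)(k+p)}{n+1},\qquad \beta^k_p=\frac{(k+n)(k+p)}{n+1}.$$ Then $\mathcal{Q}$ is the unique $\mathit{sl}_{n+1}$-equivariant quantization map of $\mathcal{S}_p$.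
   Context: Setting over $\mathbb{R}^n$ with coordinates $x^1,\dots,x^n$. $\mathcal{D}^k_p$ is the space of linear differential operators of order at most $k$ from $p$-forms $\Omega^p(\mathbb{R}^n)$ to functions $C^\infty(\mathbb{R}^n)$, and $\mathcal{D}_p=\bigcup_k\mathcal{D}^k_p$. A vector field $X$ acts on it by $\mathcal{L}_XD=L_X\circ D-D\circ L_X$, with $L_X$ the usual Lie derivative of forms/functions. Symbols: $\mathcal{S}^k_p=\Gamma(\wedge^pT\mathbb{R}^n\otimes S^kT\mathbb{R}^n)$, $\mathcal{S}_p=\bigoplus_{k\ge0}\mathcal{S}^k_p$. Elements are regarded as polynomials in $\xi=(\xi_1,\dots,\xi_n)$ (coordinates on the fibres of $T^*\mathbb{R}^n$), with coefficients in $p$-vector fields. Spaces with a negative index, or with $p>n$, are $0$. $L_X$ denotes also the usual Lie derivative of tensor fields, acting on $\mathcal{S}^k_p$. The map $\sigma_{\mathit{Aff}}:\mathcal{D}_p\to\mathcal{S}_p$ sends the operator $\omega\mapsto\sum_\alpha\langle A_\alpha(x),\partial_x^\alpha\omega\rangle$ (derivatives taken on the components of $\omega$, $A_\alpha\in\Gamma(\wedge^pT\mathbb{R}^n)$) to $\sum_\alpha \xi^\alpha A_\alpha(x)$; it is a linear bijection. The action $\mathcal{L}$ is transported to $\mathcal{S}_p$ through $\sigma_{\mathit{Aff}}$ and still denoted $\mathcal{L}$. So $\mathcal{S}_p$ carries two $\mathit{Vect}(\mathbb{R}^n)$-module structures, $(\mathcal{S}_p,L)$ and $(\mathcal{S}_p,\mathcal{L})\cong\mathcal{D}_p$.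 $\mathit{sl}_{n+1}$ is the Lie algebra of vector fields on $\mathbb{R}^n$ spanned by $\partial_{x^r}$, $x^s\partial_{x^r}$, $x^r\mathcal{E}$ ($1\le r,s\le n$), where $\mathcal{E}=\sum_r x^r\partial_{x^r}$. An $\mathit{sl}_{n+1}$-equivariant quantization map of $\mathcal{S}_p$ is a linear bijection $\mathcal{Q}:\mathcal{S}_p\to\mathcal{S}_p$ such that $\mathcal{Q}\circ L_X=\mathcal{L}_X\circ\mathcal{Q}$ for all $X\in\mathit{sl}_{n+1}$, and $\mathcal{Q}(P)-P\in\bigoplus_{r<k}\mathcal{S}^r_p$ for all $k$ and all $P\in\mathcal{S}^k_p$. (Via $\sigma_{\mathit{Aff}}^{-1}$ this is an $\mathit{sl}_{n+1}$-module isomorphism from symbols to differential operators preserving principal symbols.) Operators: $\delta:\mathcal{S}^k_p\to\mathcal{S}^{k-1}_{p+1}$, $\delta(\Lambda\otimes P)=\sum_j (\partial_{x^j}\wedge\Lambda)\otimes\partial_{\xi_j}P$; $\delta^*:\mathcal{S}^k_p\to\mathcal{S}^{k+1}_{p-1}$, $\delta^*(\Lambda\otimes P)=\sum_j i_{dx^j}\Lambda\otimes\xi_jP$; and the divergence $(\eta\partial):\mathcal{S}^k_p\to\mathcal{S}^{k-1}_p$, $(\eta\partial)u=\sum_j\frac{\partial}{\partial x^j}\frac{\partial}{\partial\xi_j}u$, where $\partial/\partial x^j$ acts on the coefficients of $u$. *)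

theory Defs
  imports "HOL-Analysis.Analysis" "HOL-Library.Function_Algebras"
begin

section \<open>Smooth functions on real n-space\<close>

definition pd :: "'n::finite \<Rightarrow> (real^'n \<Rightarrow> real) \<Rightarrow> real^'n \<Rightarrow> real" where
  "pd i f = (\<lambda>x. frechet_derivative f (at x) (axis i 1))"

definition iter_pd :: "'n::finite list \<Rightarrow> (real^'n \<Rightarrow> real) \<Rightarrow> real^'n \<Rightarrow> real" where
  "iter_pd js f = foldr pd js f"

definition smooth :: "(real^'n::finite \<Rightarrow> real) \<Rightarrow> bool" where
  "smooth f \<longleftrightarrow> (\<forall>js x. iter_pd js f differentiable (at x))"

text \<open>The partial derivative for a multi-index. The index type carries no linear order, so some
  order of differentiation is chosen; the function is only applied to smooth arguments, for which
  the order is irrelevant.\<close>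
definition multi_pd :: "('n::finite \<Rightarrow> nat) \<Rightarrow> (real^'n \<Rightarrow> real) \<Rightarrow> real^'n \<Rightarrow> real" where
  "multi_pd \<alpha> = iter_pd (SOME js. \<forall>i. count_list js i = \<alpha> i)"

definition multi_deg :: "('n::finite \<Rightarrow> nat) \<Rightarrow> nat" where
  "multi_deg \<alpha> = (\<Sum>i\<in>UNIV. \<alpha> i)"


section \<open>Multivectors, forms and their Lie derivatives\<close>

text \<open>A p-vector (or a p-form at a point) is given by its fully antisymmetric array of components
  with respect to the coordinate basis, indexed by lists of length p. The array A stands for
  1/p! times the sum over all I = [i1, ..., ip] of A I times the exterior product of the basis
  elements with indices i1, ..., ip. There is no nonzero array when p exceeds the dimension.\<close>
definition alt_arrays :: "nat \<Rightarrow> ('n list \<Rightarrow> real) set" where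
  "alt_arrays p = {A. (\<forall>I. length I \<noteq> p \<longrightarrow> A I = 0) \<and>
     (\<forall>I s t. s < length I \<longrightarrow> t < length I \<longrightarrow> s \<noteq> t \<longrightarrow> A (I[s := I ! t, t := I ! s]) = - A I)}"

definition alt_fields :: "nat \<Rightarrow> (real^'n::finite \<Rightarrow> 'n list \<Rightarrow> real) set" where
  "alt_fields p = {A. (\<forall>x. A x \<in> alt_arrays p) \<and> (\<forall>I. smooth (\<lambda>x. A x I))}"

abbreviation pvector_fields :: "nat \<Rightarrow> (real^'n::finite \<Rightarrow> 'n list \<Rightarrow> real) set" where
  "pvector_fields \<equiv> alt_fields"

abbreviation forms :: "nat \<Rightarrow> (real^'n::finite \<Rightarrow> 'n list \<Rightarrow> real) set" where
  "forms \<equiv> alt_fields"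

definition pairing :: "nat \<Rightarrow> ('n::finite list \<Rightarrow> real) \<Rightarrow> ('n list \<Rightarrow> real) \<Rightarrow> real" where
  "pairing p A w = (\<Sum>I | length I = p. A I * w I) / fact p"

text \<open>The exterior product of the j-th coordinate vector with A.\<close>
definition wedge_basis :: "'n \<Rightarrow> ('n list \<Rightarrow> real) \<Rightarrow> 'n list \<Rightarrow> real" where
  "wedge_basis j A = (\<lambda>I. \<Sum>s<length I.
     if I ! s = j then (- 1) ^ s * A (take s I @ drop (Suc s) I) else 0)"

text \<open>The interior product of the j-th coordinate covector with A.\<close>
definition contract_basis :: "'n \<Rightarrow> ('n list \<Rightarrow> real) \<Rightarrow> 'n list \<Rightarrow> real" where
  "contract_basis j A = (\<lambda>I. A (j # I))"

definition lie_fun :: "(real^'n::finite \<Rightarrow> real^'n) \<Rightarrow> (real^'n \<Rightarrow> real) \<Rightarrow> real^'n \<Rightarrow> real" where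
  "lie_fun X f = (\<lambda>x. \<Sum>j\<in>UNIV. X x $ j * pd j f x)"

definition lie_form ::
  "(real^'n::finite \<Rightarrow> real^'n) \<Rightarrow> (real^'n \<Rightarrow> 'n list \<Rightarrow> real) \<Rightarrow> real^'n \<Rightarrow> 'n list \<Rightarrow> real" where
  "lie_form X w = (\<lambda>x I. lie_fun X (\<lambda>y. w y I) x
     + (\<Sum>s<length I. \<Sum>j\<in>UNIV. pd (I ! s) (\<lambda>y. X y $ j) x * w x (I[s := j])))"


section \<open>Symbols\<close>

text \<open>A symbol is a polynomial in the fibre coordinates with coefficients in p-vector fields;
  it maps a multi-index to the coefficient of the corresponding monomial.\<close>
type_synonym 'n symbol = "('n \<Rightarrow> nat) \<Rightarrow> real^'n \<Rightarrow> 'n list \<Rightarrow> real"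

definition symbols :: "nat \<Rightarrow> 'n::finite symbol set" where
  "symbols p = {u. (\<forall>\<alpha>. u \<alpha> \<in> pvector_fields p) \<and> finite {\<alpha>. u \<alpha> \<noteq> 0}}"

definition symbols_hom :: "nat \<Rightarrow> nat \<Rightarrow> 'n::finite symbol set" where
  "symbols_hom p k = {u \<in> symbols p. \<forall>\<alpha>. multi_deg \<alpha> \<noteq> k \<longrightarrow> u \<alpha> = 0}"

definition symbols_below :: "nat \<Rightarrow> nat \<Rightarrow> 'n::finite symbol set" where
  "symbols_below p k = {u \<in> symbols p. \<forall>\<alpha>. multi_deg \<alpha> \<ge> k \<longrightarrow> u \<alpha> = 0}"

definition hom_part :: "nat \<Rightarrow> 'n::finite symbol \<Rightarrow> 'n symbol" where
  "hom_part k u = (\<lambda>\<alpha>. if multi_deg \<alpha> = k then u \<alpha> else 0)"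

definition scale_symbol :: "real \<Rightarrow> 'n::finite symbol \<Rightarrow> 'n symbol" where
  "scale_symbol c u = (\<lambda>\<alpha> x I. c * u \<alpha> x I)"

definition linear_on_symbols :: "nat \<Rightarrow> ('n::finite symbol \<Rightarrow> 'n symbol) \<Rightarrow> bool" where
  "linear_on_symbols p Q \<longleftrightarrow> (\<forall>u\<in>symbols p. \<forall>v\<in>symbols p. \<forall>a b.
     Q (scale_symbol a u + scale_symbol b v) = scale_symbol a (Q u) + scale_symbol b (Q v))"

text \<open>Differentiation with respect to, and multiplication by, the j-th fibre coordinate.\<close>
definition xi_deriv :: "'n \<Rightarrow> 'n::finite symbol \<Rightarrow> 'n symbol" where
  "xi_deriv j u = (\<lambda>\<alpha> x I. real (\<alpha> j + 1) * u (\<alpha>(j := \<alpha> j + 1)) x I)"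

definition xi_mult :: "'n \<Rightarrow> 'n::finite symbol \<Rightarrow> 'n symbol" where
  "xi_mult j u = (\<lambda>\<alpha>. if \<alpha> j = 0 then 0 else u (\<alpha>(j := \<alpha> j - 1)))"

text \<open>The Lie derivative of symbols as tensor fields. It acts as a derivation sending the i-th
  coordinate vector field (in a symmetric as well as in an exterior factor) to minus the sum over
  j of the i-th partial derivative of the j-th component of X times the j-th one.\<close>
definition lie_symbol :: "(real^'n::finite \<Rightarrow> real^'n) \<Rightarrow> 'n symbol \<Rightarrow> 'n symbol" where
  "lie_symbol X u = (\<lambda>\<alpha> x I. lie_fun X (\<lambda>y. u \<alpha> y I) x
     - (\<Sum>i\<in>UNIV. \<Sum>j\<in>UNIV. pd i (\<lambda>y. X y $ j) x * xi_mult j (xi_deriv i u) \<alpha> x I)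
     - (\<Sum>s<length I. \<Sum>j\<in>UNIV. pd j (\<lambda>y. X y $ (I ! s)) x * u \<alpha> x (I[s := j])))"

definition delta :: "'n::finite symbol \<Rightarrow> 'n symbol" where
  "delta u = (\<lambda>\<alpha> x I. \<Sum>j\<in>UNIV. wedge_basis j (xi_deriv j u \<alpha> x) I)"

definition delta_star :: "'n::finite symbol \<Rightarrow> 'n symbol" where
  "delta_star u = (\<lambda>\<alpha> x I. \<Sum>j\<in>UNIV. contract_basis j (xi_mult j u \<alpha> x) I)"

definition symbol_div :: "'n::finite symbol \<Rightarrow> 'n symbol" where
  "symbol_div u = (\<lambda>\<alpha> x I. \<Sum>j\<in>UNIV. pd j (\<lambda>y. xi_deriv j u \<alpha> y I) x)"


section \<open>Differential operators from forms to functions\<close>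

type_synonym 'n form_op = "(real^'n \<Rightarrow> 'n list \<Rightarrow> real) \<Rightarrow> real^'n \<Rightarrow> real"

text \<open>The operator with a given full symbol. As functions, operators are extensional on
  p-forms, so that equality of operators is equality on all p-forms.\<close>
definition aff_op :: "nat \<Rightarrow> 'n::finite symbol \<Rightarrow> 'n form_op" where
  "aff_op p u = (\<lambda>w\<in>forms p. \<lambda>x.
     \<Sum>\<alpha> | u \<alpha> \<noteq> 0. pairing p (u \<alpha> x) (\<lambda>I. multi_pd \<alpha> (\<lambda>y. w y I) x))"

definition diff_ops :: "nat \<Rightarrow> 'n::finite form_op set" where
  "diff_ops p = aff_op p ` symbols p"

text \<open>The inverse of \<open>aff_op p\<close>, from \<open>diff_ops p\<close> to \<open>symbols p\<close>.\<close>
definition sigma_aff :: "nat \<Rightarrow> 'n::finite form_op \<Rightarrow> 'n symbol" where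
  "sigma_aff p = inv_into (symbols p) (aff_op p)"

definition lie_op :: "nat \<Rightarrow> (real^'n::finite \<Rightarrow> real^'n) \<Rightarrow> 'n form_op \<Rightarrow> 'n form_op" where
  "lie_op p X D = (\<lambda>w\<in>forms p. \<lambda>x. lie_fun X (D w) x - D (lie_form X w) x)"

text \<open>The action on differential operators, transported to symbols.\<close>
definition act_symbol :: "nat \<Rightarrow> (real^'n::finite \<Rightarrow> real^'n) \<Rightarrow> 'n symbol \<Rightarrow> 'n symbol" where
  "act_symbol p X u = sigma_aff p (lie_op p X (aff_op p u))"


section \<open>Equivariant quantization maps\<close>

definition sl_fields :: "(real^'n::finite \<Rightarrow> real^'n) set" where
  "sl_fields = {X. \<exists>a b c. X = (\<lambda>x.
       (\<Sum>r\<in>UNIV. a r *\<^sub>R axis r 1)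
     + (\<Sum>r\<in>UNIV. \<Sum>s\<in>UNIV. (b r s * x $ s) *\<^sub>R axis r 1)
     + (\<Sum>r\<in>UNIV. (c r * x $ r) *\<^sub>R (\<Sum>s\<in>UNIV. x $ s *\<^sub>R axis s 1)))}"

definition sl_quantization :: "nat \<Rightarrow> ('n::finite symbol \<Rightarrow> 'n symbol) \<Rightarrow> bool" where
  "sl_quantization p Q \<longleftrightarrow>
     linear_on_symbols p Q \<and> bij_betw Q (symbols p) (symbols p) \<and>
     (\<forall>X\<in>sl_fields. \<forall>u\<in>symbols p. Q (lie_symbol X u) = act_symbol p X (Q u)) \<and>
     (\<forall>k. \<forall>P\<in>symbols_hom p k. Q P - P \<in> symbols_below p k)"

definition alpha_coeff :: "nat \<Rightarrow> nat \<Rightarrow> nat \<Rightarrow> real" where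
  "alpha_coeff n p k = (real k + real n + 1) * (real k + real p) / (real n + 1)"

definition beta_coeff :: "nat \<Rightarrow> nat \<Rightarrow> nat \<Rightarrow> real" where
  "beta_coeff n p k = (real k + real n) * (real k + real p) / (real n + 1)"

definition quant_alpha :: "nat \<Rightarrow> nat \<Rightarrow> nat \<Rightarrow> 'n::finite symbol \<Rightarrow> 'n symbol" where
  "quant_alpha p k l u = scale_symbol
     ((1 / (real CARD('n) + 1)) ^ l *
      (\<Prod>j=1..l. 1 / (alpha_coeff CARD('n) p k - alpha_coeff CARD('n) p (k - j))))
     (((delta \<circ> symbol_div \<circ> delta_star) ^^ l) u)"

definition quant_beta :: "nat \<Rightarrow> nat \<Rightarrow> nat \<Rightarrow> 'n::finite symbol \<Rightarrow> 'n symbol" where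
  "quant_beta p k l u = scale_symbol
     ((1 / (real CARD('n) + 1)) ^ l *
      (\<Prod>j=1..l. 1 / (beta_coeff CARD('n) p k - beta_coeff CARD('n) p (k - j))))
     (((delta_star \<circ> symbol_div \<circ> delta) ^^ l) u)"

definition quant_hom :: "nat \<Rightarrow> nat \<Rightarrow> 'n::finite symbol \<Rightarrow> 'n symbol" where
  "quant_hom p k u = u + (\<Sum>l=1..k. quant_alpha p k l u + quant_beta p k l u)"

definition quant :: "nat \<Rightarrow> 'n::finite symbol \<Rightarrow> 'n symbol" where
  "quant p u = (\<Sum>k | hom_part k u \<noteq> 0. quant_hom p k (hom_part k u))"

lemma pd_zero [simp]: "pd j (\<lambda>_. 0) = (\<lambda>_. 0)"
  by (simp add: pd_def)

lemma quant_hom_zero: "quant_hom p k (0 :: 'n::finite symbol) = 0"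
proof -
  have xd: "xi_deriv j 0 = (0 :: 'n symbol)" and xm: "xi_mult j 0 = (0 :: 'n symbol)" for j :: 'n
    by (auto simp: xi_deriv_def xi_mult_def fun_eq_iff)
  have w: "wedge_basis j (\<lambda>_. 0) = 0" and c: "contract_basis j (\<lambda>_. 0) = 0" for j :: 'n
    by (auto simp: wedge_basis_def contract_basis_def fun_eq_iff intro!: sum.neutral)
  have d: "delta 0 = (0 :: 'n symbol)" "delta_star 0 = (0 :: 'n symbol)"
      "symbol_div 0 = (0 :: 'n symbol)"
    unfolding delta_def delta_star_def symbol_div_def xd xm
    by (simp_all add: w[unfolded zero_fun_def] c[unfolded zero_fun_def] zero_fun_def
        fun_eq_iff)
  have "((delta \<circ> symbol_div \<circ> delta_star) ^^ l) 0 = (0 :: 'n symbol)"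
       "((delta_star \<circ> symbol_div \<circ> delta) ^^ l) 0 = (0 :: 'n symbol)" for l
    by (induction l) (simp_all add: d)
  then show ?thesis
    by (simp add: quant_hom_def quant_alpha_def quant_beta_def scale_symbol_def zero_fun_def
        fun_eq_iff)
qed

lemma quant_on_symbols_hom:
  assumes "u \<in> symbols_hom p k"
  shows "quant p u = quant_hom p k u"
proof -
  have u: "u \<alpha> = 0" if "multi_deg \<alpha> \<noteq> k" for \<alpha>
    using assms that by (auto simp: symbols_hom_def)
  have "hom_part k u = u"
    using u by (auto simp: hom_part_def fun_eq_iff)
  moreover have "hom_part l u = 0" if "l \<noteq> k" for l
    using u that by (auto simp: hom_part_def fun_eq_iff)
  ultimately have "{l. hom_part l u \<noteq> 0} = (if u = 0 then {} else {k})"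
    by auto metis+
  with \<open>hom_part k u = u\<close> show ?thesis
    by (auto simp: quant_def quant_hom_zero)
qed

end

theory Submission
  imports Defs "HOL-Library.Multiset"
begin

text \<open>
  Write \<open>A = \<Sum>\<^sub>r c\<^sub>r \<delta> \<partial>\<^bsub>\<xi>\<^sub>r\<^esub> \<delta>\<^sup>*\<close> and \<open>B = \<Sum>\<^sub>r c\<^sub>r \<delta>\<^sup>* \<partial>\<^bsub>\<xi>\<^sub>r\<^esub> \<delta>\<close>, where \<open>c\<close> collects the
  coefficients of the quadratic fields \<open>x\<^sub>r \<E>\<close> in \<open>X\<close>. On the symbols with values in \<open>p\<close>-vectors, the
  action transported from differential operators is \<open>L\<^sub>X - A - B\<close>. The operators \<open>\<delta>\<close> and \<open>\<delta>\<^sup>*\<close>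
  commute with \<open>L\<^sub>X\<close>, whereas \<open>N\<^sub>1 = \<delta> div \<delta>\<^sup>*\<close> and \<open>N\<^sub>2 = \<delta>\<^sup>* div \<delta>\<close> satisfy
  \<open>[N\<^sub>1, L\<^sub>X] = - (2 k + n + p) A\<close> and \<open>[N\<^sub>2, L\<^sub>X] = - (2 k + n + p - 1) B\<close> in degree \<open>k\<close>. As \<open>A\<close> commutes
  with \<open>N\<^sub>1\<close> and \<open>B\<close> with \<open>N\<^sub>2\<close> while \<open>A N\<^sub>2 = B N\<^sub>1 = 0\<close>, the commutators of \<open>L\<^sub>X\<close> with the powers of
  \<open>N\<^sub>1\<close> and \<open>N\<^sub>2\<close> telescope, and the stated coefficients are the ones that make \<open>Q\<close> equivariant.

  For uniqueness, the Casimir operator of \<open>L\<close> acts in degree \<open>k\<close> through \<open>\<delta> \<delta>\<^sup>*\<close>, with the eigenvalues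
  \<open>2 (k + p) (k + n + 1)\<close> and \<open>2 (k + p) (k + n)\<close>, both larger than those in lower degrees. Two
  quantizations therefore agree on eigenvectors: the difference of the images lies in lower degrees,
  where the eigenvalue does not occur.
\<close>

section \<open>Commutators in a Weyl-Clifford algebra\<close>

text \<open>The transported action differs from the Lie derivative only through the quadratic
  fields: composing with a quadratic coefficient leaves the extra terms
  \<open>(degS + degL) * Dc c + dl * Ic c\<close>. The Koszul identity
  \<open>ds * dl + dl * ds = tot\<close> splits them into \<open>A c + B c\<close>, one part
  starting with delta, the other with \<open>delta_star\<close>. Since both of these square to zero,
  the two chains of corrections never mix, and equivariance becomes one scalar recursion for each
  chain; its solution is the product of inverse differences in the statement. The same identity
  makes \<open>dl * ds\<close> divided by k + p a projection in degree k (for k + p > 0), which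
  explains the two Casimir eigenvalues. Even the larger one in degree j < k stays below the smaller
  one in degree k, because (j + p)(j + n + 1) <= (k - 1 + p)(k + n) < (k + p)(k + n). The operators
  involved change k and p. The identities are therefore proved in an abstract unital algebra in
  which both degrees are themselves operators; the algebra is realized afterwards on symbols of all
  types at once.\<close>

definition comm :: "'a::ring \<Rightarrow> 'a \<Rightarrow> 'a" where
  "comm x y = x * y - y * x"

lemma comm_mult_left: "comm (x * y) z = x * comm y z + comm x z * y"
  and comm_mult_right: "comm z (x * y) = x * comm z y + comm z x * y"
  and comm_add_left: "comm (x + y) z = comm x z + comm y z"
  and comm_add_right: "comm z (x + y) = comm z x + comm z y"
  and comm_diff_left: "comm (x - y) z = comm x z - comm y z"
  and comm_diff_right: "comm z (x - y) = comm z x - comm z y"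
  and comm_minus_left: "comm (- x) z = - comm x z"
  and comm_minus_right: "comm z (- x) = - comm z x"
  by (simp_all add: comm_def algebra_simps)

lemma comm_zero_right [simp]: "comm z 0 = 0"
  by (simp add: comm_def)

lemma comm_of_nat [simp]: "comm z 1 = (0 :: 'a::ring_1)"
  "comm (of_nat n) z = (0 :: 'a::ring_1)" "comm z (of_nat n) = (0 :: 'a::ring_1)"
  by (simp_all add: comm_def mult_of_nat_commute)

lemma comm_scale_left [simp]: "comm (c *\<^sub>R x) z = c *\<^sub>R comm x (z :: 'a::real_algebra)"
  and comm_scale_right [simp]: "comm z (c *\<^sub>R x) = c *\<^sub>R comm z (x :: 'a::real_algebra)"
  by (simp_all add: comm_def algebra_simps)

lemma comm_sum_left: "comm (sum f S) z = (\<Sum>i\<in>S. comm (f i) z)"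
  and comm_sum_right: "comm z (sum f S) = (\<Sum>i\<in>S. comm z (f i))"
  by (simp_all add: comm_def sum_distrib_left sum_distrib_right sum_subtractf)

lemmas comm_bilin = comm_add_left comm_add_right comm_diff_left comm_diff_right
  comm_minus_left comm_minus_right comm_sum_left comm_sum_right

lemma comm_flip: "comm x y = z \<Longrightarrow> comm y x = - z"
  by (auto simp: comm_def)

lemma comm_eq_iff: "comm x y = z \<longleftrightarrow> x * y = y * x + z"
  by (auto simp: comm_def algebra_simps)

lemma comm_zero_iff: "comm x y = 0 \<longleftrightarrow> x * y = y * x"
  by (simp add: comm_def)

lemma mult_if_zero: "(if b then x else 0) * y = (if b then x * y else (0 :: 'a::ring))"
  "y * (if b then x else 0) = (if b then y * x else (0 :: 'a::ring))"
  "(- (if b then x else 0)) = (if b then - x else (0 :: 'a::ring))"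
  by simp_all

lemma self_neg: "x = - x \<Longrightarrow> x = (0 :: 'a::real_vector)"
  by (metis add.right_inverse scaleR_2 scaleR_eq_0_iff zero_neq_numeral)

text \<open>Intended meaning: \<open>D\<close> differentiates by and \<open>M\<close> multiplies by fibre coordinates, \<open>W\<close> and \<open>I\<close>
  are exterior and interior products with basis (co)vectors, \<open>P\<close> and \<open>X\<close> are partial derivatives
  and coordinates of the base. Then \<open>degS\<close> and \<open>degL\<close> are multiplication by the symmetric and the
  exterior degree.\<close>

locale weyl_clifford =
  fixes D M W I P X :: "'n::finite \<Rightarrow> 'a::real_algebra_1"
  assumes DM: "comm (D i) (M j) = (if i = j then 1 else 0)"
    and PX: "comm (P i) (X j) = (if i = j then 1 else 0)"
    and DD: "comm (D i) (D j) = 0" and MM: "comm (M i) (M j) = 0"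
    and PP: "comm (P i) (P j) = 0" and XX: "comm (X i) (X j) = 0"
    and DP: "comm (D i) (P j) = 0" and DX: "comm (D i) (X j) = 0"
    and MP: "comm (M i) (P j) = 0" and MX: "comm (M i) (X j) = 0"
    and WD: "comm (W i) (D j) = 0" and WM: "comm (W i) (M j) = 0"
    and WP: "comm (W i) (P j) = 0" and WX: "comm (W i) (X j) = 0"
    and ID: "comm (I i) (D j) = 0" and IM: "comm (I i) (M j) = 0"
    and IP: "comm (I i) (P j) = 0" and IX: "comm (I i) (X j) = 0"
    and II: "I i * I j = - (I j * I i)" and WW: "W i * W j = - (W j * W i)"
    and IW: "I i * W j = (if i = j then 1 else 0) - W j * I i"
begin

lemmas basic = DM PX DD MM PP XX DP DX MP MX WD WM WP WX ID IM IP IX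

lemmas basic_flip [simplified] = DM[THEN comm_flip] PX[THEN comm_flip] DP[THEN comm_flip] DX[THEN comm_flip]
  MP[THEN comm_flip] MX[THEN comm_flip] WD[THEN comm_flip] WM[THEN comm_flip] WP[THEN comm_flip]
  WX[THEN comm_flip] ID[THEN comm_flip] IM[THEN comm_flip] IP[THEN comm_flip] IX[THEN comm_flip]

text \<open>\<open>E a b\<close> is the matrix unit of gl(n) acting on the symmetric and exterior
  factors together, and \<open>eul\<close> the Euler field of the base. In the realization
  \<open>dl\<close>, \<open>ds\<close>, \<open>dv\<close> become delta, \<open>delta_star\<close>
  and the divergence (\<open>delta_sym_of\<close>, \<open>delta_star_sym_of\<close>,
  \<open>symbol_div_sym_of\<close>).\<close>

definition E where "E a b = M a * D b + W a * I b"
definition degS where "degS = (\<Sum>j\<in>UNIV. M j * D j)"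
definition degL where "degL = (\<Sum>j\<in>UNIV. W j * I j)"
definition tot where "tot = degS + degL"
definition eul where "eul = (\<Sum>j\<in>UNIV. X j * P j)"
definition dl where "dl = (\<Sum>j\<in>UNIV. W j * D j)"
definition ds where "ds = (\<Sum>j\<in>UNIV. I j * M j)"
definition dv where "dv = (\<Sum>j\<in>UNIV. P j * D j)"

text \<open>\<open>W a * I b\<close> is even: moving \<open>W j\<close> past it costs two signs that
  cancel, and only the contraction of \<open>W j\<close> with \<open>I b\<close> is left. So
  commutators suffice for quadratic expressions in the odd generators.\<close>

lemma W_WI: "comm (W j) (W a * I b) = (if b = j then - W a else 0)"
proof -
  have "W j * (W a * I b) = - (W a * W j) * I b" using WW[of j a] by (simp add: mult.assoc [symmetric])
  moreover have "W a * I b * W j = W a * ((if b = j then 1 else 0) - W j * I b)"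
    by (simp add: IW mult.assoc)
  ultimately show ?thesis by (cases "b = j") (simp_all add: comm_def mult.assoc right_diff_distrib)
qed

lemma I_WI: "comm (I j) (W a * I b) = (if a = j then I b else 0)"
proof -
  have "W a * I b * I j = - (W a * I j * I b)" using II[of b j] by (simp add: mult.assoc)
  moreover have "I j * (W a * I b) = ((if a = j then 1 else 0) - W a * I j) * I b"
    using IW[of j a] by (simp add: mult.assoc [symmetric])
  ultimately show ?thesis by (cases "a = j") (simp_all add: comm_def mult.assoc left_diff_distrib)
qed

lemma comm_E:
  "comm (D j) (E a b) = (if a = j then D b else 0)"
  "comm (M j) (E a b) = (if b = j then - M a else 0)"
  "comm (W j) (E a b) = (if b = j then - W a else 0)"
  "comm (I j) (E a b) = (if a = j then I b else 0)"
  "comm (P j) (E a b) = 0" "comm (X j) (E a b) = 0"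
  unfolding E_def comm_bilin W_WI I_WI
  by (auto simp: comm_mult_right basic basic_flip)

lemma tot_E: "tot = (\<Sum>j\<in>UNIV. E j j)"
  by (simp add: tot_def degS_def degL_def E_def sum.distrib)

lemma comm_degS:
  "comm (D j) degS = D j" "comm (M j) degS = - M j" "comm (W j) degS = 0" "comm (I j) degS = 0"
  "comm (P j) degS = 0" "comm (X j) degS = 0"
  unfolding degS_def
  by (simp_all add: comm_bilin comm_mult_right basic basic_flip mult_if_zero sum_negf)

lemma comm_degL:
  "comm (D j) degL = 0" "comm (M j) degL = 0" "comm (W j) degL = - W j" "comm (I j) degL = I j"
  "comm (P j) degL = 0" "comm (X j) degL = 0"
  unfolding degL_def
  by (simp_all add: comm_sum_right W_WI I_WI, simp_all add: comm_mult_right basic basic_flip)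

lemma comm_tot:
  "comm (D j) tot = D j" "comm (M j) tot = - M j" "comm (W j) tot = - W j" "comm (I j) tot = I j"
  "comm (P j) tot = 0" "comm (X j) tot = 0"
  by (simp_all add: tot_def comm_bilin comm_degS comm_degL)

lemma comm_eul:
  "comm (D j) eul = 0" "comm (M j) eul = 0" "comm (W j) eul = 0" "comm (I j) eul = 0"
  "comm (P j) eul = P j" "comm (X j) eul = - X j"
  unfolding eul_def
  by (simp_all add: comm_bilin comm_mult_right basic basic_flip mult_if_zero sum_negf)

section \<open>Commutators of delta, \<open>delta_star\<close> and the divergence with gl(n),
  degrees and coordinates\<close>

lemma comm_dl:
  "comm dl (E a b) = 0" "comm dl degS = dl" "comm dl degL = - dl" "comm dl tot = 0" "comm dl eul = 0"
  "comm dl (P j) = 0" "comm dl (X j) = 0" "comm dl (D j) = 0"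
  unfolding dl_def
  by (simp_all add: comm_sum_left comm_mult_left comm_E comm_degS comm_degL comm_tot comm_eul basic basic_flip
    mult_if_zero sum.distrib sum_negf)

lemma comm_ds:
  "comm ds (E a b) = 0" "comm ds degS = - ds" "comm ds degL = ds" "comm ds tot = 0" "comm ds eul = 0"
  "comm ds (P j) = 0" "comm ds (X j) = 0" "comm ds (D j) = - I j"
  unfolding ds_def
  by (simp_all add: comm_sum_left comm_mult_left comm_E comm_degS comm_degL comm_tot comm_eul basic basic_flip
    mult_if_zero sum.distrib sum_negf)

lemma comm_dv:
  "comm dv (E a b) = P a * D b" "comm dv degS = dv" "comm dv degL = 0" "comm dv tot = dv" "comm dv eul = dv"
  "comm dv (P j) = 0" "comm dv (X j) = D j" "comm dv (D j) = 0"
  unfolding dv_def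
  by (simp_all add: comm_sum_left comm_mult_left comm_E comm_degS comm_degL comm_tot comm_eul basic basic_flip
    mult_if_zero sum.distrib sum_negf)

lemma dl_dv: "comm dl dv = 0"
  by (simp add: dv_def comm_sum_right comm_mult_right comm_dl)

text \<open>The \<open>D\<close> commute and the \<open>W\<close> anticommute, so exchanging i and j
  negates the double sum.\<close>

lemma dl_dl: "dl * dl = 0"
proof -
  have *: "W i * D i * (W j * D j) = - (W j * D j * (W i * D i))" for i j
  proof -
    have "D i * W j = W j * D i" for i j using WD[of j i] by (simp add: comm_zero_iff)
    then have "W i * D i * (W j * D j) = W i * W j * (D i * D j)" for i j
      by (metis mult.assoc)
    moreover have "D i * D j = D j * D i" using DD[of i j] by (simp add: comm_zero_iff)
    ultimately show ?thesis using WW[of i j] by simp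
  qed
  have eq: "dl * dl = (\<Sum>i\<in>UNIV. \<Sum>j\<in>UNIV. W i * D i * (W j * D j))"
    by (simp only: dl_def sum_product)
  also have "\<dots> = (\<Sum>j\<in>UNIV. \<Sum>i\<in>UNIV. - (W j * D j * (W i * D i)))"
    by (subst sum.swap) (intro sum.cong refl *)
  also have "\<dots> = - (dl * dl)"
    by (simp only: eq sum_negf)
  finally show ?thesis by (rule self_neg)
qed

lemma ds_ds: "ds * ds = 0"
proof -
  have *: "I i * M i * (I j * M j) = - (I j * M j * (I i * M i))" for i j
  proof -
    have "M i * I j = I j * M i" for i j using IM[of j i] by (simp add: comm_zero_iff)
    then have "I i * M i * (I j * M j) = I i * I j * (M i * M j)" for i j
      by (metis mult.assoc)
    moreover have "M i * M j = M j * M i" using MM[of i j] by (simp add: comm_zero_iff)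
    ultimately show ?thesis using II[of i j] by simp
  qed
  have eq: "ds * ds = (\<Sum>i\<in>UNIV. \<Sum>j\<in>UNIV. I i * M i * (I j * M j))"
    by (simp only: ds_def sum_product)
  also have "\<dots> = (\<Sum>j\<in>UNIV. \<Sum>i\<in>UNIV. - (I j * M j * (I i * M i)))"
    by (subst sum.swap) (intro sum.cong refl *)
  also have "\<dots> = - (ds * ds)"
    by (simp only: eq sum_negf)
  finally show ?thesis by (rule self_neg)
qed

text \<open>The Koszul homotopy formula. For distinct i and j the summands \<open>I i * M i\<close>
  and \<open>W j * D j\<close> anticommute; on the diagonal \<open>M i * D i + W i * I i\<close>
  survives.\<close>

lemma ds_dl: "ds * dl = tot - dl * ds"
proof -
  have *: "I i * M i * (W j * D j) + W j * D j * (I i * M i)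
     = (if i = j then M i * D i + W i * I i else 0)" for i j
  proof -
    have MW: "M i * W j = W j * M i" and DI: "D j * I i = I i * D j"
      using WM[of j i] ID[of i j] by (simp_all add: comm_zero_iff)
    have DM': "D j * M i = M i * D j + (if i = j then 1 else 0)"
      using DM[of j i] by (auto simp: comm_def algebra_simps)
    have WI: "W j * I i = (if i = j then 1 else 0) - I i * W j"
      using IW[of i j] by simp
    have 1: "I i * M i * (W j * D j) = I i * W j * (M i * D j)"
      using MW by (metis mult.assoc)
    have 2: "W j * D j * (I i * M i) = W j * I i * (D j * M i)"
      using DI by (metis mult.assoc)
    show ?thesis unfolding 1 2 DM'
      by (cases "i = j") (simp_all add: IW algebra_simps)
  qed
  have "ds * dl + dl * ds = (\<Sum>i\<in>UNIV. \<Sum>j\<in>UNIV. I i * M i * (W j * D j) + W j * D j * (I i * M i))"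
    unfolding dl_def ds_def sum_product sum.distrib
    by (rule arg_cong2[where f = "(+)"], rule refl, rule sum.swap)
  also have "\<dots> = tot"
    unfolding * by (simp add: tot_def degS_def degL_def sum.distrib)
  finally show ?thesis by (simp add: algebra_simps)
qed

lemma sum_DM: "(\<Sum>j\<in>UNIV. D j * M j) = of_nat CARD('n) + degS"
proof -
  have "D j * M j = 1 + M j * D j" for j
    using DM[of j j] by (simp add: comm_def algebra_simps)
  then show ?thesis by (simp add: degS_def sum.distrib)
qed

lemma sum_IW: "(\<Sum>j\<in>UNIV. I j * W j) = of_nat CARD('n) - degL"
  by (simp add: IW sum_subtractf degL_def)

section \<open>The operators \<open>N1\<close> and \<open>N2\<close> and their commutators with the
  projective fields\<close>

definition N1 where "N1 = dl * dv * ds"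
definition N2 where "N2 = ds * dv * dl"

text \<open>In the realization on symbols, these are the Lie derivatives along \<open>\<partial>\<^sub>r\<close>, \<open>x\<^sub>s \<partial>\<^sub>r\<close> and
  \<open>x\<^sub>r \<E>\<close>.\<close>

definition Tr where "Tr r = P r"
definition Gr where "Gr r s = X s * P r - E r s"
definition Zr where "Zr r = X r * eul - (\<Sum>j\<in>UNIV. X j * E j r) - X r * tot"

text \<open>This sum arises when the divergence hits the coordinate in \<open>X j * E j r\<close>.
  It is ordered with \<open>dl\<close> in front, because \<open>dl * dl = 0\<close> will remove that
  term in the computation for \<open>N1\<close>.\<close>

lemma dl_E_sum: "(\<Sum>j\<in>UNIV. D j * E j r) = (of_nat CARD('n) + degS) * D r + dl * I r"
proof -
  have "D j * E j r = D j * M j * D r + W j * D j * I r" for j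
  proof -
    have "D j * W j = W j * D j" using WD[of j j] by (simp add: comm_zero_iff)
    then show ?thesis unfolding E_def by (metis distrib_left mult.assoc)
  qed
  then show ?thesis
    by (simp add: sum.distrib sum_DM[symmetric] sum_distrib_right dl_def)
qed

lemma D_degS: "D r * degS = degS * D r + D r" and D_degL: "D r * degL = degL * D r"
  using comm_degS(1)[of r] comm_degL(1)[of r] by (simp_all add: comm_eq_iff)

lemma dl_Lie: "comm dl (Tr r) = 0" "comm dl (Gr r s) = 0" "comm dl (Zr r) = 0"
  unfolding Tr_def Gr_def Zr_def
  by (simp_all add: comm_bilin comm_mult_right comm_dl)

lemma ds_Lie: "comm ds (Tr r) = 0" "comm ds (Gr r s) = 0" "comm ds (Zr r) = 0"
  unfolding Tr_def Gr_def Zr_def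
  by (simp_all add: comm_bilin comm_mult_right comm_ds)

lemma degS_E: "comm degS (E a b) = 0" and degS_eul: "comm degS eul = 0" and degS_degL: "comm degS degL = 0"
  unfolding degS_def
  by (simp_all add: comm_sum_left comm_mult_left comm_E comm_eul comm_degL mult_if_zero sum.distrib)

lemma degL_E: "comm degL (E a b) = 0" and degL_eul: "comm degL eul = 0" and degL_degS: "comm degL degS = 0"
  unfolding degL_def
  by (simp_all add: comm_sum_left comm_mult_left comm_E comm_eul comm_degS mult_if_zero sum.distrib)

lemma degS_basic: "comm degS (X j) = 0" "comm degS (P j) = 0" "comm degS degS = 0"
   "comm degL (X j) = 0" "comm degL (P j) = 0" "comm degL degL = 0"
  using comm_degS(5,6)[THEN comm_flip] comm_degL(5,6)[THEN comm_flip]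
  by (simp_all, simp_all add: comm_def)

lemma deg_Lie: "comm degS (Tr r) = 0" "comm degS (Gr r s) = 0" "comm degS (Zr r) = 0"
  "comm degL (Tr r) = 0" "comm degL (Gr r s) = 0" "comm degL (Zr r) = 0"
  unfolding Tr_def Gr_def Zr_def tot_def
  by (simp_all add: comm_bilin comm_mult_right degS_E degS_eul degS_degL degL_E degL_eul degL_degS degS_basic)

text \<open>The divergence is invariant under affine fields only. For a quadratic field all
  derivatives along the base still cancel: the two terms \<open>X r * dv\<close> against each other,
  and \<open>D r * eul\<close> against \<open>eul * D r\<close>. What remains acts on the
  fibres.\<close>

lemma dv_Lie: "comm dv (Tr r) = 0" "comm dv (Gr r s) = 0"
  "comm dv (Zr r) = - ((2 * degS + degL + of_nat (CARD('n) + 1)) * D r + dl * I r)"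
proof -
  show "comm dv (Tr r) = 0" by (simp add: Tr_def comm_dv)
  have "D s * P r = P r * D s" using DP[of s r] by (simp add: comm_zero_iff)
  then show "comm dv (Gr r s) = 0"
    by (simp add: Gr_def comm_bilin comm_mult_right comm_dv)
  have "comm dv (Zr r) = D r * eul - (\<Sum>j\<in>UNIV. X j * (P j * D r) + D j * E j r) - D r * tot"
    by (simp add: Zr_def comm_bilin comm_mult_right comm_dv)
  also have "(\<Sum>j\<in>UNIV. X j * (P j * D r) + D j * E j r) = eul * D r + (of_nat CARD('n) + degS) * D r + dl * I r"
    by (simp only: sum.distrib dl_E_sum eul_def sum_distrib_right mult.assoc add.assoc)
  also have "D r * eul = eul * D r"
    using comm_eul(1)[of r] by (simp add: comm_zero_iff)
  also have "eul * D r - (eul * D r + (of_nat CARD('n) + degS) * D r + dl * I r) - D r * tot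
     = - ((2 * degS + degL + of_nat (CARD('n) + 1)) * D r + dl * I r)"
    by (simp add: D_degS D_degL tot_def algebra_simps mult_2)
  finally show "comm dv (Zr r) = - ((2 * degS + degL + of_nat (CARD('n) + 1)) * D r + dl * I r)" .
qed


text \<open>\<open>Dc c\<close> and \<open>Ic c\<close> differentiate and contract along the
  covector c of the quadratic part of the field. \<open>Lam a b c\<close> is the Lie derivative
  along the general projective field, see \<open>lie_symbol_sl_vec\<close>.\<close>

definition Dc where "Dc c = (\<Sum>r\<in>UNIV. c r *\<^sub>R D r)"
definition Ic where "Ic c = (\<Sum>r\<in>UNIV. c r *\<^sub>R I r)"
definition Lam where "Lam a b c = (\<Sum>r\<in>UNIV. a r *\<^sub>R Tr r) + (\<Sum>r\<in>UNIV. \<Sum>s\<in>UNIV. b r s *\<^sub>R Gr r s)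
   + (\<Sum>r\<in>UNIV. c r *\<^sub>R Zr r)"
definition A where "A c = dl * Dc c * ds"
definition B where "B c = ds * Dc c * dl"

lemma Lam_comm: "comm dl (Lam a b c) = 0" "comm ds (Lam a b c) = 0"
  "comm degS (Lam a b c) = 0" "comm degL (Lam a b c) = 0"
  by (simp_all add: Lam_def comm_bilin dl_Lie ds_Lie deg_Lie)

lemma dv_Lam: "comm dv (Lam a b c) = - ((2 * degS + degL + of_nat (CARD('n) + 1)) * Dc c + dl * Ic c)"
  unfolding Lam_def Dc_def Ic_def
  by (simp add: comm_bilin dv_Lie sum_distrib_left sum.distrib sum_negf scaleR_diff_right sum_subtractf del: of_nat_add)

lemma Dc_comm: "comm dl (Dc c) = 0" "comm dv (Dc c) = 0" "comm ds (Dc c) = - Ic c"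
  "comm (Dc c) degS = Dc c" "comm (Dc c) degL = 0"
  by (simp_all add: Dc_def Ic_def comm_bilin comm_dl comm_dv comm_ds comm_degS comm_degL sum_negf)

lemma Ic_dl: "Ic c * dl = Dc c - dl * Ic c"
proof -
  have "I r * dl = D r - dl * I r" for r
  proof -
    have "I r * (W j * D j) = (if r = j then D j else 0) - W j * D j * I r" for j
    proof -
      have "D j * I r = I r * D j" using ID[of r j] by (simp add: comm_zero_iff)
      then show ?thesis by (cases "r = j") (simp_all add: mult.assoc [symmetric] IW left_diff_distrib, simp_all add: mult.assoc)
    qed
    then show ?thesis by (simp add: dl_def sum_distrib_left sum_distrib_right sum_subtractf)
  qed
  then show ?thesis
    by (simp add: Dc_def Ic_def sum_distrib_left sum_distrib_right sum_subtractf scaleR_diff_right)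
qed

text \<open>The part \<open>dl * Ic c\<close> of the defect of \<open>dv\<close> dies against the
  leading \<open>dl\<close>. Moving \<open>dl\<close> across \<open>2 * degS + degL\<close> adds 2 -
  1 to the constant n + 1.\<close>

lemma comm_N1_Lam: "comm N1 (Lam a b c) = - ((2 * degS + degL + of_nat (CARD('n) + 2)) * A c)"
proof -
  let ?S = "2 * degS + degL + of_nat (CARD('n) + 1)"
  have "comm N1 (Lam a b c) = - (dl * ?S * Dc c * ds + dl * dl * Ic c * ds)"
    unfolding N1_def by (simp add: comm_mult_left Lam_comm dv_Lam algebra_simps)
  also have "dl * ?S = (2 * degS + degL + of_nat (CARD('n) + 2)) * dl"
  proof -
    have "dl * degS = degS * dl + dl" "dl * degL = degL * dl - dl"
      using comm_dl(2,3) by (simp_all add: comm_eq_iff)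
    then show ?thesis by (simp add: distrib_left distrib_right mult_2 mult_of_nat_commute)
  qed
  finally show ?thesis by (simp add: dl_dl A_def mult.assoc)
qed

text \<open>Here \<open>dl * Ic c\<close> survives, but next to the trailing \<open>dl\<close> it
  becomes another \<open>B c\<close>. This adds 1 to the constant, while moving \<open>ds\<close>
  across the degrees subtracts 1.\<close>

lemma comm_N2_Lam: "comm N2 (Lam a b c) = - ((2 * degS + degL + of_nat (CARD('n) + 1)) * B c)"
proof -
  let ?S = "2 * degS + degL + of_nat (CARD('n) + 1)"
  have "comm N2 (Lam a b c) = - (ds * ?S * Dc c * dl + ds * dl * (Ic c * dl))"
    unfolding N2_def by (simp add: comm_mult_left Lam_comm dv_Lam algebra_simps)
  also have "ds * ?S = (2 * degS + degL + of_nat CARD('n)) * ds"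
  proof -
    have "ds * degS = degS * ds - ds" "ds * degL = degL * ds + ds"
      using comm_ds(2,3) by (simp_all add: comm_eq_iff)
    then show ?thesis by (simp add: distrib_left distrib_right mult_2 mult_of_nat_commute)
  qed
  also have "ds * dl * (Ic c * dl) = B c"
  proof -
    have "ds * dl * (Ic c * dl) = ds * (dl * Dc c) - ds * (dl * dl) * Ic c"
      by (simp add: Ic_dl algebra_simps)
    also have "dl * Dc c = Dc c * dl" using Dc_comm(1)[of c] by (simp add: comm_zero_iff)
    finally show ?thesis by (simp add: dl_dl B_def mult.assoc)
  qed
  finally show ?thesis by (simp add: B_def algebra_simps)
qed

text \<open>The left side is the form that interacts with \<open>N1\<close> and \<open>N2\<close>,
  the right side the one that the symbol calculus delivers in \<open>act_left_right\<close>.\<close>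

lemma AB_sum: "A c + B c = (degS + degL) * Dc c + dl * Ic c"
proof -
  have "A c = dl * (ds * Dc c + Ic c)"
    using Dc_comm(3)[of c] by (simp add: A_def mult.assoc comm_def algebra_simps)
  moreover have "B c = ds * dl * Dc c"
    using Dc_comm(1)[of c] by (simp add: B_def mult.assoc comm_zero_iff)
  ultimately show ?thesis by (simp add: ds_dl tot_def algebra_simps)
qed

lemma dl_ds_dl: "dl * ds * dl = tot * dl"
proof -
  have "dl * ds * dl = dl * tot - dl * dl * ds" by (simp add: mult.assoc ds_dl algebra_simps)
  then show ?thesis using comm_dl(4) by (simp add: dl_dl comm_zero_iff)
qed

lemma AB_N:
  "A c * N1 = N1 * A c" "B c * N2 = N2 * B c" "A c * N2 = 0" "B c * N1 = 0"
proof -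
  have dD: "dl * Dc c = Dc c * dl" and dV: "dl * dv = dv * dl" and VD: "dv * Dc c = Dc c * dv"
    using Dc_comm(1,2)[of c] dl_dv by (simp_all add: comm_zero_iff)
  have tD: "Dc c * tot = tot * Dc c + Dc c"
    using Dc_comm(4,5)[of c] by (simp add: comm_def tot_def algebra_simps)
  have tV: "dv * tot = tot * dv + dv"
    using comm_dv(4) by (simp add: comm_eq_iff)
  \<comment> \<open>x and y stand for \<open>Dc c\<close> and \<open>dv\<close>, which commute with
    \<open>dl\<close> and with each other and lower \<open>tot\<close> by one. The right side is
    symmetric in commuting x and y, so the two can be exchanged on the left; both commutation claims
    are instances.\<close>
  have key: "dl * x * ds * dl * y = tot * (x * y * dl) + x * y * dl"
    if "dl * x = x * dl" "dl * y = y * dl" "x * tot = tot * x + x" for x y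
  proof -
    have "dl * x * ds * dl * y = x * (dl * ds * dl) * y" by (simp add: that mult.assoc)
    also have "\<dots> = x * tot * (dl * y)" by (subst dl_ds_dl) (simp only: mult.assoc)
    finally show ?thesis by (simp add: that mult.assoc distrib_right)
  qed
  have "A c * N1 = dl * Dc c * ds * dl * dv * ds" by (simp add: A_def N1_def mult.assoc)
  also have "\<dots> = dl * dv * ds * dl * Dc c * ds"
    using key[of "Dc c" dv, OF dD dV tD] key[of dv "Dc c", OF dV dD tV] VD by simp
  finally show "A c * N1 = N1 * A c" by (simp add: A_def N1_def mult.assoc)
  have "B c * N2 = ds * (Dc c * dl * ds * dv * dl)" by (simp add: B_def N2_def mult.assoc)
  also have "Dc c * dl * ds * dv * dl = dl * Dc c * ds * dl * dv" by (simp add: dD dV mult.assoc)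
  also have "\<dots> = dl * dv * ds * dl * Dc c"
    using key[of "Dc c" dv, OF dD dV tD] key[of dv "Dc c", OF dV dD tV] VD by simp
  also have "ds * \<dots> = N2 * B c" by (simp add: B_def N2_def dD dV mult.assoc)
  finally show "B c * N2 = N2 * B c" .
  have "A c * N2 = dl * Dc c * (ds * ds) * dv * dl" by (simp only: A_def N2_def mult.assoc)
  then show "A c * N2 = 0" by (simp add: ds_ds)
  have "B c * N1 = ds * Dc c * (dl * dl) * dv * ds" by (simp only: B_def N1_def mult.assoc)
  then show "B c * N1 = 0" by (simp add: dl_dl)
qed

text \<open>A multiple of the Casimir operator; the coefficients are those for which all terms
  containing \<open>X\<close> or \<open>P\<close> cancel.\<close>

definition cas where "cas = (\<Sum>r\<in>UNIV. \<Sum>s\<in>UNIV. Gr r s * Gr s r) - 2 *\<^sub>R (\<Sum>r\<in>UNIV. Zr r * Tr r)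
   + (\<Sum>r\<in>UNIV. Gr r r) * (\<Sum>r\<in>UNIV. Gr r r) - (real CARD('n) + 1) *\<^sub>R (\<Sum>r\<in>UNIV. Gr r r)"

section \<open>Evaluation of the Casimir operator\<close>

lemma tot_P: "tot * P r = P r * tot"
  using comm_tot(5)[of r] by (simp add: comm_zero_iff)

lemma eul_P: "eul * P r = P r * eul - P r"
  using comm_eul(5)[of r] by (simp add: comm_eq_iff)

lemma sum_X_eul_P: "(\<Sum>r\<in>UNIV. X r * eul * P r) = eul * eul - eul"
proof -
  have "(\<Sum>r\<in>UNIV. X r * eul * P r) = (\<Sum>r\<in>UNIV. X r * P r * eul - X r * P r)"
    by (intro sum.cong refl) (simp add: mult.assoc eul_P right_diff_distrib)
  then show ?thesis by (simp only: sum_subtractf sum_distrib_right [symmetric] eul_def [symmetric])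
qed

lemma sum_Zr_Tr: "(\<Sum>r\<in>UNIV. Zr r * Tr r) = eul * eul - eul - (\<Sum>r\<in>UNIV. \<Sum>j\<in>UNIV. X j * E j r * P r) - eul * tot"
proof -
  have "(\<Sum>r\<in>UNIV. X r * tot * P r) = eul * tot"
    unfolding eul_def sum_distrib_right by (intro sum.cong refl) (simp add: mult.assoc tot_P)
  then show ?thesis
    by (simp add: Zr_def Tr_def left_diff_distrib sum_subtractf sum_distrib_right sum_X_eul_P)
qed

lemma sum_Gr: "(\<Sum>r\<in>UNIV. Gr r r) = eul - tot"
  by (simp add: Gr_def sum_subtractf eul_def tot_E)

lemma sum_Gr_Gr: "(\<Sum>r\<in>UNIV. \<Sum>s\<in>UNIV. Gr r s * Gr s r) = eul * eul - eul + of_nat CARD('n) * eul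
   - 2 *\<^sub>R (\<Sum>r\<in>UNIV. \<Sum>j\<in>UNIV. X j * E j r * P r) + (\<Sum>r\<in>UNIV. \<Sum>s\<in>UNIV. E r s * E s r)"
proof -
  have PE: "P r * E a b = E a b * P r" and XE: "X r * E a b = E a b * X r" for r a b
    using comm_E(5,6)[of r a b] by (simp_all add: comm_zero_iff)
  have "Gr r s * Gr s r = X s * (P r * X r) * P s - X s * E s r * P r - X r * E r s * P s + E r s * E s r" for r s
    unfolding Gr_def by (simp add: left_diff_distrib right_diff_distrib mult.assoc PE XE)
     (simp add: mult.assoc [symmetric] PE XE)
  then have "(\<Sum>r\<in>UNIV. \<Sum>s\<in>UNIV. Gr r s * Gr s r) = (\<Sum>r\<in>UNIV. \<Sum>s\<in>UNIV. X s * (P r * X r) * P s)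
      - (\<Sum>r\<in>UNIV. \<Sum>s\<in>UNIV. X s * E s r * P r) - (\<Sum>r\<in>UNIV. \<Sum>s\<in>UNIV. X r * E r s * P s)
      + (\<Sum>r\<in>UNIV. \<Sum>s\<in>UNIV. E r s * E s r)"
    by (simp add: sum.distrib sum_subtractf)
  also have "(\<Sum>r\<in>UNIV. \<Sum>s\<in>UNIV. X r * E r s * P s) = (\<Sum>r\<in>UNIV. \<Sum>s\<in>UNIV. X s * E s r * P r)"
    by (rule sum.swap)
  also have "(\<Sum>r\<in>UNIV. \<Sum>s\<in>UNIV. X s * (P r * X r) * P s) = (\<Sum>s\<in>UNIV. X s * (\<Sum>r\<in>UNIV. P r * X r) * P s)"
    by (subst sum.swap) (simp add: sum_distrib_left sum_distrib_right)
  also have "(\<Sum>r\<in>UNIV. P r * X r) = of_nat CARD('n) + eul"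
  proof -
    have "P r * X r = 1 + X r * P r" for r using PX[of r r] by (simp add: comm_def algebra_simps)
    then show ?thesis by (simp add: eul_def sum.distrib)
  qed
  also have "(\<Sum>s\<in>UNIV. X s * (of_nat CARD('n) + eul) * P s) = of_nat CARD('n) * eul + (eul * eul - eul)"
  proof -
    have "X s * (of_nat CARD('n) + eul) * P s = of_nat CARD('n) * (X s * P s) + X s * eul * P s" for s
      by (simp add: distrib_left distrib_right mult_of_nat_commute mult.assoc)
    then show ?thesis by (simp add: sum.distrib sum_X_eul_P sum_distrib_left [symmetric] eul_def [symmetric])
  qed
  finally show ?thesis by (simp add: scaleR_2 algebra_simps)
qed

text \<open>The quadratic Casimir of gl(n) on products of symmetric and exterior powers. Each pure
  factor gives a polynomial in its own degree; each of the two mixed sums gives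
  \<open>dl * ds - degL\<close>, the only source of a nonscalar term on homogeneous symbols.\<close>

lemma sum_E_E: "(\<Sum>r\<in>UNIV. \<Sum>s\<in>UNIV. E r s * E s r)
   = of_nat CARD('n) * tot + degS * degS - degS - degL * degL - degL + 2 *\<^sub>R (dl * ds)"
proof -
  have DMc: "D i * M j = M j * D i + (if i = j then 1 else 0)" for i j using DM[of i j] by (simp add: comm_def algebra_simps)
  have com: "M j * W i = W i * M j" "M j * I i = I i * M j" "D j * W i = W i * D j" "D j * I i = I i * D j" for i j
    using WM[of i j] IM[of i j] WD[of i j] ID[of i j] by (simp_all add: comm_zero_iff)
  have 1: "(\<Sum>r\<in>UNIV. \<Sum>s\<in>UNIV. M r * D s * (M s * D r)) = of_nat CARD('n) * degS + degS * degS - degS"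
  proof -
    have "(\<Sum>r\<in>UNIV. \<Sum>s\<in>UNIV. M r * D s * (M s * D r)) = (\<Sum>r\<in>UNIV. M r * (\<Sum>s\<in>UNIV. D s * M s) * D r)"
      by (simp add: sum_distrib_left sum_distrib_right mult.assoc)
    also have "\<dots> = (\<Sum>r\<in>UNIV. of_nat CARD('n) * (M r * D r) + M r * D r * degS - M r * D r)"
      unfolding sum_DM
      by (intro sum.cong refl) (simp add: distrib_left distrib_right mult_of_nat_commute mult.assoc D_degS)
    finally show ?thesis
      by (simp only: sum.distrib sum_subtractf sum_distrib_left [symmetric] sum_distrib_right [symmetric] degS_def [symmetric])
  qed
  have 2: "(\<Sum>r\<in>UNIV. \<Sum>s\<in>UNIV. W r * I s * (W s * I r)) = of_nat CARD('n) * degL - degL * degL + degL"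
  proof -
    have I_degL: "degL * I r = I r * degL - I r" for r using comm_degL(4)[of r] by (simp add: comm_def algebra_simps)
    have "(\<Sum>r\<in>UNIV. \<Sum>s\<in>UNIV. W r * I s * (W s * I r)) = (\<Sum>r\<in>UNIV. W r * (\<Sum>s\<in>UNIV. I s * W s) * I r)"
      by (simp add: sum_distrib_left sum_distrib_right mult.assoc)
    also have "\<dots> = (\<Sum>r\<in>UNIV. of_nat CARD('n) * (W r * I r) - W r * I r * degL + W r * I r)"
      unfolding sum_IW
      by (intro sum.cong refl) (simp add: left_diff_distrib right_diff_distrib mult_of_nat_commute mult.assoc I_degL)
    finally show ?thesis
      by (simp only: sum.distrib sum_subtractf sum_distrib_left [symmetric] sum_distrib_right [symmetric] degL_def [symmetric])
  qed
  have 3: "(\<Sum>r\<in>UNIV. \<Sum>s\<in>UNIV. W r * I s * (M s * D r)) = dl * ds - degL"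
  proof -
    have "W r * D r * (I s * M s) = W r * I s * (M s * D r) + (if r = s then W r * I r else 0)" for r s
    proof -
      have "W r * D r * (I s * M s) = W r * (D r * I s) * M s" by (simp add: mult.assoc)
      also have "\<dots> = W r * I s * (D r * M s)" by (simp add: com mult.assoc)
      finally show ?thesis by (simp add: DMc distrib_left)
    qed
    then show ?thesis by (simp add: dl_def ds_def sum_product sum.distrib degL_def)
  qed
  have "E r s * E s r = M r * D s * (M s * D r) + W r * I s * (W s * I r) + W r * I s * (M s * D r)
     + W s * I r * (M r * D s)" for r s
  proof -
    have "M r * D s * (W s * I r) = W s * I r * (M r * D s)" by (metis com mult.assoc)
    then show ?thesis by (simp add: E_def distrib_left distrib_right)
  qed
  then have "(\<Sum>r\<in>UNIV. \<Sum>s\<in>UNIV. E r s * E s r) = (of_nat CARD('n) * degS + degS * degS - degS)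
     + (of_nat CARD('n) * degL - degL * degL + degL) + (dl * ds - degL) + (\<Sum>r\<in>UNIV. \<Sum>s\<in>UNIV. W s * I r * (M r * D s))"
    by (simp only: sum.distrib 1 2 3)
  also have "(\<Sum>r\<in>UNIV. \<Sum>s\<in>UNIV. W s * I r * (M r * D s)) = dl * ds - degL"
    by (subst sum.swap) (rule 3)
  finally show ?thesis by (simp add: tot_def scaleR_2 algebra_simps)
qed

lemma cas_eq: "cas = (of_nat (2 * CARD('n)) + 1) * tot + tot * tot + degS * degS - degS - degL * degL - degL + 2 *\<^sub>R (dl * ds)"
proof -
  have "comm eul tot = 0"
    by (simp add: comm_sum_left eul_def comm_mult_left comm_tot)
  then have et: "tot * eul = eul * tot" by (simp add: comm_zero_iff)
  have n: "of_nat CARD('n) * x = real CARD('n) *\<^sub>R x" for x :: 'a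
    by (simp add: scaleR_conv_of_real)
  show ?thesis
    unfolding cas_def sum_Gr sum_Gr_Gr sum_Zr_Tr sum_E_E
    by (simp add: n et algebra_simps scaleR_2 mult_2)
qed

text \<open>Composing a differential operator on the right with multiplication by \<open>x\<^sub>s\<close> applies \<open>X s + D s\<close>
  to its symbol, and composing it with \<open>\<partial>\<^sub>j\<close> applies \<open>M j\<close> on the right and \<open>P j + M j\<close> on the left.
  So \<open>act_left\<close> and \<open>act_right\<close> give the symbols of \<open>L\<^sub>X \<circ> D\<close> and \<open>D \<circ> L\<^sub>X\<close>.\<close>

definition act_left where
  "act_left a b c = (\<Sum>j\<in>UNIV. a j *\<^sub>R (P j + M j)) + (\<Sum>j\<in>UNIV. \<Sum>s\<in>UNIV. b j s *\<^sub>R (X s * (P j + M j)))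
     + (\<Sum>j\<in>UNIV. \<Sum>r\<in>UNIV. c r *\<^sub>R (X r * X j * (P j + M j)))"

definition act_right where
  "act_right a b c = (\<Sum>j\<in>UNIV. a j *\<^sub>R M j) + (\<Sum>j\<in>UNIV. \<Sum>s\<in>UNIV. b j s *\<^sub>R (M j * (X s + D s)))
     + (\<Sum>j\<in>UNIV. \<Sum>r\<in>UNIV. c r *\<^sub>R (M j * (X j + D j) * (X r + D r)))
     + ((\<Sum>j\<in>UNIV. \<Sum>i\<in>UNIV. b j i *\<^sub>R (W j * I i)) + (\<Sum>j\<in>UNIV. \<Sum>i\<in>UNIV. c i *\<^sub>R (W j * I i * (X j + D j)))
     + (\<Sum>j\<in>UNIV. \<Sum>r\<in>UNIV. c r *\<^sub>R (W j * I j * (X r + D r))))"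

text \<open>The leading terms in \<open>M\<close> cancel, and for affine fields the rest is the Lie
  derivative. In a quadratic coefficient \<open>X + D\<close> occurs twice: the terms that keep a
  factor \<open>X\<close> complete \<open>Zr r\<close>, and those without one sum to
  \<open>(degS + degL) * D r + dl * I r\<close>, which \<open>AB_sum\<close> recognizes.\<close>

lemma act_left_right: "act_left a b c - act_right a b c = Lam a b c - A c - B c"
proof -
  have com: "M i * X j = X j * M i" "D i * X j = X j * D i" "W i * X j = X j * W i" "I i * X j = X j * I i"
     "I i * D j = D j * I i" "X i * X j = X j * X i" for i j
    using MX[of i j] DX[of i j] WX[of i j] IX[of i j] ID[of i j] XX[of i j] by (simp_all add: comm_zero_iff)
  have coml: "M i * (X j * y) = X j * (M i * y)" "D i * (X j * y) = X j * (D i * y)" "W i * (X j * y) = X j * (W i * y)"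
     "I i * (X j * y) = X j * (I i * y)" "X i * (X j * y) = X j * (X i * y)" for i j y
    by (metis com mult.assoc)+
  have b: "X s * (P j + M j) - M j * (X s + D s) - W j * I s = Gr j s" for j s
    by (simp add: Gr_def E_def com distrib_left)
  have c: "X r * X j * (P j + M j) - M j * (X j + D j) * (X r + D r) - W j * I r * (X j + D j) - W j * I j * (X r + D r)
     = X r * (X j * P j) - X j * E j r - X r * E j j - M j * D j * D r - W j * D j * I r - W j * I j * D r" for j r
  proof -
    have "M j * (X j + D j) * (X r + D r) = X r * X j * M j + X j * (M j * D r) + X r * (M j * D j) + M j * D j * D r"
      by (simp add: distrib_left distrib_right mult.assoc com coml)
    moreover have "W j * I r * (X j + D j) = X j * (W j * I r) + W j * D j * I r"
      "W j * I j * (X r + D r) = X r * (W j * I j) + W j * I j * D r"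
      by (simp_all add: distrib_left mult.assoc com coml)
    ultimately show ?thesis by (simp add: E_def algebra_simps)
  qed
  have c': "(\<Sum>j\<in>UNIV. X r * (X j * P j) - X j * E j r - X r * E j j - M j * D j * D r - W j * D j * I r - W j * I j * D r)
     = Zr r - (degS + degL) * D r - dl * I r" for r
    unfolding Zr_def tot_E eul_def degS_def degL_def dl_def sum_subtractf
    by (simp add: sum_distrib_left sum_distrib_right distrib_right)
  have "act_left a b c - act_right a b c = (\<Sum>j\<in>UNIV. a j *\<^sub>R P j)
    + (\<Sum>j\<in>UNIV. \<Sum>s\<in>UNIV. b j s *\<^sub>R (X s * (P j + M j) - M j * (X s + D s) - W j * I s))
    + (\<Sum>j\<in>UNIV. \<Sum>r\<in>UNIV. c r *\<^sub>R (X r * X j * (P j + M j) - M j * (X j + D j) * (X r + D r)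
        - W j * I r * (X j + D j) - W j * I j * (X r + D r)))"
    unfolding act_left_def act_right_def scaleR_diff_right sum_subtractf scaleR_add_right sum.distrib by simp
  also have "(\<Sum>j\<in>UNIV. \<Sum>r\<in>UNIV. c r *\<^sub>R (X r * X j * (P j + M j) - M j * (X j + D j) * (X r + D r)
        - W j * I r * (X j + D j) - W j * I j * (X r + D r)))
      = (\<Sum>r\<in>UNIV. c r *\<^sub>R (Zr r - (degS + degL) * D r - dl * I r))"
    by (subst sum.swap) (simp only: c c' scaleR_sum_right [symmetric])
  also have "\<dots> = (\<Sum>r\<in>UNIV. c r *\<^sub>R Zr r) - ((degS + degL) * Dc c + dl * Ic c)"
    by (simp add: Dc_def Ic_def scaleR_diff_right sum_subtractf sum_distrib_left)
  finally show ?thesis by (simp add: b Lam_def Tr_def AB_sum [symmetric])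
qed

end

section \<open>Smooth functions and iterated partial derivatives\<close>

lemma has_derivative_pd:
  assumes "(f has_derivative f') (at x)"
  shows "pd j f x = f' (axis j 1)"
  unfolding pd_def using frechet_derivative_at[OF assms] by simp

lemma pd_add:
  assumes "f differentiable (at x)" "g differentiable (at x)"
  shows "pd j (\<lambda>x. f x + g x) x = pd j f x + pd j g x"
  using has_derivative_pd[OF has_derivative_add[OF assms[THEN frechet_derivative_works[THEN iffD1]]], of j]
  by (simp add: pd_def)

lemma pd_mult:
  assumes "f differentiable (at x)" "g differentiable (at x)"
  shows "pd j (\<lambda>x. f x * g x) x = f x * pd j g x + pd j f x * g x"
  using has_derivative_pd[OF has_derivative_mult[OF assms[THEN frechet_derivative_works[THEN iffD1]]], of j]
  by (simp add: pd_def)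

lemma pd_const [simp]: "pd j (\<lambda>_. c) x = 0"
  by (simp add: pd_def)

lemma pd_cmult:
  assumes "f differentiable (at x)"
  shows "pd j (\<lambda>x. c * f x) x = c * pd j f x"
  using pd_mult[OF differentiable_const assms] by simp

lemma differentiable_coord [simp]: "(\<lambda>x. x $ s) differentiable (at (x :: real^'n::finite))"
  by (rule bounded_linear_imp_differentiable) (rule bounded_linear_vec_nth)

lemma pd_coord: "pd j (\<lambda>x. x $ s) x = (if j = s then 1 else 0)"
proof -
  have "((\<lambda>x. x $ s) has_derivative (\<lambda>h. h $ s)) (at x)"
    by (intro bounded_linear.has_derivative[OF bounded_linear_vec_nth] has_derivative_ident)
  from has_derivative_pd[OF this, of j] show ?thesis by (simp add: axis_def)
qed

lemma smooth_differentiable: "smooth f \<Longrightarrow> f differentiable (at x)"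
  unfolding smooth_def by (drule spec[of _ "[]"]) (simp add: iter_pd_def)

lemma smooth_pd: "smooth f \<Longrightarrow> smooth (pd j f)"
  unfolding smooth_def
proof (intro allI)
  fix js x assume "\<forall>js x. iter_pd js f differentiable (at x)"
  from this[rule_format, of "js @ [j]" x] show "iter_pd js (pd j f) differentiable (at x)"
    by (simp add: iter_pd_def)
qed

text \<open>Smooth functions form the largest class of differentiable functions closed under partial
  derivatives, so closure properties follow by exhibiting such a class.\<close>

lemma smooth_coinduct:
  assumes "f \<in> S" "\<And>f x. f \<in> S \<Longrightarrow> f differentiable (at x)" "\<And>f j. f \<in> S \<Longrightarrow> pd j f \<in> S"
  shows "smooth f"
proof -
  have "iter_pd js f \<in> S" for js
    by (induction js) (simp_all add: iter_pd_def assms)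
  then show ?thesis by (simp add: smooth_def assms(2))
qed

section \<open>Closure of smooth functions under algebraic operations\<close>

lemma smooth_const [simp, intro]: "smooth (\<lambda>_. c)"
  by (rule smooth_coinduct[where S = "{\<lambda>_. c, \<lambda>_. 0}"]) auto

lemma smooth_add:
  assumes "smooth f" "smooth g"
  shows "smooth (\<lambda>x. f x + g x)"
proof (rule smooth_coinduct[where S = "{\<lambda>x. f x + g x | f g. smooth f \<and> smooth g}"])
  fix h j assume "h \<in> {\<lambda>x. f x + g x | f g. smooth f \<and> smooth g}"
  then obtain f g where "h = (\<lambda>x. f x + g x)" and s: "smooth f" "smooth g" by auto
  then have "pd j h = (\<lambda>x. pd j f x + pd j g x)"
    by (auto intro!: ext simp: pd_add smooth_differentiable)
  with s show "pd j h \<in> {\<lambda>x. f x + g x | f g. smooth f \<and> smooth g}"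
    using smooth_pd by blast
qed (use assms in \<open>auto simp: differentiable_add smooth_differentiable\<close>)

text \<open>Products alone are not closed under \<open>pd\<close>; by the Leibniz rule their sums
  are, and so they can serve as the class in \<open>smooth_coinduct\<close>.\<close>

inductive_set smooth_products :: "(real^'n::finite \<Rightarrow> real) set" where
  "smooth f \<Longrightarrow> smooth g \<Longrightarrow> (\<lambda>x. f x * g x) \<in> smooth_products"
| "f \<in> smooth_products \<Longrightarrow> g \<in> smooth_products \<Longrightarrow> (\<lambda>x. f x + g x) \<in> smooth_products"

lemma smooth_mult:
  assumes "smooth f" "smooth g"
  shows "smooth (\<lambda>x. f x * g x)"
proof (rule smooth_coinduct[where S = smooth_products])
  show "(\<lambda>x. f x * g x) \<in> smooth_products" using assms by (rule smooth_products.intros)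
  show diff: "h differentiable (at x)" if "h \<in> smooth_products" for h and x :: "real^'a"
    using that by induction (simp_all add: smooth_differentiable differentiable_mult differentiable_add)
  show "pd j h \<in> smooth_products" if "h \<in> smooth_products" for h and j :: 'a
    using that
  proof induction
    case (1 f g)
    then have "pd j (\<lambda>x. f x * g x) = (\<lambda>x. f x * pd j g x + pd j f x * g x)"
      by (intro ext) (simp add: pd_mult smooth_differentiable)
    with 1 show ?case by (simp add: smooth_products.intros smooth_pd)
  next
    case (2 f g)
    then have "pd j (\<lambda>x. f x + g x) = (\<lambda>x. pd j f x + pd j g x)"
      by (intro ext) (simp add: pd_add diff)
    with 2 show ?case by (simp add: smooth_products.intros)
  qed
qed

lemma smooth_coord [simp]: "smooth (\<lambda>x. x $ s)"
proof (rule smooth_coinduct[where S = "insert (\<lambda>x. x $ s) (range (\<lambda>c _. c))"])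
  fix f :: "real^'a \<Rightarrow> real" and j :: 'a and x :: "real^'a"
  assume f: "f \<in> insert (\<lambda>x. x $ s) (range (\<lambda>c _. c))"
  show "f differentiable (at x)" using f by auto
  have "pd j (\<lambda>x. x $ s) = (\<lambda>_. if j = s then 1 else 0)" by (intro ext) (rule pd_coord)
  moreover have "pd j (\<lambda>_. c) = (\<lambda>_. 0)" for c by (intro ext) simp
  ultimately show "pd j f \<in> insert (\<lambda>x. x $ s) (range (\<lambda>c _. c))" using f by auto
qed simp

lemma smooth_coord_mult: "smooth f \<Longrightarrow> smooth (\<lambda>x. x $ s * f x)"
  by (intro smooth_mult smooth_coord)

lemma smooth_cmult: "smooth f \<Longrightarrow> smooth (\<lambda>x. c * f x)"
  by (intro smooth_mult smooth_const)

lemma smooth_minus: "smooth f \<Longrightarrow> smooth (\<lambda>x. - f x)"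
  using smooth_cmult[of f "-1"] by simp

lemma smooth_diff: "smooth f \<Longrightarrow> smooth g \<Longrightarrow> smooth (\<lambda>x. f x - g x)"
  using smooth_add[of f "\<lambda>x. - g x"] smooth_minus[of g] by simp

lemma smooth_sum: "(\<And>i. i \<in> S \<Longrightarrow> smooth (f i)) \<Longrightarrow> smooth (\<lambda>x. \<Sum>i\<in>S. f i x)"
  by (induction S rule: infinite_finite_induct) (simp_all add: smooth_add)

lemma pd_sum:
  "(\<And>i. i \<in> S \<Longrightarrow> smooth (f i)) \<Longrightarrow> pd j (\<lambda>x. \<Sum>i\<in>S. f i x) x = (\<Sum>i\<in>S. pd j (f i) x)"
  by (induction S rule: infinite_finite_induct) (simp_all add: pd_add smooth_differentiable smooth_sum)

lemma pd_line:
  assumes "smooth f"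
  shows "((\<lambda>s. f (y + s *\<^sub>R axis i 1)) has_real_derivative pd i f (y + s *\<^sub>R axis i 1)) (at s)"
proof -
  have "(f has_derivative frechet_derivative f (at (y + s *\<^sub>R axis i 1))) (at (y + s *\<^sub>R axis i 1))"
    using assms smooth_differentiable frechet_derivative_works by blast
  moreover have "((\<lambda>s. y + s *\<^sub>R axis i 1) has_derivative (\<lambda>h. h *\<^sub>R axis i 1)) (at s)"
    by (auto intro!: derivative_eq_intros)
  ultimately have "((\<lambda>s. f (y + s *\<^sub>R axis i 1)) has_derivative
      (\<lambda>h. frechet_derivative f (at (y + s *\<^sub>R axis i 1)) (h *\<^sub>R axis i 1))) (at s)"
    by (rule has_derivative_compose[rotated])
  moreover have "frechet_derivative f (at z) (h *\<^sub>R axis i 1) = pd i f z * h" for h z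
    using linear_frechet_derivative[OF smooth_differentiable[OF assms]]
    by (simp add: pd_def linear_cmul)
  ultimately show ?thesis by (simp add: has_field_derivative_def)
qed

text \<open>The mean value theorem is applied in direction i to a difference in direction j, and
  then in direction j to \<open>pd i f\<close>. The left side is symmetric in i and j, which
  \<open>pd_commute\<close> exploits.\<close>

lemma second_difference:
  assumes "smooth f" "h > 0"
  shows "\<exists>s t. 0 < s \<and> s < h \<and> 0 < t \<and> t < h \<and>
     f (x + h *\<^sub>R axis i 1 + h *\<^sub>R axis j 1) - f (x + h *\<^sub>R axis i 1) - f (x + h *\<^sub>R axis j 1) + f x
     = h * h * pd j (pd i f) (x + s *\<^sub>R axis i 1 + t *\<^sub>R axis j 1)"
proof -
  define \<phi> where "\<phi> s = f (x + h *\<^sub>R axis j 1 + s *\<^sub>R axis i 1) - f (x + s *\<^sub>R axis i 1)" for s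
  have "DERIV \<phi> s :> pd i f (x + h *\<^sub>R axis j 1 + s *\<^sub>R axis i 1) - pd i f (x + s *\<^sub>R axis i 1)" for s
    unfolding \<phi>_def by (intro DERIV_diff pd_line assms)
  from MVT2[OF assms(2) this] obtain s where s: "0 < s" "s < h"
    and 1: "\<phi> h - \<phi> 0 = h * (pd i f (x + h *\<^sub>R axis j 1 + s *\<^sub>R axis i 1) - pd i f (x + s *\<^sub>R axis i 1))"
    by auto
  have "DERIV (\<lambda>t. pd i f (x + s *\<^sub>R axis i 1 + t *\<^sub>R axis j 1)) t
     :> pd j (pd i f) (x + s *\<^sub>R axis i 1 + t *\<^sub>R axis j 1)" for t
    by (intro pd_line smooth_pd assms)
  from MVT2[OF assms(2) this] obtain t where t: "0 < t" "t < h"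
    and 2: "pd i f (x + s *\<^sub>R axis i 1 + h *\<^sub>R axis j 1) - pd i f (x + s *\<^sub>R axis i 1)
       = h * pd j (pd i f) (x + s *\<^sub>R axis i 1 + t *\<^sub>R axis j 1)"
    by auto
  have "\<phi> h - \<phi> 0 = h * (h * pd j (pd i f) (x + s *\<^sub>R axis i 1 + t *\<^sub>R axis j 1))"
    unfolding 1 2 [symmetric] by (simp add: add_ac)
  with s t show ?thesis
    by (intro exI[of _ s] exI[of _ t]) (simp add: \<phi>_def algebra_simps)
qed

theorem pd_commute:
  assumes "smooth f"
  shows "pd i (pd j f) = pd j (pd i f)"
proof (rule ext, rule ccontr)
  fix x assume ne: "pd i (pd j f) x \<noteq> pd j (pd i f) x"
  \<comment> \<open>Half the gap: the two mixed derivatives will take equal values at two points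
    near x, yet each stays within e of its own value at x.\<close>
  define e where "e = \<bar>pd i (pd j f) x - pd j (pd i f) x\<bar> / 2"
  have "e > 0" using ne by (simp add: e_def)
  have cont: "isCont (pd i (pd j f)) x" for i j
    by (intro differentiable_imp_continuous_within smooth_differentiable smooth_pd assms)
  obtain d1 where d1: "d1 > 0" "\<And>y. dist y x < d1 \<Longrightarrow> \<bar>pd i (pd j f) y - pd i (pd j f) x\<bar> < e"
    using cont[of i j] \<open>e > 0\<close> unfolding continuous_at_eps_delta dist_real_def by blast
  obtain d2 where d2: "d2 > 0" "\<And>y. dist y x < d2 \<Longrightarrow> \<bar>pd j (pd i f) y - pd j (pd i f) x\<bar> < e"
    using cont[of j i] \<open>e > 0\<close> unfolding continuous_at_eps_delta dist_real_def by blast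
  define h where "h = min d1 d2 / 2"
  have h: "h > 0" "2 * h \<le> d1" "2 * h \<le> d2" using d1 d2 by (simp_all add: h_def)
  have near: "dist (x + s *\<^sub>R axis k 1 + t *\<^sub>R axis l 1) x < 2 * h"
    if "0 < s" "s < h" "0 < t" "t < h" for s t and k l :: 'a
  proof -
    have "norm (s *\<^sub>R axis k 1 + t *\<^sub>R axis l (1::real)) \<le> \<bar>s\<bar> + \<bar>t\<bar>"
      by (rule order_trans[OF norm_triangle_ineq]) simp
    then show ?thesis using that by (simp add: dist_norm add.assoc)
  qed
  obtain s t where st: "0 < s" "s < h" "0 < t" "t < h" and
     1: "f (x + h *\<^sub>R axis i 1 + h *\<^sub>R axis j 1) - f (x + h *\<^sub>R axis i 1) - f (x + h *\<^sub>R axis j 1) + f x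
     = h * h * pd j (pd i f) (x + s *\<^sub>R axis i 1 + t *\<^sub>R axis j 1)"
    using second_difference[OF assms h(1)] by blast
  obtain s' t' where st': "0 < s'" "s' < h" "0 < t'" "t' < h" and
     2: "f (x + h *\<^sub>R axis j 1 + h *\<^sub>R axis i 1) - f (x + h *\<^sub>R axis j 1) - f (x + h *\<^sub>R axis i 1) + f x
     = h * h * pd i (pd j f) (x + s' *\<^sub>R axis j 1 + t' *\<^sub>R axis i 1)"
    using second_difference[OF assms h(1)] by blast
  have "h * h * pd j (pd i f) (x + s *\<^sub>R axis i 1 + t *\<^sub>R axis j 1)
     = h * h * pd i (pd j f) (x + s' *\<^sub>R axis j 1 + t' *\<^sub>R axis i 1)"
    unfolding 1 [symmetric] 2 [symmetric] by (simp add: add_ac)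
  then have "pd j (pd i f) (x + s *\<^sub>R axis i 1 + t *\<^sub>R axis j 1)
     = pd i (pd j f) (x + s' *\<^sub>R axis j 1 + t' *\<^sub>R axis i 1)" using h by simp
  moreover have "\<bar>pd j (pd i f) (x + s *\<^sub>R axis i 1 + t *\<^sub>R axis j 1) - pd j (pd i f) x\<bar> < e"
    using near[OF st, of i j] h by (intro d2) linarith
  moreover have "\<bar>pd i (pd j f) (x + s' *\<^sub>R axis j 1 + t' *\<^sub>R axis i 1) - pd i (pd j f) x\<bar> < e"
    using near[OF st', of j i] h by (intro d1) linarith
  ultimately show False using e_def by (simp add: abs_if split: if_splits)
qed

section \<open>Independence of the order of differentiation, and derivatives for
  multi-indices\<close>

lemma iter_pd_simps [simp]: "iter_pd [] f = f" "iter_pd (j # js) f = pd j (iter_pd js f)"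
  "iter_pd (js @ ks) f = iter_pd js (iter_pd ks f)"
  by (simp_all add: iter_pd_def)

lemma smooth_iter_pd: "smooth f \<Longrightarrow> smooth (iter_pd js f)"
  by (induction js) (simp_all add: smooth_pd)

lemma pd_iter_pd: "smooth f \<Longrightarrow> pd j (iter_pd js f) = iter_pd js (pd j f)"
  by (induction js) (simp_all add: pd_commute[of _ j] smooth_iter_pd)

lemma iter_pd_mset:
  "smooth f \<Longrightarrow> mset js = mset ks \<Longrightarrow> iter_pd js f = iter_pd ks f"
proof (induction js arbitrary: ks)
  case (Cons j js)
  then have "j \<in> set ks" by (metis list.set_intros(1) set_mset_mset)
  then obtain as bs where ks: "ks = as @ j # bs" by (meson split_list)
  with Cons.prems have "mset js = mset (as @ bs)" by simp
  then have "iter_pd js f = iter_pd (as @ bs) f" using Cons by blast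
  then show ?case by (simp add: ks pd_iter_pd[symmetric] smooth_iter_pd Cons.prems(1))
qed simp

lemma multi_pd_eq:
  assumes "smooth f" "\<And>i. count_list js i = \<alpha> i"
  shows "multi_pd \<alpha> f = iter_pd js f"
proof -
  have "\<forall>i. count_list (SOME js. \<forall>i. count_list js i = \<alpha> i) i = \<alpha> i"
    by (rule someI[of _ js]) (simp add: assms)
  then have "mset (SOME js. \<forall>i. count_list js i = \<alpha> i) = mset js"
    by (intro multiset_eqI) (simp add: count_mset assms)
  then show ?thesis unfolding multi_pd_def by (rule iter_pd_mset[OF assms(1)])
qed

lemma multi_index_list:
  fixes \<alpha> :: "'n::finite \<Rightarrow> nat"
  shows "\<exists>js. \<forall>i. count_list js i = \<alpha> i"
proof -
  obtain js where "mset js = (\<Sum>i\<in>UNIV. replicate_mset (\<alpha> i) i)" using ex_mset by blast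
  then have "count (mset js) i = \<alpha> i" for i by (simp add: count_sum)
  then show ?thesis by (auto simp: count_mset)
qed

lemma multi_pd_zero [simp]: "smooth f \<Longrightarrow> multi_pd (\<lambda>_. 0) f = f"
  using multi_pd_eq[of f "[]"] by simp

lemma multi_pd_Suc: "smooth f \<Longrightarrow> multi_pd (\<alpha>(j := Suc (\<alpha> j))) f = pd j (multi_pd \<alpha> f)"
  and multi_pd_pd: "smooth f \<Longrightarrow> multi_pd \<alpha> (pd j f) = pd j (multi_pd \<alpha> f)"
proof -
  obtain js where js: "\<And>i. count_list js i = \<alpha> i" using multi_index_list by metis
  assume f: "smooth f"
  have "multi_pd \<alpha> f = iter_pd js f" by (rule multi_pd_eq[OF f js])
  moreover have "multi_pd (\<alpha>(j := Suc (\<alpha> j))) f = iter_pd (j # js) f" by (rule multi_pd_eq[OF f]) (simp add: js)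
  ultimately show "multi_pd (\<alpha>(j := Suc (\<alpha> j))) f = pd j (multi_pd \<alpha> f)" by simp
  have "multi_pd \<alpha> (pd j f) = iter_pd js (pd j f)" by (rule multi_pd_eq[OF smooth_pd[OF f] js])
  then show "multi_pd \<alpha> (pd j f) = pd j (multi_pd \<alpha> f)"
    by (simp add: \<open>multi_pd \<alpha> f = iter_pd js f\<close> pd_iter_pd f)
qed

lemma smooth_multi_pd: "smooth f \<Longrightarrow> smooth (multi_pd \<alpha> f)"
  by (simp add: multi_pd_def smooth_iter_pd)

lemma iter_pd_add: "smooth f \<Longrightarrow> smooth g \<Longrightarrow> iter_pd js (\<lambda>x. f x + g x) = (\<lambda>x. iter_pd js f x + iter_pd js g x)"
  by (induction js) (auto intro!: ext simp: pd_add smooth_differentiable smooth_iter_pd)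

lemma iter_pd_cmult: "smooth f \<Longrightarrow> iter_pd js (\<lambda>x. c * f x) = (\<lambda>x. c * iter_pd js f x)"
  by (induction js) (auto intro!: ext simp: pd_cmult smooth_differentiable smooth_iter_pd)

lemma multi_pd_add: "smooth f \<Longrightarrow> smooth g \<Longrightarrow> multi_pd \<alpha> (\<lambda>x. f x + g x) = (\<lambda>x. multi_pd \<alpha> f x + multi_pd \<alpha> g x)"
  by (simp add: multi_pd_def iter_pd_add)

lemma multi_pd_cmult: "smooth f \<Longrightarrow> multi_pd \<alpha> (\<lambda>x. c * f x) = (\<lambda>x. c * multi_pd \<alpha> f x)"
  by (simp add: multi_pd_def iter_pd_cmult)

lemma iter_pd_coord_mult:
  assumes "smooth f"
  shows "iter_pd js (\<lambda>x. x $ j * f x) = (\<lambda>x. x $ j * iter_pd js f x + real (count_list js j) * iter_pd (remove1 j js) f x)"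
proof (induction js)
  case (Cons i js)
  have "pd i (\<lambda>x. x $ j * iter_pd js f x + real (count_list js j) * iter_pd (remove1 j js) f x) x
     = x $ j * pd i (iter_pd js f) x + (if i = j then iter_pd js f x else 0)
       + real (count_list js j) * pd i (iter_pd (remove1 j js) f) x" for x
    by (simp add: pd_add pd_mult pd_coord smooth_differentiable differentiable_mult smooth_iter_pd assms)
  \<comment> \<open>\<open>pd j\<close> restores the entry taken away by \<open>remove1\<close>.
    Without an entry j nothing is taken away, but then the coefficient
    \<open>count_list js j\<close> is zero.\<close>
  moreover have "pd j (iter_pd (remove1 j js) f) = iter_pd js f" if "count_list js j \<noteq> 0"
  proof -
    have "j \<in> set js" using that by (metis count_notin)
    then have "mset (j # remove1 j js) = mset js" by simp
    from iter_pd_mset[OF assms this] show ?thesis by simp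
  qed
  ultimately show ?case
    unfolding iter_pd_simps(2) Cons
    by (cases "i = j"; cases "count_list js j = 0") (auto intro!: ext simp: distrib_right)
qed simp

lemma multi_pd_coord_mult:
  assumes "smooth f"
  shows "multi_pd \<alpha> (\<lambda>x. x $ j * f x) = (\<lambda>x. x $ j * multi_pd \<alpha> f x + real (\<alpha> j) * multi_pd (\<alpha>(j := \<alpha> j - 1)) f x)"
proof -
  obtain js where js: "\<And>i. count_list js i = \<alpha> i" using multi_index_list by metis
  have "count_list (remove1 j js) i = (\<alpha>(j := \<alpha> j - 1)) i" for i
    by (auto simp: js[symmetric] count_mset[symmetric])
  note * = multi_pd_eq[OF assms this] multi_pd_eq[OF assms js] multi_pd_eq[OF smooth_coord_mult[OF assms] js]
  show ?thesis unfolding * by (simp add: iter_pd_coord_mult[OF assms] js)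
qed

section \<open>Alternating arrays\<close>

text \<open>Only neighbours are exchanged, and lists of all lengths are treated alike, so induction
  along lists applies. \<open>alternating_iff\<close> links this to the exchange of arbitrary
  positions in \<open>alt_arrays\<close>.\<close>

definition alternating :: "('n list \<Rightarrow> real) \<Rightarrow> bool" where
  "alternating A \<longleftrightarrow> (\<forall>xs a b ys. A (xs @ a # b # ys) = - A (xs @ b # a # ys))"

lemma alternatingD: "alternating A \<Longrightarrow> A (xs @ a # b # ys) = - A (xs @ b # a # ys)"
  unfolding alternating_def by blast

text \<open>Each entry in between is passed by both exchanged entries, so its two signs
  cancel.\<close>

lemma alternating_swap:
  "alternating A \<Longrightarrow> A (xs @ a # ys @ b # zs) = - A (xs @ b # ys @ a # zs)"
proof (induction ys arbitrary: xs)
  case Nil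
  then show ?case using alternatingD[of A xs a b zs] by simp
next
  case (Cons y ys)
  have "A (xs @ a # (y # ys) @ b # zs) = - A ((xs @ [y]) @ a # ys @ b # zs)"
    using alternatingD[OF Cons.prems, of xs a y] by simp
  also have "\<dots> = A (xs @ y # b # (ys @ a # zs))"
    using Cons.IH[OF Cons.prems, of "xs @ [y]"] by simp
  also have "\<dots> = - A (xs @ b # (y # ys) @ a # zs)"
    using alternatingD[OF Cons.prems, of xs y b] by simp
  finally show ?case .
qed

lemma split_at_two:
  assumes "s < t" "t < length I"
  obtains xs a ys b zs where "I = xs @ a # ys @ b # zs" "s = length xs" "t = length xs + Suc (length ys)"
proof -
  have "s < length I" using assms by (rule less_trans)
  then have 1: "I = take s I @ I ! s # drop (Suc s) I" and ls: "length (take s I) = s"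
    by (rule id_take_nth_drop, simp)
  define J where "J = drop (Suc s) I"
  define r where "r = t - Suc s"
  have r: "r < length J" and t: "t = s + Suc r" using assms by (simp_all add: J_def r_def)
  then have 2: "J = take r J @ J ! r # drop (Suc r) J" and lr: "length (take r J) = r"
    by (rule_tac id_take_nth_drop, simp_all)
  have "I = take s I @ I ! s # take r J @ J ! r # drop (Suc r) J"
    using 1 unfolding J_def [symmetric] 2 [symmetric] .
  then show thesis
    by (rule that) (simp_all only: ls lr t)
qed

lemma alternating_iff:
  "alternating A \<longleftrightarrow>
     (\<forall>I s t. s < length I \<longrightarrow> t < length I \<longrightarrow> s \<noteq> t \<longrightarrow> A (I[s := I ! t, t := I ! s]) = - A I)"
    (is "_ = ?R")
proof
  assume alt: "alternating A"
  have swap: "A (I[s := I ! t, t := I ! s]) = - A I" if "s < t" "t < length I" for I s t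
  proof -
    from that obtain xs a ys b zs where I: "I = xs @ a # ys @ b # zs" "s = length xs" "t = length xs + Suc (length ys)"
      by (rule split_at_two)
    have "I[s := I ! t, t := I ! s] = xs @ b # ys @ a # zs"
      by (simp add: I list_update_append nth_append)
    then show ?thesis using alternating_swap[OF alt, of xs b ys a zs] by (simp only: I)
  qed
  show ?R
    by (metis swap list_update_swap linorder_neqE_nat)
next
  assume *: ?R
  show "alternating A" unfolding alternating_def
  proof (intro allI)
    fix xs :: "'a list" and a b ys
    define I where "I = xs @ b # a # ys"
    have "A (I[length xs := I ! Suc (length xs), Suc (length xs) := I ! length xs]) = - A I"
      by (intro *[rule_format]) (simp_all add: I_def)
    moreover have "I[length xs := I ! Suc (length xs), Suc (length xs) := I ! length xs] = xs @ a # b # ys"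
      by (simp add: I_def list_update_append nth_append)
    ultimately show "A (xs @ a # b # ys) = - A (xs @ b # a # ys)"
      by (simp only: I_def)
  qed
qed

lemma alt_arrays_iff: "A \<in> alt_arrays p \<longleftrightarrow> alternating A \<and> (\<forall>I. length I \<noteq> p \<longrightarrow> A I = 0)"
  unfolding alt_arrays_def mem_Collect_eq alternating_iff by (rule conj_commute)

section \<open>Exterior and interior products on arrays\<close>

lemma wedge_basis_Nil [simp]: "wedge_basis j A [] = 0"
  by (simp add: wedge_basis_def)

text \<open>The antiderivation rule for contraction with the first index; it replaces the explicit
  signed sum in inductions along lists.\<close>

lemma wedge_basis_Cons:
  "wedge_basis j A (x # I) = (if x = j then A I else 0) - wedge_basis j (contract_basis x A) I"
proof -
  have "(\<Sum>s<length I. if I ! s = j then (- 1) ^ Suc s * A (x # take s I @ drop (Suc s) I) else 0)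
     = - (\<Sum>s<length I. if I ! s = j then (- 1) ^ s * A (x # take s I @ drop (Suc s) I) else 0)"
    unfolding sum_negf [symmetric] by (intro sum.cong) auto
  then show ?thesis
    unfolding wedge_basis_def contract_basis_def length_Cons sum.lessThan_Suc_shift by (simp cong: if_cong)
qed

lemma alternating_contract: "alternating A \<Longrightarrow> alternating (contract_basis j A)"
  unfolding alternating_def contract_basis_def by (metis append_Cons)

lemma contract_contract: "alternating A \<Longrightarrow> contract_basis i (contract_basis j A) = - contract_basis j (contract_basis i A)"
  using alternatingD[of A "[]" j i] by (intro ext) (simp add: contract_basis_def)

lemma wedge_basis_add: "wedge_basis j (\<lambda>I. A I + B I) I = wedge_basis j A I + wedge_basis j B I"
  unfolding wedge_basis_def sum.distrib [symmetric] by (intro sum.cong refl) (simp add: distrib_left)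

lemma wedge_basis_cmult: "wedge_basis j (\<lambda>I. c * A I) I = c * wedge_basis j A I"
  unfolding wedge_basis_def sum_distrib_left by (intro sum.cong refl) simp

lemma wedge_basis_zero: "wedge_basis j (\<lambda>I. 0) I = 0"
  using wedge_basis_cmult[of j 0 "\<lambda>_. 0"] by simp

lemma wedge_basis_minus: "wedge_basis j (\<lambda>I. - A I) I = - wedge_basis j A I"
  using wedge_basis_cmult[of j "-1" A] by simp

lemma wedge_basis_diff: "wedge_basis j (\<lambda>I. A I - B I) I = wedge_basis j A I - wedge_basis j B I"
  using wedge_basis_add[of j A "\<lambda>I. - B I"] by (simp add: wedge_basis_minus)

lemmas wedge_basis_linear = wedge_basis_add wedge_basis_cmult wedge_basis_zero wedge_basis_minus wedge_basis_diff

lemma contract_wedge: "contract_basis i (wedge_basis j A) I = (if i = j then A I else 0) - wedge_basis j (contract_basis i A) I"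
  by (simp add: contract_basis_def[of i "wedge_basis j A"] wedge_basis_Cons)

text \<open>Applying \<open>wedge_basis_Cons\<close> twice gives terms antisymmetric in i and j and
  a double wedge of a contracted array on a shorter list; hence the induction for arbitrary
  \<open>A\<close>.\<close>

lemma wedge_wedge: "wedge_basis i (wedge_basis j A) I = - wedge_basis j (wedge_basis i A) I"
proof (induction I arbitrary: A)
  case (Cons x I)
  have "wedge_basis i (contract_basis x (wedge_basis j A)) I
     = (if x = j then wedge_basis i A I else 0) - wedge_basis i (wedge_basis j (contract_basis x A)) I" for i j
    by (cases "x = j") (simp_all add: contract_wedge[abs_def] wedge_basis_linear)
  then show ?case
    unfolding wedge_basis_Cons by (simp add: Cons)
qed simp

lemma alternating_wedge: "alternating A \<Longrightarrow> alternating (wedge_basis j A)"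
proof -
  have "wedge_basis j A (xs @ a # b # ys) = - wedge_basis j A (xs @ b # a # ys)" if "alternating A" for xs a b ys
    using that
  proof (induction xs arbitrary: A)
    case Nil
    have "contract_basis b (contract_basis a A) = (\<lambda>I. - contract_basis a (contract_basis b A) I)"
      using contract_contract[OF Nil, of b a] by (simp add: fun_eq_iff)
    then show ?case
      by (simp add: wedge_basis_Cons wedge_basis_linear) (simp add: contract_basis_def)
  next
    case (Cons x xs)
    then show ?case
      using alternatingD[of A xs a b ys] alternating_contract[of A x] by (simp add: wedge_basis_Cons)
  qed
  then show "alternating A \<Longrightarrow> alternating (wedge_basis j A)"
    unfolding alternating_def [of "wedge_basis j A"] by blast
qed

text \<open>A matrix unit of gl(n) on components: entries j are replaced by a one at a time. The Lie
  derivatives of forms and of multivectors both contain such sums, and \<open>wedge_contract\<close>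
  expresses them as a wedge after a contraction.\<close>

definition subst_index :: "'n \<Rightarrow> 'n \<Rightarrow> ('n list \<Rightarrow> real) \<Rightarrow> 'n list \<Rightarrow> real" where
  "subst_index j a A I = (\<Sum>s<length I. if I ! s = j then A (I[s := a]) else 0)"

lemma alternating_move:
  "alternating A \<Longrightarrow> A (ps @ a # xs @ ys) = (- 1) ^ length xs * A (ps @ xs @ a # ys)"
proof (induction xs arbitrary: ps)
  case (Cons x xs)
  have "A (ps @ a # (x # xs) @ ys) = - A ((ps @ [x]) @ a # xs @ ys)"
    using alternatingD[OF Cons.prems, of ps a x] by simp
  also have "A ((ps @ [x]) @ a # xs @ ys) = (- 1) ^ length xs * A ((ps @ [x]) @ xs @ a # ys)"
    by (rule Cons.IH[OF Cons.prems])
  finally show ?case by simp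
qed simp

text \<open>Moving the contracted index from the front to position s costs (-1)^s, which cancels the
  sign in the wedge product.\<close>

lemma wedge_contract:
  assumes "alternating A"
  shows "wedge_basis j (contract_basis a A) = subst_index j a A"
proof (rule ext)
  fix I
  have "(- 1) ^ s * A (a # take s I @ drop (Suc s) I) = A (I[s := a])" if "s < length I" for s
  proof -
    have len: "length (take s I) = s" using that by simp
    have "A (a # take s I @ drop (Suc s) I) = (- 1) ^ s * A (take s I @ a # drop (Suc s) I)"
      using alternating_move[OF assms, of "[]" a "take s I" "drop (Suc s) I"] unfolding len by simp
    then have "(- 1) ^ s * A (a # take s I @ drop (Suc s) I) = ((- 1) ^ s * (- 1) ^ s) * A (take s I @ a # drop (Suc s) I)"
      by (simp only: mult.assoc)
    also have "((- 1) ^ s * (- 1) ^ s :: real) = 1" by (subst power_mult_distrib [symmetric]) simp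
    also have "take s I @ a # drop (Suc s) I = I[s := a]" by (rule upd_conv_take_nth_drop[OF that, symmetric])
    finally show ?thesis by simp
  qed
  then show "wedge_basis j (contract_basis a A) I = subst_index j a A I"
    unfolding wedge_basis_def subst_index_def contract_basis_def
    by (intro sum.cong refl) simp
qed

lemma sum_subst_index_diag: "(\<Sum>j\<in>UNIV. subst_index j j A I) = real (length I) * A (I :: 'n::finite list)"
proof -
  have "(\<Sum>j\<in>UNIV. subst_index j j A I) = (\<Sum>s<length I. \<Sum>j\<in>UNIV. if I ! s = j then A (I[s := j]) else 0)"
    unfolding subst_index_def by (rule sum.swap)
  also have "\<dots> = (\<Sum>s<length I. A I)" by simp
  finally show ?thesis by simp
qed

text \<open>Transposed matrix units are adjoint under the pairing: for each position s, overwriting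
  entry s is a bijection between the lists with a there and the lists with j there.\<close>

lemma pairing_subst_index: "pairing p A (subst_index a j w) = pairing p (subst_index j a A) w"
proof -
  have "(\<Sum>I | length I = p. A I * (if I ! s = a then w (I[s := j]) else 0))
      = (\<Sum>I | length I = p. (if I ! s = j then A (I[s := a]) else 0) * w I)" if "s < p" for s
  proof -
    let ?S = "\<lambda>a. {I :: 'a list. length I = p \<and> I ! s = a}"
    have "finite {I :: 'a list. length I = p}" using finite_lists_length_eq[of "UNIV :: 'a set" p] by simp
    note fin = this
    have "(\<Sum>I | length I = p. A I * (if I ! s = a then w (I[s := j]) else 0)) = (\<Sum>I\<in>?S a. A I * w (I[s := j]))"
      by (intro sum.mono_neutral_cong_right fin) auto
    also have "\<dots> = (\<Sum>I\<in>?S j. A (I[s := a]) * w I)"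
      by (rule sum.reindex_bij_witness[of _ "\<lambda>I. I[s := a]" "\<lambda>I. I[s := j]"]) (use that in auto)
    also have "\<dots> = (\<Sum>I | length I = p. (if I ! s = j then A (I[s := a]) else 0) * w I)"
      by (intro sum.mono_neutral_cong_left fin) auto
    finally show ?thesis .
  qed
  then have *: "(\<Sum>s<p. \<Sum>I | length I = p. A I * (if I ! s = a then w (I[s := j]) else 0))
      = (\<Sum>s<p. \<Sum>I | length I = p. (if I ! s = j then A (I[s := a]) else 0) * w I)" by simp
  have "(\<Sum>I | length I = p. \<Sum>s<p. A I * (if I ! s = a then w (I[s := j]) else 0))
      = (\<Sum>s<p. \<Sum>I | length I = p. A I * (if I ! s = a then w (I[s := j]) else 0))" by (rule sum.swap)
  also note *
  also have "(\<Sum>s<p. \<Sum>I | length I = p. (if I ! s = j then A (I[s := a]) else 0) * w I)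
      = (\<Sum>I | length I = p. \<Sum>s<p. (if I ! s = j then A (I[s := a]) else 0) * w I)" by (rule sum.swap)
  finally show ?thesis unfolding pairing_def subst_index_def
    by (simp add: sum_distrib_left sum_distrib_right)
qed

section \<open>The operator algebra acting on symbols\<close>

definition alt_smooth :: "'n::finite symbol \<Rightarrow> bool" where
  "alt_smooth u \<longleftrightarrow> (\<forall>\<alpha> x. alternating (u \<alpha> x)) \<and> (\<forall>\<alpha> I. smooth (\<lambda>x. u \<alpha> x I))"

lemma alternating_zero: "alternating (\<lambda>_. 0)"
  by (simp add: alternating_def)

lemma alternating_lin: "alternating A \<Longrightarrow> alternating B \<Longrightarrow> alternating (\<lambda>I. a * A I + b * B I)"
  unfolding alternating_def by (metis minus_add_distrib mult_minus_right)

lemma alternating_add: "alternating A \<Longrightarrow> alternating B \<Longrightarrow> alternating (\<lambda>I. A I + B I)"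
  and alternating_cmult: "alternating A \<Longrightarrow> alternating (\<lambda>I. a * A I)"
  and alternating_minus: "alternating A \<Longrightarrow> alternating (\<lambda>I. - A I)"
  and alternating_diff: "alternating A \<Longrightarrow> alternating B \<Longrightarrow> alternating (\<lambda>I. A I - B I)"
  using alternating_lin[of A B 1 1] alternating_lin[of A A a 0] alternating_lin[of A A "-1" 0] alternating_lin[of A B 1 "-1"]
  by simp_all

lemma alternating_sum: "(\<And>i. i \<in> S \<Longrightarrow> alternating (A i)) \<Longrightarrow> alternating (\<lambda>I. \<Sum>i\<in>S. A i I)"
  by (induction S rule: infinite_finite_induct) (simp_all add: alternating_zero alternating_add)

lemma smooth_if: "smooth f \<Longrightarrow> smooth (\<lambda>x. if b then f x else 0)"
  by (cases b) simp_all

lemma smooth_wedge: "(\<And>I. smooth (\<lambda>x. A x I)) \<Longrightarrow> smooth (\<lambda>x. wedge_basis j (A x) I)"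
  unfolding wedge_basis_def by (intro smooth_sum smooth_if smooth_cmult)

text \<open>All degrees are allowed in one symbol, since \<open>delta\<close> and \<open>delta_star\<close> change them; the degrees
  are recovered as eigenvalues of \<open>degS\<close> and \<open>degL\<close>.\<close>

typedef 'n asym = "{u :: 'n::finite symbol. alt_smooth u}" morphisms sym_of Abs_asym
  by (rule exI[of _ "\<lambda>_ _ _. 0"]) (simp add: alt_smooth_def alternating_zero)

setup_lifting type_definition_asym

instantiation asym :: (finite) real_vector
begin

lift_definition zero_asym :: "'a asym" is "\<lambda>_ _ _. 0"
  by (simp add: alt_smooth_def alternating_zero)
lift_definition plus_asym :: "'a asym \<Rightarrow> 'a asym \<Rightarrow> 'a asym" is "\<lambda>u v \<alpha> x I. u \<alpha> x I + v \<alpha> x I"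
  by (simp add: alt_smooth_def alternating_add smooth_add)
lift_definition minus_asym :: "'a asym \<Rightarrow> 'a asym \<Rightarrow> 'a asym" is "\<lambda>u v \<alpha> x I. u \<alpha> x I - v \<alpha> x I"
  by (simp add: alt_smooth_def alternating_diff smooth_diff)
lift_definition uminus_asym :: "'a asym \<Rightarrow> 'a asym" is "\<lambda>u \<alpha> x I. - u \<alpha> x I"
  by (simp add: alt_smooth_def alternating_minus smooth_minus)
lift_definition scaleR_asym :: "real \<Rightarrow> 'a asym \<Rightarrow> 'a asym" is "\<lambda>c u \<alpha> x I. c * u \<alpha> x I"
  by (simp add: alt_smooth_def alternating_cmult smooth_cmult)

instance
  by (standard; transfer) (auto simp: fun_eq_iff algebra_simps)

end

lift_definition aD :: "'n::finite \<Rightarrow> 'n asym \<Rightarrow> 'n asym" is xi_deriv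
  unfolding alt_smooth_def xi_deriv_def by (auto intro: alternating_cmult smooth_cmult)
lift_definition aM :: "'n::finite \<Rightarrow> 'n asym \<Rightarrow> 'n asym" is xi_mult
  unfolding alt_smooth_def xi_mult_def by (auto simp: alternating_zero zero_fun_def)
lift_definition aW :: "'n::finite \<Rightarrow> 'n asym \<Rightarrow> 'n asym" is "\<lambda>j u \<alpha> x. wedge_basis j (u \<alpha> x)"
  unfolding alt_smooth_def by (auto intro: alternating_wedge smooth_wedge)
lift_definition aI :: "'n::finite \<Rightarrow> 'n asym \<Rightarrow> 'n asym" is "\<lambda>j u \<alpha> x. contract_basis j (u \<alpha> x)"
  unfolding alt_smooth_def by (auto intro: alternating_contract) (simp add: contract_basis_def)
lift_definition aP :: "'n::finite \<Rightarrow> 'n asym \<Rightarrow> 'n asym" is "\<lambda>j u \<alpha> x I. pd j (\<lambda>y. u \<alpha> y I) x"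
proof -
  fix j :: 'n and u :: "'n symbol"
  assume u: "alt_smooth u"
  have "pd j (\<lambda>y. u \<alpha> y (xs @ a # b # ys)) x = - pd j (\<lambda>y. u \<alpha> y (xs @ b # a # ys)) x" for \<alpha> xs a b ys x
  proof -
    have "(\<lambda>y. u \<alpha> y (xs @ a # b # ys)) = (\<lambda>y. (-1) * u \<alpha> y (xs @ b # a # ys))"
      using u alternatingD[of "u \<alpha> y" xs a b ys for y] by (auto simp: alt_smooth_def)
    moreover have "pd j (\<lambda>y. (-1) * u \<alpha> y (xs @ b # a # ys)) x = (-1) * pd j (\<lambda>y. u \<alpha> y (xs @ b # a # ys)) x"
      using u by (intro pd_cmult smooth_differentiable) (simp add: alt_smooth_def)
    ultimately show ?thesis by simp
  qed
  then show "alt_smooth (\<lambda>\<alpha> x I. pd j (\<lambda>y. u \<alpha> y I) x)"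
    using u smooth_pd unfolding alt_smooth_def alternating_def by blast
qed
lift_definition aX :: "'n::finite \<Rightarrow> 'n asym \<Rightarrow> 'n asym" is "\<lambda>j u \<alpha> x I. x $ j * u \<alpha> x I"
  unfolding alt_smooth_def by (auto intro: alternating_cmult smooth_coord_mult)

lemma sym_of_alt_smooth [simp]: "alternating (sym_of u \<alpha> x)" "smooth (\<lambda>x. sym_of u \<alpha> x I)"
  using sym_of[of u] by (simp_all add: alt_smooth_def)

lemma sym_of_simps [simp]: "sym_of 0 \<alpha> x I = 0" "sym_of (u + v) \<alpha> x I = sym_of u \<alpha> x I + sym_of v \<alpha> x I"
  "sym_of (u - v) \<alpha> x I = sym_of u \<alpha> x I - sym_of v \<alpha> x I" "sym_of (- u) \<alpha> x I = - sym_of u \<alpha> x I"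
  "sym_of (c *\<^sub>R u) \<alpha> x I = c * sym_of u \<alpha> x I"
  by (transfer; simp)+

lemma sym_of_sum [simp]: "sym_of (sum f S) \<alpha> x I = (\<Sum>i\<in>S. sym_of (f i) \<alpha> x I)"
  by (induction S rule: infinite_finite_induct) simp_all

lemma asym_eqI: "(\<And>\<alpha> x I. sym_of u \<alpha> x I = sym_of v \<alpha> x I) \<Longrightarrow> u = v"
  by (simp add: sym_of_inject[symmetric] fun_eq_iff)

lemma sym_of_D: "sym_of (aD j u) \<alpha> x I = real (Suc (\<alpha> j)) * sym_of u (\<alpha>(j := Suc (\<alpha> j))) x I"
  by (simp add: aD.rep_eq xi_deriv_def)
lemma sym_of_M: "sym_of (aM j u) \<alpha> x I = (if \<alpha> j = 0 then 0 else sym_of u (\<alpha>(j := \<alpha> j - 1)) x I)"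
  by (simp add: aM.rep_eq xi_mult_def)
lemma sym_of_W: "sym_of (aW j u) \<alpha> x I = wedge_basis j (sym_of u \<alpha> x) I"
  by (simp add: aW.rep_eq)
lemma sym_of_I: "sym_of (aI j u) \<alpha> x I = sym_of u \<alpha> x (j # I)"
  by (simp add: aI.rep_eq contract_basis_def)
lemma sym_of_P: "sym_of (aP j u) \<alpha> x I = pd j (\<lambda>y. sym_of u \<alpha> y I) x"
  by (simp add: aP.rep_eq)
lemma sym_of_X: "sym_of (aX j u) \<alpha> x I = x $ j * sym_of u \<alpha> x I"
  by (simp add: aX.rep_eq)

lemmas sym_of_gen = sym_of_D sym_of_M sym_of_W sym_of_I sym_of_P sym_of_X

lemma wedge_sym_lin:
  "wedge_basis j (sym_of (u + v) \<alpha> x) I = wedge_basis j (sym_of u \<alpha> x) I + wedge_basis j (sym_of v \<alpha> x) I"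
  "wedge_basis j (sym_of (c *\<^sub>R u) \<alpha> x) I = c * wedge_basis j (sym_of u \<alpha> x) I"
  using wedge_basis_linear(1)[of j "sym_of u \<alpha> x" "sym_of v \<alpha> x" I] wedge_basis_linear(2)[of j c "sym_of u \<alpha> x" I]
  by (simp_all add: sym_of_simps[abs_def])

lemma linear_gen: "linear (aD j)" "linear (aM j)" "linear (aW j)" "linear (aI j)" "linear (aP j)" "linear (aX j)"
  by (auto intro!: linearI asym_eqI simp: sym_of_gen wedge_sym_lin pd_add pd_cmult smooth_differentiable algebra_simps)

text \<open>Linear operators are made a type so that they can be an instance of
  \<open>real_algebra_1\<close>, as the locale \<open>weyl_clifford\<close> demands.\<close>

typedef 'n symop = "{f :: 'n::finite asym \<Rightarrow> 'n asym. linear f}" morphisms app Abs_symop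
  by (rule exI[of _ "\<lambda>_. 0"]) (simp add: linear_zero)

setup_lifting type_definition_symop

lemma linear_app [simp]: "linear (app f)" using app[of f] by simp

lemma app_lin [simp]: "app f 0 = 0" "app f (u + v) = app f u + app f v" "app f (u - v) = app f u - app f v"
  "app f (- u) = - app f u" "app f (c *\<^sub>R u) = c *\<^sub>R app f u"
  by (simp_all add: linear_0 linear_add linear_diff linear_neg linear_cmul)

lemma app_sum_right: "app f (sum g S) = (\<Sum>i\<in>S. app f (g i))"
  by (simp add: linear_sum)

instantiation symop :: (finite) real_algebra_1
begin

lift_definition zero_symop :: "'a symop" is "\<lambda>_. 0" by (rule linear_zero)
lift_definition one_symop :: "'a symop" is "\<lambda>u. u" by (rule linear_ident)
lift_definition plus_symop :: "'a symop \<Rightarrow> 'a symop \<Rightarrow> 'a symop" is "\<lambda>f g u. f u + g u"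
  by (rule linear_compose_add)
lift_definition minus_symop :: "'a symop \<Rightarrow> 'a symop \<Rightarrow> 'a symop" is "\<lambda>f g u. f u - g u"
  by (rule linear_compose_sub)
lift_definition uminus_symop :: "'a symop \<Rightarrow> 'a symop" is "\<lambda>f u. - f u"
  by (rule linear_compose_neg)
lift_definition scaleR_symop :: "real \<Rightarrow> 'a symop \<Rightarrow> 'a symop" is "\<lambda>c f u. c *\<^sub>R f u"
  by (rule linear_compose_scale_right)
lift_definition times_symop :: "'a symop \<Rightarrow> 'a symop \<Rightarrow> 'a symop" is "\<lambda>f g u. f (g u)"
  using linear_compose unfolding comp_def by blast

instance
proof
  \<comment> \<open>A nonzero symbol separates 0 from 1. The scalar one is alternating because the
    condition concerns only lists with at least two entries.\<close>
  let ?u = "Abs_asym (\<lambda>_ _ I. if I = [] then 1 else 0) :: 'a asym"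
  have "alt_smooth (\<lambda>_ (_ :: real^'a) (I :: 'a list). if I = [] then 1 else 0)"
    by (auto simp: alt_smooth_def alternating_def)
  then have "sym_of ?u \<alpha> x [] = 1" for \<alpha> x by (simp add: Abs_asym_inverse)
  then have "?u \<noteq> 0" by (metis sym_of_simps(1) zero_neq_one)
  moreover have "app 0 ?u = 0" "app 1 ?u = ?u" by (simp_all add: zero_symop.rep_eq one_symop.rep_eq)
  ultimately show "(0 :: 'a symop) \<noteq> 1" by metis
qed (transfer; auto simp: fun_eq_iff linear_add linear_cmul algebra_simps)+

end

lemma app_simps [simp]: "app 0 u = 0" "app 1 u = u" "app (f + g) u = app f u + app g u" "app (f - g) u = app f u - app g u"
  "app (- f) u = - app f u" "app (c *\<^sub>R f) u = c *\<^sub>R app f u" "app (f * g) u = app f (app g u)"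
  by (transfer; simp)+

lemma app_of_nat [simp]: "app (of_nat n) u = real n *\<^sub>R u" "app (numeral m) u = numeral m *\<^sub>R u"
proof -
  have *: "app (of_nat n) u = real n *\<^sub>R u" for n
    by (induction n) (simp_all add: algebra_simps)
  show "app (of_nat n) u = real n *\<^sub>R u" by (rule *)
  show "app (numeral m) u = numeral m *\<^sub>R u" using *[of "numeral m"] by simp
qed

lemma app_sum [simp]: "app (sum f S) u = (\<Sum>i\<in>S. app (f i) u)"
  by (induction S rule: infinite_finite_induct) simp_all

lemma symop_eqI: "(\<And>u. app f u = app g u) \<Longrightarrow> f = g"
  by (simp add: app_inject[symmetric] fun_eq_iff)

lift_definition oD :: "'n::finite \<Rightarrow> 'n symop" is aD by (rule linear_gen)
lift_definition oM :: "'n::finite \<Rightarrow> 'n symop" is aM by (rule linear_gen)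
lift_definition oW :: "'n::finite \<Rightarrow> 'n symop" is aW by (rule linear_gen)
lift_definition oI :: "'n::finite \<Rightarrow> 'n symop" is aI by (rule linear_gen)
lift_definition oP :: "'n::finite \<Rightarrow> 'n symop" is aP by (rule linear_gen)
lift_definition oX :: "'n::finite \<Rightarrow> 'n symop" is aX by (rule linear_gen)

lemmas app_gen = oD.rep_eq oM.rep_eq oW.rep_eq oI.rep_eq oP.rep_eq oX.rep_eq

section \<open>Commutation relations of the six families of generators\<close>

lemma aD_aM: "aD i (aM j u) = aM j (aD i u) + (if i = j then u else 0)"
proof (intro asym_eqI)
  fix \<alpha> x I
  show "sym_of (aD i (aM j u)) \<alpha> x I = sym_of (aM j (aD i u) + (if i = j then u else 0)) \<alpha> x I"
    by (cases "i = j"; cases "\<alpha> j")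
      (auto simp: sym_of_gen fun_upd_twist[of i j] fun_upd_idem algebra_simps)
qed

lemma aD_aD: "aD i (aD j u) = aD j (aD i u)"
  by (intro asym_eqI; cases "i = j") (auto simp: sym_of_gen fun_upd_twist)

lemma aM_aM: "aM i (aM j u) = aM j (aM i u)"
  by (intro asym_eqI; cases "i = j") (auto simp: sym_of_gen fun_upd_twist)

lemma aP_aX: "aP i (aX j u) = aX j (aP i u) + (if i = j then u else 0)"
  by (intro asym_eqI) (auto simp: sym_of_gen pd_mult pd_coord smooth_differentiable)

lemma aP_aP: "aP i (aP j u) = aP j (aP i u)"
  by (intro asym_eqI) (simp add: sym_of_P sym_of_P[abs_def] pd_commute[of _ i j])

lemma aD_aP: "aD i (aP j u) = aP j (aD i u)"
  by (intro asym_eqI) (simp add: sym_of_gen pd_cmult smooth_differentiable)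

lemma aM_aP: "aM i (aP j u) = aP j (aM i u)"
  by (intro asym_eqI) (auto simp: sym_of_gen)

lemma aW_aD: "aW i (aD j u) = aD j (aW i u)"
  by (intro asym_eqI) (simp add: sym_of_gen[abs_def] sym_of_gen wedge_basis_cmult)

lemma aW_aM: "aW i (aM j u) = aM j (aW i u)"
  by (intro asym_eqI) (auto simp: sym_of_gen sym_of_M[abs_def] wedge_basis_zero)

lemma aW_aX: "aW i (aX j u) = aX j (aW i u)"
  by (intro asym_eqI) (simp add: sym_of_W sym_of_X sym_of_X[abs_def] wedge_basis_cmult)

lemma aW_aP: "aW i (aP j u) = aP j (aW i u)"
proof (intro asym_eqI)
  fix \<alpha> x I
  have "pd j (\<lambda>y. wedge_basis i (sym_of u \<alpha> y) I) x =
    (\<Sum>s<length I. pd j (\<lambda>y. if I ! s = i then (- 1) ^ s * sym_of u \<alpha> y (take s I @ drop (Suc s) I) else 0) x)"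
    unfolding wedge_basis_def by (intro pd_sum smooth_if smooth_cmult sym_of_alt_smooth)
  also have "\<dots> = wedge_basis i (\<lambda>I. pd j (\<lambda>y. sym_of u \<alpha> y I) x) I"
    unfolding wedge_basis_def by (intro sum.cong refl) (simp add: pd_cmult smooth_differentiable)
  finally show "sym_of (aW i (aP j u)) \<alpha> x I = sym_of (aP j (aW i u)) \<alpha> x I"
    by (simp add: sym_of_W sym_of_P sym_of_P[abs_def])
qed

lemma aI_aW: "aI i (aW j u) = (if i = j then u else 0) - aW j (aI i u)"
proof (intro asym_eqI)
  fix \<alpha> x I
  have "sym_of (aI i u) \<alpha> x = contract_basis i (sym_of u \<alpha> x)" by (simp add: aI.rep_eq)
  then show "sym_of (aI i (aW j u)) \<alpha> x I = sym_of ((if i = j then u else 0) - aW j (aI i u)) \<alpha> x I"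
    using contract_wedge[of i j "sym_of u \<alpha> x" I]
    by (simp add: aI.rep_eq sym_of_W[abs_def] sym_of_W aW.rep_eq)
qed

lemma aW_aW: "aW i (aW j u) = - aW j (aW i u)"
proof (intro asym_eqI)
  fix \<alpha> x I
  have "sym_of (aW i u) \<alpha> x = wedge_basis i (sym_of u \<alpha> x)" for i by (simp add: aW.rep_eq)
  then show "sym_of (aW i (aW j u)) \<alpha> x I = sym_of (- aW j (aW i u)) \<alpha> x I"
    using wedge_wedge[of i j "sym_of u \<alpha> x" I] by (simp add: sym_of_W)
qed

lemma aI_aI: "aI i (aI j u) = - aI j (aI i u)"
proof (intro asym_eqI)
  fix \<alpha> x I
  show "sym_of (aI i (aI j u)) \<alpha> x I = sym_of (- aI j (aI i u)) \<alpha> x I"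
    using alternatingD[of "sym_of u \<alpha> x" "[]" j i I] by (simp add: sym_of_I)
qed

lemma aI_com: "aI i (aD j u) = aD j (aI i u)" "aI i (aM j u) = aM j (aI i u)" "aI i (aP j u) = aP j (aI i u)"
    "aI i (aX j u) = aX j (aI i u)"
  by (auto intro!: asym_eqI simp: sym_of_gen)

lemma aX_com: "aX i (aX j u) = aX j (aX i u)" "aD i (aX j u) = aX j (aD i u)" "aM i (aX j u) = aX j (aM i u)"
  by (auto intro!: asym_eqI simp: sym_of_gen)

lemmas gen_com = aD_aD aM_aM aP_aP aD_aP aM_aP aW_aD aW_aM aW_aX aW_aP aI_com aX_com

global_interpretation weyl: weyl_clifford oD oM oW oI oP oX
proof
  fix i j :: 'a
  show "oI i * oI j = - (oI j * oI i)"
    by (rule symop_eqI, simp only: app_simps app_gen, rule aI_aI)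
  show "oW i * oW j = - (oW j * oW i)"
    by (rule symop_eqI, simp only: app_simps app_gen, rule aW_aW)
qed (rule symop_eqI, simp add: comm_def app_gen gen_com aD_aM aP_aX aI_aW)+

section \<open>Homogeneous components and the projective Lie algebra\<close>

lemma sym_of_degS: "sym_of (app weyl.degS v) \<alpha> x I = real (multi_deg \<alpha>) * sym_of v \<alpha> x I"
proof -
  have "sym_of (aM j (aD j v)) \<alpha> x I = real (\<alpha> j) * sym_of v \<alpha> x I" for j
    by (cases "\<alpha> j") (simp_all add: sym_of_gen fun_upd_idem)
  then show ?thesis
    by (simp add: weyl.degS_def app_gen multi_deg_def sum_distrib_right)
qed

lemma sym_of_WI: "sym_of (aW j (aI a v)) \<alpha> x I = subst_index j a (sym_of v \<alpha> x) I"
  using wedge_contract[of "sym_of v \<alpha> x" j a] by (simp add: sym_of_W aI.rep_eq)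

lemma sym_of_degL: "sym_of (app weyl.degL v) \<alpha> x I = real (length I) * sym_of v \<alpha> x I"
  by (simp add: weyl.degL_def app_gen sym_of_WI sum_subst_index_diag)

lemma degS_eigen: "app weyl.degS v = c *\<^sub>R v \<longleftrightarrow> (\<forall>\<alpha>. real (multi_deg \<alpha>) \<noteq> c \<longrightarrow> sym_of v \<alpha> = 0)"
  by (auto simp: sym_of_inject[symmetric] fun_eq_iff sym_of_degS)

lemma degL_eigen: "app weyl.degL v = c *\<^sub>R v \<longleftrightarrow> (\<forall>\<alpha> x I. real (length I) \<noteq> c \<longrightarrow> sym_of v \<alpha> x I = 0)"
  by (auto simp: sym_of_inject[symmetric] fun_eq_iff sym_of_degL)

lemma delta_sym_of: "delta (sym_of v) = sym_of (app weyl.dl v)"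
  by (simp add: fun_eq_iff delta_def weyl.dl_def app_gen sym_of_W aD.rep_eq)

lemma delta_star_sym_of: "delta_star (sym_of v) = sym_of (app weyl.ds v)"
  by (simp add: fun_eq_iff delta_star_def weyl.ds_def app_gen aI.rep_eq aM.rep_eq)

lemma symbol_div_sym_of: "symbol_div (sym_of v) = sym_of (app weyl.dv v)"
  by (simp add: fun_eq_iff symbol_div_def weyl.dv_def app_gen sym_of_P aD.rep_eq)

text \<open>A degree bound is easier to carry through operators than finite support. The two agree
  (\<open>fin_iff\<close>) because there are finitely many multi-indices up to a given
  degree.\<close>

definition fin :: "'n::finite asym \<Rightarrow> bool" where
  "fin v \<longleftrightarrow> (\<exists>K. \<forall>\<alpha>. multi_deg \<alpha> > K \<longrightarrow> sym_of v \<alpha> = 0)"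

lemma finite_multi_deg: "finite {\<alpha> :: 'n::finite \<Rightarrow> nat. multi_deg \<alpha> \<le> K}"
proof (rule finite_subset)
  show "{\<alpha> :: 'n \<Rightarrow> nat. multi_deg \<alpha> \<le> K} \<subseteq> PiE UNIV (\<lambda>_. {..K})"
  proof
    fix \<alpha> :: "'n \<Rightarrow> nat" assume "\<alpha> \<in> {\<alpha>. multi_deg \<alpha> \<le> K}"
    moreover have "\<alpha> i \<le> multi_deg \<alpha>" for i
      unfolding multi_deg_def by (intro member_le_sum) auto
    ultimately have "\<alpha> i \<le> K" for i using order_trans by blast
    then show "\<alpha> \<in> PiE UNIV (\<lambda>_. {..K})" by (simp add: PiE_def Pi_def)
  qed
  show "finite (PiE UNIV (\<lambda>_ :: 'n. {..K}))" by (intro finite_PiE) auto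
qed

lemma fin_iff: "fin v \<longleftrightarrow> finite {\<alpha>. sym_of v \<alpha> \<noteq> 0}"
proof
  assume "fin v"
  then obtain K where K: "\<And>\<alpha>. multi_deg \<alpha> > K \<Longrightarrow> sym_of v \<alpha> = 0" unfolding fin_def by blast
  have "{\<alpha>. sym_of v \<alpha> \<noteq> 0} \<subseteq> {\<alpha>. multi_deg \<alpha> \<le> K}"
  proof
    fix \<alpha> assume "\<alpha> \<in> {\<alpha>. sym_of v \<alpha> \<noteq> 0}"
    with K[of \<alpha>] have "\<not> multi_deg \<alpha> > K" by blast
    then show "\<alpha> \<in> {\<alpha>. multi_deg \<alpha> \<le> K}" by simp
  qed
  then show "finite {\<alpha>. sym_of v \<alpha> \<noteq> 0}" using finite_multi_deg by (rule finite_subset)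
next
  assume f: "finite {\<alpha>. sym_of v \<alpha> \<noteq> 0}"
  obtain K where "\<forall>\<alpha> \<in> {\<alpha>. sym_of v \<alpha> \<noteq> 0}. multi_deg \<alpha> \<le> K"
    using finite_imageI[OF f, of multi_deg] unfolding finite_nat_set_iff_bounded_le by blast
  then have "multi_deg \<alpha> > K \<Longrightarrow> sym_of v \<alpha> = 0" for \<alpha> by (meson mem_Collect_eq not_le)
  then show "fin v" unfolding fin_def by blast
qed

lemma fin_add: "fin u \<Longrightarrow> fin v \<Longrightarrow> fin (u + v)"
proof -
  assume "fin u" "fin v"
  then obtain K L where "\<And>\<alpha>. multi_deg \<alpha> > K \<Longrightarrow> sym_of u \<alpha> = 0" "\<And>\<alpha>. multi_deg \<alpha> > L \<Longrightarrow> sym_of v \<alpha> = 0"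
    by (auto simp: fin_def)
  then show ?thesis unfolding fin_def
    by (intro exI[of _ "max K L"]) (auto simp: fun_eq_iff)
qed

lemma fin_scale: "fin u \<Longrightarrow> fin (c *\<^sub>R u)"
  by (auto simp: fin_def fun_eq_iff)

lemma fin_zero: "fin 0"
  by (auto simp: fin_def fun_eq_iff)

lemma fin_diff: "fin u \<Longrightarrow> fin v \<Longrightarrow> fin (u - v)"
  using fin_add[of u "(-1) *\<^sub>R v"] fin_scale[of v "-1"] by simp

lemma fin_sum: "(\<And>i. i \<in> S \<Longrightarrow> fin (f i)) \<Longrightarrow> fin (sum f S)"
  by (induction S rule: infinite_finite_induct) (simp_all add: fin_zero fin_add)

lemma multi_deg_Suc: "multi_deg (\<alpha>(j := Suc (\<alpha> j))) = Suc (multi_deg \<alpha>)"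
proof -
  have "multi_deg (\<alpha>(j := Suc (\<alpha> j))) = (\<Sum>i\<in>UNIV. \<alpha> i + (if i = j then 1 else 0))"
    unfolding multi_deg_def by (intro sum.cong) auto
  then show ?thesis by (simp add: sum.distrib multi_deg_def)
qed

lemma multi_deg_pred: "\<alpha> j \<noteq> 0 \<Longrightarrow> Suc (multi_deg (\<alpha>(j := \<alpha> j - 1))) = multi_deg \<alpha>"
  using multi_deg_Suc[of "\<alpha>(j := \<alpha> j - 1)" j] by (simp add: fun_upd_idem)

lemma fin_gen:
  assumes "fin v"
  shows "fin (app (oD j) v)" "fin (app (oM j) v)" "fin (app (oW j) v)" "fin (app (oI j) v)"
    "fin (app (oP j) v)" "fin (app (oX j) v)"
proof -
  obtain K where K: "\<And>\<alpha>. multi_deg \<alpha> > K \<Longrightarrow> sym_of v \<alpha> = 0" using assms by (auto simp: fin_def)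
  then have K0: "\<And>\<alpha> x I. multi_deg \<alpha> > K \<Longrightarrow> sym_of v \<alpha> x I = 0" by simp
  have w: "wedge_basis j (sym_of v \<alpha> x) I = 0" if "multi_deg \<alpha> > K" for \<alpha> x I
    using wedge_basis_zero[of j I] that by (simp add: K zero_fun_def)
  show "fin (app (oD j) v)" "fin (app (oW j) v)" "fin (app (oI j) v)"
    "fin (app (oP j) v)" "fin (app (oX j) v)"
    unfolding fin_def
    by (intro exI[of _ K] allI impI ext, simp add: app_gen sym_of_gen K0 w multi_deg_Suc)+
  have "sym_of (app (oM j) v) \<alpha> = 0" if "multi_deg \<alpha> > Suc K" for \<alpha>
  proof (cases "\<alpha> j = 0")
    case False
    then have "multi_deg (\<alpha>(j := \<alpha> j - 1)) > K" using multi_deg_pred[of \<alpha> j] False that by simp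
    then show ?thesis by (intro ext) (simp add: app_gen sym_of_gen K0)
  qed (intro ext, simp add: app_gen sym_of_gen)
  then show "fin (app (oM j) v)" unfolding fin_def by blast
qed

text \<open>\<open>asym\<close> contains symbols of infinite support too, so every operator built
  from the generators has to be shown to keep symbols polynomial.\<close>

definition fin_op :: "'n::finite symop \<Rightarrow> bool" where
  "fin_op f \<longleftrightarrow> (\<forall>v. fin v \<longrightarrow> fin (app f v))"

lemma fin_opD: "fin_op f \<Longrightarrow> fin v \<Longrightarrow> fin (app f v)" by (simp add: fin_op_def)

lemma fin_op_intros [intro]:
  "fin_op (oD j)" "fin_op (oM j)" "fin_op (oW j)" "fin_op (oI j)" "fin_op (oP j)" "fin_op (oX j)"
  "fin_op f \<Longrightarrow> fin_op g \<Longrightarrow> fin_op (f + g)" "fin_op f \<Longrightarrow> fin_op g \<Longrightarrow> fin_op (f - g)"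
  "fin_op f \<Longrightarrow> fin_op g \<Longrightarrow> fin_op (f * g)" "fin_op f \<Longrightarrow> fin_op (c *\<^sub>R f)"
  "(\<And>i. i \<in> S \<Longrightarrow> fin_op (h i)) \<Longrightarrow> fin_op (sum h S)" "fin_op 1"
  by (auto simp: fin_op_def fin_gen fin_add fin_diff fin_scale fin_sum)

lemma fin_op_derived [intro]:
  "fin_op weyl.degS" "fin_op weyl.degL" "fin_op weyl.tot" "fin_op weyl.eul" "fin_op weyl.dl" "fin_op weyl.ds" "fin_op weyl.dv"
  "fin_op (weyl.E a b)"
  unfolding weyl.degS_def weyl.degL_def weyl.tot_def weyl.eul_def weyl.dl_def weyl.ds_def weyl.dv_def weyl.E_def
  by (intro fin_op_intros)+

lemma fin_op_Lam [intro]: "fin_op (weyl.Lam a b c)"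
  and fin_op_AB [intro]: "fin_op (weyl.A c)" "fin_op (weyl.B c)"
  unfolding weyl.Lam_def weyl.Tr_def weyl.Gr_def weyl.Zr_def weyl.A_def weyl.B_def weyl.Dc_def
  by (intro fin_op_intros fin_op_derived)+

definition of_type :: "nat \<Rightarrow> 'n::finite asym \<Rightarrow> bool" where
  "of_type p v \<longleftrightarrow> app weyl.degL v = real p *\<^sub>R v"

lemma sym_of_in_symbols: "sym_of v \<in> symbols p \<longleftrightarrow> fin v \<and> of_type p v"
  by (auto simp: symbols_def alt_fields_def alt_arrays_iff fin_iff of_type_def degL_eigen)

lemma symbols_sym_of: "u \<in> symbols p \<Longrightarrow> \<exists>v. u = sym_of v \<and> fin v \<and> of_type p v"
proof -
  assume u: "u \<in> symbols p"
  then have "alt_smooth u" by (auto simp: symbols_def alt_fields_def alt_arrays_iff alt_smooth_def)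
  then have "u = sym_of (Abs_asym u)" by (simp add: Abs_asym_inverse)
  with u sym_of_in_symbols show ?thesis by metis
qed

lemma sym_of_in_symbols_hom:
  "sym_of v \<in> symbols_hom p k \<longleftrightarrow> fin v \<and> of_type p v \<and> app weyl.degS v = real k *\<^sub>R v"
  by (auto simp: symbols_hom_def sym_of_in_symbols degS_eigen)

section \<open>The Lie derivative along a projective field\<close>

definition sl_vec :: "('n \<Rightarrow> real) \<Rightarrow> ('n \<Rightarrow> 'n \<Rightarrow> real) \<Rightarrow> ('n \<Rightarrow> real) \<Rightarrow> real^'n::finite \<Rightarrow> real^'n" where
  "sl_vec a b c = (\<lambda>x. (\<Sum>r\<in>UNIV. a r *\<^sub>R axis r 1)
     + (\<Sum>r\<in>UNIV. \<Sum>s\<in>UNIV. (b r s * x $ s) *\<^sub>R axis r 1)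
     + (\<Sum>r\<in>UNIV. (c r * x $ r) *\<^sub>R (\<Sum>s\<in>UNIV. x $ s *\<^sub>R axis s 1)))"

lemma sl_fields_eq: "sl_fields = {X. \<exists>a b c. X = sl_vec a b c}"
  by (simp add: sl_fields_def sl_vec_def)

lemma sl_vec_nth: "sl_vec a b c x $ j = a j + (\<Sum>s\<in>UNIV. b j s * x $ s) + (\<Sum>r\<in>UNIV. c r * x $ r) * x $ j"
  unfolding sl_vec_def scaleR_sum_left [symmetric]
  by (simp add: axis_def if_distrib cong: if_cong)

lemma pd_sl_vec:
  "pd i (\<lambda>x. sl_vec a b c x $ j) x = b j i + c i * x $ j + (if i = j then \<Sum>r\<in>UNIV. c r * x $ r else 0)"
proof -
  have 1: "smooth (\<lambda>x. \<Sum>s\<in>UNIV. b j s * x $ s)" and 2: "smooth (\<lambda>x. \<Sum>r\<in>UNIV. c r * x $ r)" for b c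
    by (intro smooth_sum smooth_cmult smooth_coord)+
  have lin: "pd i (\<lambda>x. \<Sum>r\<in>UNIV. c r * x $ r) x = c i" for c
    by (subst pd_sum) (auto simp: pd_cmult pd_coord smooth_cmult if_distrib cong: if_cong)
  show ?thesis unfolding sl_vec_nth
    by (simp add: pd_add pd_mult smooth_differentiable 1 2 differentiable_mult pd_coord lin)
qed

text \<open>Holds for every X: the Lie derivative is X acting on the coefficients minus the Jacobian
  of X acting through gl(n). The coefficients of a projective field are inserted only
  afterwards.\<close>

lemma lie_symbol_sym_of:
  "lie_symbol X (sym_of v) \<alpha> x I = (\<Sum>j\<in>UNIV. X x $ j * sym_of (aP j v) \<alpha> x I)
     - (\<Sum>i\<in>UNIV. \<Sum>j\<in>UNIV. pd i (\<lambda>y. X y $ j) x * sym_of (app (weyl.E j i) v) \<alpha> x I)"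
proof -
  let ?p = "\<lambda>i j. pd i (\<lambda>y. X y $ j) x"
  have "(\<Sum>s<length I. \<Sum>j\<in>UNIV. ?p j (I ! s) * sym_of v \<alpha> x (I[s := j]))
     = (\<Sum>s<length I. \<Sum>i\<in>UNIV. \<Sum>j\<in>UNIV. ?p i j * (if I ! s = j then sym_of v \<alpha> x (I[s := i]) else 0))"
    by (simp add: if_distrib cong: if_cong)
  also have "\<dots> = (\<Sum>i\<in>UNIV. \<Sum>s<length I. \<Sum>j\<in>UNIV. ?p i j * (if I ! s = j then sym_of v \<alpha> x (I[s := i]) else 0))"
    by (rule sum.swap)
  also have "\<dots> = (\<Sum>i\<in>UNIV. \<Sum>j\<in>UNIV. \<Sum>s<length I. ?p i j * (if I ! s = j then sym_of v \<alpha> x (I[s := i]) else 0))"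
    by (intro sum.cong refl) (rule sum.swap)
  also have "\<dots> = (\<Sum>i\<in>UNIV. \<Sum>j\<in>UNIV. ?p i j * sym_of (aW j (aI i v)) \<alpha> x I)"
    by (simp only: sym_of_WI subst_index_def sum_distrib_left)
  finally have 3: "(\<Sum>s<length I. \<Sum>j\<in>UNIV. ?p j (I ! s) * sym_of v \<alpha> x (I[s := j])) = \<dots>" .
  show ?thesis unfolding lie_symbol_def 3
    by (simp add: lie_fun_def sym_of_P weyl.E_def app_gen distrib_left sum.distrib aM.rep_eq [symmetric] aD.rep_eq [symmetric])
qed

lemma lie_symbol_sl_vec: "lie_symbol (sl_vec a b c) (sym_of v) = sym_of (app (weyl.Lam a b c) v)"
proof (intro ext)
  fix \<alpha> x I
  define P where "P j = sym_of (aP j v) \<alpha> x I" for j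
  define G where "G i j = sym_of (app (weyl.E i j) v) \<alpha> x I" for i j
  let ?c = "\<Sum>r\<in>UNIV. c r * x $ r"
  have L: "lie_symbol (sl_vec a b c) (sym_of v) \<alpha> x I =
      (\<Sum>j\<in>UNIV. (a j + (\<Sum>s\<in>UNIV. b j s * x $ s) + ?c * x $ j) * P j)
    - (\<Sum>i\<in>UNIV. \<Sum>j\<in>UNIV. (b j i + c i * x $ j + (if i = j then ?c else 0)) * G j i)"
    unfolding lie_symbol_sym_of pd_sl_vec P_def G_def unfolding sl_vec_nth by (rule refl)
  also have "\<dots> = (\<Sum>j\<in>UNIV. a j * P j) + (\<Sum>j\<in>UNIV. \<Sum>s\<in>UNIV. b j s * (x $ s * P j)) + ?c * (\<Sum>j\<in>UNIV. x $ j * P j)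
    - ((\<Sum>i\<in>UNIV. \<Sum>j\<in>UNIV. b j i * G j i) + (\<Sum>i\<in>UNIV. c i * (\<Sum>j\<in>UNIV. x $ j * G j i)) + ?c * (\<Sum>j\<in>UNIV. G j j))"
  proof -
    have 1: "(b j i + c i * x $ j + (if i = j then ?c else 0)) * G j i
      = b j i * G j i + c i * (x $ j * G j i) + (if i = j then ?c * G j i else 0)" for i j
      by (simp add: distrib_right)
    have 2: "(a j + (\<Sum>s\<in>UNIV. b j s * x $ s) + ?c * x $ j) * P j
      = a j * P j + (\<Sum>s\<in>UNIV. b j s * (x $ s * P j)) + ?c * (x $ j * P j)" for j
      by (simp add: distrib_right sum_distrib_right mult.assoc)
    have 3: "(\<Sum>i\<in>UNIV. \<Sum>j\<in>UNIV. if i = j then ?c * G j i else 0) = ?c * (\<Sum>j\<in>UNIV. G j j)"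
      by (simp add: sum_distrib_left)
    show ?thesis
      unfolding 1 2 sum.distrib 3 sum_distrib_left [symmetric] by (rule refl)
  qed
  also have "(\<Sum>i\<in>UNIV. \<Sum>j\<in>UNIV. b j i * G j i) = (\<Sum>j\<in>UNIV. \<Sum>i\<in>UNIV. b j i * G j i)"
    by (rule sum.swap)
  also have "(\<Sum>j\<in>UNIV. a j * P j) + (\<Sum>j\<in>UNIV. \<Sum>s\<in>UNIV. b j s * (x $ s * P j)) + ?c * (\<Sum>j\<in>UNIV. x $ j * P j)
    - (\<dots> + (\<Sum>i\<in>UNIV. c i * (\<Sum>j\<in>UNIV. x $ j * G j i)) + ?c * (\<Sum>j\<in>UNIV. G j j))
    = (\<Sum>j\<in>UNIV. a j * P j) + (\<Sum>j\<in>UNIV. \<Sum>s\<in>UNIV. b j s * (x $ s * P j - G j s))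
      + (\<Sum>r\<in>UNIV. c r * (x $ r * (\<Sum>j\<in>UNIV. x $ j * P j) - (\<Sum>j\<in>UNIV. x $ j * G j r) - x $ r * (\<Sum>j\<in>UNIV. G j j)))"
    by (simp only: right_diff_distrib sum_subtractf mult.assoc [symmetric] sum_distrib_right [symmetric])
  also have "\<dots> = sym_of (app (weyl.Lam a b c) v) \<alpha> x I"
    by (simp add: weyl.Lam_def weyl.Tr_def weyl.Gr_def weyl.Zr_def weyl.eul_def weyl.tot_E app_gen sym_of_X P_def G_def)
  finally show "lie_symbol (sl_vec a b c) (sym_of v) \<alpha> x I = sym_of (app (weyl.Lam a b c) v) \<alpha> x I" .
qed

section \<open>Differential operators and their symbols\<close>

text \<open>Not restricted to alternating forms of degree p, so that the summands of
  \<open>lie_form\<close> can be treated one by one under smoothness alone.\<close>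

definition aop :: "nat \<Rightarrow> 'n::finite asym \<Rightarrow> (real^'n \<Rightarrow> 'n list \<Rightarrow> real) \<Rightarrow> real^'n \<Rightarrow> real" where
  "aop p v w x = (\<Sum>\<alpha> | sym_of v \<alpha> \<noteq> 0. pairing p (sym_of v \<alpha> x) (\<lambda>I. multi_pd \<alpha> (\<lambda>y. w y I) x))"

definition smooth_form :: "(real^'n::finite \<Rightarrow> 'n list \<Rightarrow> real) \<Rightarrow> bool" where
  "smooth_form w \<longleftrightarrow> (\<forall>I. smooth (\<lambda>x. w x I))"

lemma aff_op_sym_of: "aff_op p (sym_of v) = (\<lambda>w\<in>forms p. aop p v w)"
  unfolding aff_op_def aop_def by (intro restrict_ext ext) simp

lemma pairing_lin:
  "pairing p (\<lambda>I. A I + B I) w = pairing p A w + pairing p B w"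
  "pairing p (\<lambda>I. c * A I) w = c * pairing p A w"
  "pairing p A (\<lambda>I. v I + w I) = pairing p A v + pairing p A w"
  "pairing p A (\<lambda>I. c * w I) = c * pairing p A w"
  "pairing p (\<lambda>I. 0) w = 0" "pairing p A (\<lambda>I. 0) = 0"
  by (simp_all add: pairing_def sum.distrib distrib_left distrib_right add_divide_distrib sum_distrib_left mult_ac)

definition deg_le :: "nat \<Rightarrow> 'n::finite asym \<Rightarrow> bool" where
  "deg_le K v \<longleftrightarrow> (\<forall>\<alpha>. multi_deg \<alpha> > K \<longrightarrow> sym_of v \<alpha> = 0)"

lemma deg_leI: "(\<And>\<alpha> x I. multi_deg \<alpha> > K \<Longrightarrow> sym_of v \<alpha> x I = 0) \<Longrightarrow> deg_le K v"
  by (simp add: deg_le_def fun_eq_iff)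

lemma deg_leD: "deg_le K v \<Longrightarrow> multi_deg \<alpha> > K \<Longrightarrow> sym_of v \<alpha> x I = 0"
  by (simp add: deg_le_def)

lemma deg_le_mono: "deg_le K v \<Longrightarrow> K \<le> L \<Longrightarrow> deg_le L v"
  by (simp add: deg_le_def)

lemma fin_deg_le: "fin v \<longleftrightarrow> (\<exists>K. deg_le K v)"
  by (simp add: fin_def deg_le_def)

lemma deg_le_gen:
  assumes "deg_le K v"
  shows "deg_le K (aD j v)" "deg_le (Suc K) (aM j v)" "deg_le K (aP j v)" "deg_le K (aX j v)" "deg_le K (aW j (aI i v))"
proof -
  note [simp] = deg_leD[OF assms]
  show "deg_le K (aD j v)" "deg_le K (aP j v)" "deg_le K (aX j v)" "deg_le K (aW j (aI i v))"
    by (intro deg_leI; simp add: sym_of_D sym_of_P sym_of_X sym_of_WI subst_index_def multi_deg_Suc cong: if_cong)+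
  show "deg_le (Suc K) (aM j v)"
  proof (rule deg_leI)
    fix \<alpha> :: "'a \<Rightarrow> nat" and x I assume "Suc K < multi_deg \<alpha>"
    then show "sym_of (aM j v) \<alpha> x I = 0"
      using multi_deg_pred[of \<alpha> j] by (cases "\<alpha> j = 0") (simp_all add: sym_of_M)
  qed
qed

lemma deg_le_add: "deg_le K u \<Longrightarrow> deg_le K v \<Longrightarrow> deg_le K (u + v)"
  and deg_le_scale: "deg_le K u \<Longrightarrow> deg_le K (c *\<^sub>R u)"
  by (intro deg_leI; simp add: deg_leD)+

text \<open>A range of summation that depends on the degree bound and not on the support lets
  different symbols be compared term by term.\<close>

lemma aop_bound:
  assumes "deg_le K v"
  shows "aop p v w x = (\<Sum>\<alpha> | multi_deg \<alpha> \<le> K. pairing p (sym_of v \<alpha> x) (\<lambda>I. multi_pd \<alpha> (\<lambda>y. w y I) x))"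
  unfolding aop_def
proof (rule sum.mono_neutral_left[OF finite_multi_deg])
  show "{\<alpha>. sym_of v \<alpha> \<noteq> 0} \<subseteq> {\<alpha>. multi_deg \<alpha> \<le> K}"
    using assms not_le unfolding deg_le_def by blast
qed (auto simp: pairing_lin zero_fun_def)

lemma aop_scale: "fin u \<Longrightarrow> aop p (c *\<^sub>R u) w x = c * aop p u w x"
  and aop_X: "fin u \<Longrightarrow> aop p (aX j u) w x = x $ j * aop p u w x"
  and aop_WI: "fin u \<Longrightarrow> aop p u (\<lambda>y. subst_index i j (w y)) x = aop p (aW j (aI i u)) w x" if "smooth_form w"
proof -
  assume u: "fin u"
  then obtain K where K: "deg_le K u" unfolding fin_deg_le by blast
  note 1 = deg_le_scale[OF K, of c] and 2 = deg_le_gen(4)[OF K, of j] and 3 = deg_le_gen(5)[OF K, of j i]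
  show "aop p (c *\<^sub>R u) w x = c * aop p u w x"
    unfolding aop_bound[OF K] aop_bound[OF 1] sym_of_simps[abs_def] pairing_lin sum_distrib_left ..
  show "aop p (aX j u) w x = x $ j * aop p u w x"
    unfolding aop_bound[OF K] aop_bound[OF 2] sym_of_X[abs_def] pairing_lin sum_distrib_left ..
  have "multi_pd \<alpha> (\<lambda>y. subst_index i j (w y) I) x = subst_index i j (\<lambda>I. multi_pd \<alpha> (\<lambda>y. w y I) x) I" for \<alpha> I
  proof -
    have sm: "smooth (\<lambda>y. w y I)" for I using that by (simp add: smooth_form_def)
    have "smooth (\<lambda>y. \<Sum>s\<in>S. if I ! s = i then w y (I[s := j]) else 0) \<and>
      multi_pd \<alpha> (\<lambda>y. \<Sum>s\<in>S. if I ! s = i then w y (I[s := j]) else 0) x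
      = (\<Sum>s\<in>S. if I ! s = i then multi_pd \<alpha> (\<lambda>y. w y (I[s := j])) x else 0)" if "finite S" for S
      using that
    proof induction
      case empty
      show ?case using multi_pd_cmult[OF smooth_const[of 0], of \<alpha> 0] by simp
    next
      case (insert s S)
      have z: "multi_pd \<alpha> (\<lambda>y :: real^'a. 0) = (\<lambda>_. 0)" using multi_pd_cmult[OF smooth_const[of 0], of \<alpha> 0] by simp
      from insert show ?case
        by (simp add: smooth_add smooth_if sm multi_pd_add z)
    qed
    from this[of "{..<length I}"] show ?thesis by (simp add: subst_index_def)
  qed
  then show "aop p u (\<lambda>y. subst_index i j (w y)) x = aop p (aW j (aI i u)) w x"
    unfolding aop_bound[OF K] aop_bound[OF 3]
    by (simp add: pairing_subst_index sym_of_WI[abs_def])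
qed

lemma aop_add: "fin u \<Longrightarrow> fin v \<Longrightarrow> aop p (u + v) w x = aop p u w x + aop p v w x"
proof -
  assume u: "fin u" and v: "fin v"
  from u v obtain K L where "deg_le K u" "deg_le L v" unfolding fin_deg_le by blast
  then have 1: "deg_le (max K L) u" and 2: "deg_le (max K L) v"
    by (auto intro: deg_le_mono)
  note 3 = deg_le_add[OF 1 2]
  show ?thesis
    unfolding aop_bound[OF 1] aop_bound[OF 2] aop_bound[OF 3] sym_of_simps[abs_def] pairing_lin sum.distrib ..
qed

text \<open>Raising entry j is a bijection onto the multi-indices with nonzero entry j. This turns
  an additional derivative of the form into multiplication by a fibre coordinate, and a lost one
  into fibre differentiation.\<close>

lemma sum_shift_multi_index:
  fixes f :: "('n::finite \<Rightarrow> nat) \<Rightarrow> 'b::comm_monoid_add"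
  shows "(\<Sum>\<alpha> | multi_deg \<alpha> \<le> K. f (\<alpha>(j := Suc (\<alpha> j)))) = (\<Sum>\<alpha> | multi_deg \<alpha> \<le> Suc K. if \<alpha> j = 0 then 0 else f \<alpha>)"
proof -
  have "(\<Sum>\<alpha> | multi_deg \<alpha> \<le> K. f (\<alpha>(j := Suc (\<alpha> j)))) = (\<Sum>\<alpha> | multi_deg \<alpha> \<le> Suc K \<and> \<alpha> j \<noteq> 0. f \<alpha>)"
  proof (rule sum.reindex_bij_witness[of _ "\<lambda>\<alpha>. \<alpha>(j := \<alpha> j - 1)" "\<lambda>\<alpha>. \<alpha>(j := Suc (\<alpha> j))"])
    fix \<alpha> :: "'n \<Rightarrow> nat"
    assume "\<alpha> \<in> {\<alpha>. multi_deg \<alpha> \<le> Suc K \<and> \<alpha> j \<noteq> 0}"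
    then have a: "multi_deg \<alpha> \<le> Suc K" "\<alpha> j \<noteq> 0" by simp_all
    then show "\<alpha>(j := \<alpha> j - 1) \<in> {\<alpha>. multi_deg \<alpha> \<le> K}" using multi_deg_pred[of \<alpha> j] by simp
    from a show "(\<alpha>(j := \<alpha> j - 1))(j := Suc ((\<alpha>(j := \<alpha> j - 1)) j)) = \<alpha>" by (simp add: fun_upd_idem)
  qed (auto simp: multi_deg_Suc)
  also have "\<dots> = (\<Sum>\<alpha> | multi_deg \<alpha> \<le> Suc K. if \<alpha> j = 0 then 0 else f \<alpha>)"
    by (intro sum.mono_neutral_cong_left finite_multi_deg) auto
  finally show ?thesis .
qed

lemma aop_pd_form:
  assumes "fin v" "smooth_form w"
  shows "aop p v (\<lambda>y I. pd j (\<lambda>z. w z I) y) x = aop p (aM j v) w x"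
proof -
  obtain K where K: "deg_le K v" using assms unfolding fin_deg_le by blast
  have sm: "smooth (\<lambda>y. w y I)" for I using assms by (simp add: smooth_form_def)
  note M = deg_le_gen(2)[OF K, of j]
  have "aop p v (\<lambda>y I. pd j (\<lambda>z. w z I) y) x
    = (\<Sum>\<alpha> | multi_deg \<alpha> \<le> K. pairing p (sym_of v \<alpha> x) (\<lambda>I. multi_pd (\<alpha>(j := Suc (\<alpha> j))) (\<lambda>y. w y I) x))"
    unfolding aop_bound[OF K] by (simp add: multi_pd_Suc multi_pd_pd sm)
  also have "\<dots> = (\<Sum>\<alpha> | multi_deg \<alpha> \<le> K. (\<lambda>\<alpha>. pairing p (sym_of v (\<alpha>(j := \<alpha> j - 1)) x) (\<lambda>I. multi_pd \<alpha> (\<lambda>y. w y I) x)) (\<alpha>(j := Suc (\<alpha> j))))"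
    by (intro sum.cong refl) (simp add: fun_upd_idem)
  also have "\<dots> = (\<Sum>\<alpha> | multi_deg \<alpha> \<le> Suc K. if \<alpha> j = 0 then 0 else
      pairing p (sym_of v (\<alpha>(j := \<alpha> j - 1)) x) (\<lambda>I. multi_pd \<alpha> (\<lambda>y. w y I) x))"
    by (rule sum_shift_multi_index)
  also have "\<dots> = aop p (aM j v) w x"
    unfolding aop_bound[OF M]
    by (intro sum.cong refl) (simp add: sym_of_M[abs_def] pairing_lin)
  finally show ?thesis .
qed

lemma aop_coord_form:
  assumes "fin v" "smooth_form w"
  shows "aop p v (\<lambda>y I. y $ j * w y I) x = aop p (aX j v + aD j v) w x"
proof -
  obtain K where K: "deg_le K v" using assms unfolding fin_deg_le by blast
  \<comment> \<open>The larger range is the one that \<open>sum_shift_multi_index\<close> produces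
    from the degrees up to K.\<close>
  then have K': "deg_le (Suc K) v" by (rule deg_le_mono) simp
  have sm: "smooth (\<lambda>y. w y I)" for I using assms by (simp add: smooth_form_def)
  note D = deg_le_gen(1)[OF K, of j]
  let ?T = "\<lambda>\<alpha>. pairing p (sym_of v \<alpha> x) (\<lambda>I. multi_pd (\<alpha>(j := \<alpha> j - 1)) (\<lambda>y. w y I) x)"
  have "aop p v (\<lambda>y I. y $ j * w y I) x = x $ j * aop p v w x + (\<Sum>\<alpha> | multi_deg \<alpha> \<le> Suc K. real (\<alpha> j) * ?T \<alpha>)"
    unfolding aop_bound[OF K'] by (simp add: multi_pd_coord_mult sm pairing_lin sum.distrib sum_distrib_left)
  also have "(\<Sum>\<alpha> | multi_deg \<alpha> \<le> Suc K. real (\<alpha> j) * ?T \<alpha>)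
    = (\<Sum>\<alpha> | multi_deg \<alpha> \<le> Suc K. if \<alpha> j = 0 then 0 else (\<lambda>\<alpha>. real (\<alpha> j) * ?T \<alpha>) \<alpha>)"
    by (intro sum.cong) auto
  also have "\<dots> = (\<Sum>\<alpha> | multi_deg \<alpha> \<le> K. (\<lambda>\<alpha>. real (\<alpha> j) * ?T \<alpha>) (\<alpha>(j := Suc (\<alpha> j))))"
    by (rule sum_shift_multi_index[symmetric])
  also have "\<dots> = aop p (aD j v) w x"
    unfolding aop_bound[OF D]
    by (intro sum.cong refl) (simp add: fun_upd_idem sym_of_D[abs_def] pairing_lin del: of_nat_Suc)
  finally show ?thesis
    using assms fin_gen[OF assms(1)] by (simp add: aop_add aop_X app_gen)
qed

lemma pd_pairing:
  assumes "\<And>I. smooth (\<lambda>x. A x I)" "\<And>I. smooth (\<lambda>x. B x I)"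
  shows "pd j (\<lambda>x. pairing p (A x) (B x)) x = pairing p (\<lambda>I. pd j (\<lambda>x. A x I) x) (B x) + pairing p (A x) (\<lambda>I. pd j (\<lambda>x. B x I) x)"
    and "smooth (\<lambda>x. pairing p (A x) (B x))"
proof -
  have s: "smooth (\<lambda>x. A x I * B x I)" for I using assms by (intro smooth_mult)
  have eq: "pairing p (A x) (B x) = (1 / fact p) * (\<Sum>I | length I = p. A x I * B x I)" for x
    by (simp add: pairing_def)
  show "smooth (\<lambda>x. pairing p (A x) (B x))"
    unfolding eq by (intro smooth_cmult smooth_sum s)
  show "pd j (\<lambda>x. pairing p (A x) (B x)) x = pairing p (\<lambda>I. pd j (\<lambda>x. A x I) x) (B x) + pairing p (A x) (\<lambda>I. pd j (\<lambda>x. B x I) x)"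
    unfolding eq
    by (subst pd_cmult, intro smooth_differentiable smooth_sum s, subst pd_sum, rule s)
      (simp add: pd_mult assms smooth_differentiable sum.distrib pairing_def add_divide_distrib)
qed

lemma aop_pd:
  assumes "fin v" "smooth_form w"
  shows "pd j (aop p v w) x = aop p (aP j v + aM j v) w x" and "smooth (aop p v w)"
proof -
  obtain K where K: "deg_le K v" using assms unfolding fin_deg_le by blast
  have sm: "smooth (\<lambda>y. w y I)" for I using assms by (simp add: smooth_form_def)
  note P = deg_le_gen(3)[OF K, of j]
  let ?T = "\<lambda>\<alpha> x. pairing p (sym_of v \<alpha> x) (\<lambda>I. multi_pd \<alpha> (\<lambda>y. w y I) x)"
  have sT: "smooth (?T \<alpha>)" for \<alpha>
    by (intro pd_pairing smooth_multi_pd sm sym_of_alt_smooth)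
  have eq: "aop p v w = (\<lambda>x. \<Sum>\<alpha> | multi_deg \<alpha> \<le> K. ?T \<alpha> x)" by (intro ext) (rule aop_bound[OF K])
  show "smooth (aop p v w)" unfolding eq by (intro smooth_sum sT)
  have "pd j (aop p v w) x = (\<Sum>\<alpha> | multi_deg \<alpha> \<le> K. pd j (?T \<alpha>) x)"
    unfolding eq by (rule pd_sum[OF sT])
  also have "\<dots> = aop p (aP j v) w x + aop p v (\<lambda>y I. pd j (\<lambda>z. w z I) y) x"
    unfolding aop_bound[OF K] aop_bound[OF P] sum.distrib [symmetric]
    by (intro sum.cong refl) (simp add: pd_pairing smooth_multi_pd sm sym_of_P[abs_def] multi_pd_pd)
  finally show "pd j (aop p v w) x = aop p (aP j v + aM j v) w x"
    using fin_gen[OF assms(1)] by (simp add: aop_pd_form[OF assms] aop_add app_gen)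
qed

lemma aop_form_add:
  assumes "fin v" "smooth_form u" "smooth_form w"
  shows "aop p v (\<lambda>y I. u y I + w y I) x = aop p v u x + aop p v w x"
  using assms(2,3) by (simp add: aop_def smooth_form_def multi_pd_add pairing_lin sum.distrib)

lemma aop_form_cmult:
  assumes "fin v" "smooth_form w"
  shows "aop p v (\<lambda>y I. c * w y I) x = c * aop p v w x"
  using assms(2) by (simp add: aop_def smooth_form_def multi_pd_cmult pairing_lin sum_distrib_left)

lemma smooth_form_sum: "(\<And>i. i \<in> S \<Longrightarrow> smooth_form (w i)) \<Longrightarrow> smooth_form (\<lambda>y I. \<Sum>i\<in>S. w i y I)"
  by (simp add: smooth_form_def smooth_sum)

lemma aop_form_sum:
  assumes "fin v" "\<And>i. i \<in> S \<Longrightarrow> smooth_form (w i)"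
  shows "aop p v (\<lambda>y I. \<Sum>i\<in>S. w i y I) x = (\<Sum>i\<in>S. aop p v (w i) x)"
  using assms(2)
proof (induction S rule: infinite_finite_induct)
  case (insert i S)
  then show ?case by (simp add: aop_form_add assms(1) smooth_form_sum)
qed (use aop_form_cmult[OF assms(1), of "\<lambda>_ _. 0" p 0 x] in \<open>simp_all add: smooth_form_def\<close>)

lemma aop_zero: "aop p 0 w x = 0"
proof -
  have "deg_le 0 0" by (rule deg_leI) simp
  from aop_bound[OF this] show ?thesis by (simp add: sym_of_simps(1)[abs_def] pairing_lin)
qed

lemma aop_sum: "(\<And>i. i \<in> S \<Longrightarrow> fin (f i)) \<Longrightarrow> aop p (sum f S) w x = (\<Sum>i\<in>S. aop p (f i) w x)"
  by (induction S rule: infinite_finite_induct) (simp_all add: aop_zero aop_add fin_sum)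

section \<open>The transported action\<close>

lemma smooth_form_intros [simp]:
  assumes "smooth_form w"
  shows "smooth_form (\<lambda>y I. pd j (\<lambda>z. w z I) y)" "smooth_form (\<lambda>y I. y $ s * w y I)" "smooth_form (\<lambda>y I. c * w y I)"
    "smooth_form (\<lambda>y. subst_index i j (w y))"
proof -
  have sm: "smooth (\<lambda>y. w y I)" for I using assms by (simp add: smooth_form_def)
  show "smooth_form (\<lambda>y I. pd j (\<lambda>z. w z I) y)" "smooth_form (\<lambda>y I. y $ s * w y I)" "smooth_form (\<lambda>y I. c * w y I)"
    unfolding smooth_form_def by (auto intro: smooth_pd smooth_coord_mult smooth_cmult sm)
  show "smooth_form (\<lambda>y. subst_index i j (w y))"
    unfolding smooth_form_def subst_index_def by (intro allI smooth_sum smooth_if sm)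
qed

lemma smooth_form_add: "smooth_form u \<Longrightarrow> smooth_form w \<Longrightarrow> smooth_form (\<lambda>y I. u y I + w y I)"
  by (simp add: smooth_form_def smooth_add)

text \<open>Each summand is a chain of elementary operations on w, arranged like those of
  \<open>act_right\<close>, so that \<open>aop_lie_form\<close> can convert it by rewriting.\<close>

lemma lie_form_sl_vec:
  "lie_form (sl_vec a b c) w = (\<lambda>x I.
      (\<Sum>j\<in>UNIV. a j * pd j (\<lambda>y. w y I) x)
    + (\<Sum>j\<in>UNIV. \<Sum>s\<in>UNIV. b j s * (x $ s * pd j (\<lambda>y. w y I) x))
    + (\<Sum>j\<in>UNIV. \<Sum>r\<in>UNIV. c r * (x $ r * (x $ j * pd j (\<lambda>y. w y I) x)))
    + ((\<Sum>j\<in>UNIV. \<Sum>i\<in>UNIV. b j i * subst_index i j (w x) I)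
      + (\<Sum>j\<in>UNIV. \<Sum>i\<in>UNIV. c i * (x $ j * subst_index i j (w x) I))
      + (\<Sum>j\<in>UNIV. \<Sum>r\<in>UNIV. c r * (x $ r * subst_index j j (w x) I))))"
proof (intro ext)
  fix x I
  let ?X = "sl_vec a b c"
  let ?p = "\<lambda>i j. pd i (\<lambda>y. ?X y $ j) x"
  have "(\<Sum>s<length I. \<Sum>j\<in>UNIV. ?p (I ! s) j * w x (I[s := j]))
     = (\<Sum>s<length I. \<Sum>j\<in>UNIV. \<Sum>i\<in>UNIV. ?p i j * (if I ! s = i then w x (I[s := j]) else 0))"
    by (simp add: if_distrib cong: if_cong)
  also have "\<dots> = (\<Sum>j\<in>UNIV. \<Sum>s<length I. \<Sum>i\<in>UNIV. ?p i j * (if I ! s = i then w x (I[s := j]) else 0))"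
    by (rule sum.swap)
  also have "\<dots> = (\<Sum>j\<in>UNIV. \<Sum>i\<in>UNIV. \<Sum>s<length I. ?p i j * (if I ! s = i then w x (I[s := j]) else 0))"
    by (intro sum.cong refl) (rule sum.swap)
  also have "\<dots> = (\<Sum>j\<in>UNIV. \<Sum>i\<in>UNIV. ?p i j * subst_index i j (w x) I)"
    by (simp only: subst_index_def sum_distrib_left)
  also have "\<dots> = (\<Sum>j\<in>UNIV. \<Sum>i\<in>UNIV. b j i * subst_index i j (w x) I)
      + (\<Sum>j\<in>UNIV. \<Sum>i\<in>UNIV. c i * (x $ j * subst_index i j (w x) I))
      + (\<Sum>j\<in>UNIV. \<Sum>r\<in>UNIV. c r * (x $ r * subst_index j j (w x) I))"
  proof -
    have 1: "?p i j * g = b j i * g + c i * (x $ j * g) + (if i = j then (\<Sum>r\<in>UNIV. c r * (x $ r * g)) else 0)" for i j g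
      unfolding pd_sl_vec by (simp add: distrib_right sum_distrib_right mult.assoc)
    show ?thesis unfolding 1 sum.distrib by simp
  qed
  finally have 2: "(\<Sum>s<length I. \<Sum>j\<in>UNIV. ?p (I ! s) j * w x (I[s := j])) = \<dots>" .
  have 3: "?X x $ j * g = a j * g + (\<Sum>s\<in>UNIV. b j s * (x $ s * g)) + (\<Sum>r\<in>UNIV. c r * (x $ r * (x $ j * g)))" for j g
    unfolding sl_vec_nth by (simp add: distrib_right sum_distrib_right mult.assoc)
  show "lie_form ?X w x I = (\<Sum>j\<in>UNIV. a j * pd j (\<lambda>y. w y I) x)
    + (\<Sum>j\<in>UNIV. \<Sum>s\<in>UNIV. b j s * (x $ s * pd j (\<lambda>y. w y I) x))
    + (\<Sum>j\<in>UNIV. \<Sum>r\<in>UNIV. c r * (x $ r * (x $ j * pd j (\<lambda>y. w y I) x)))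
    + ((\<Sum>j\<in>UNIV. \<Sum>i\<in>UNIV. b j i * subst_index i j (w x) I)
      + (\<Sum>j\<in>UNIV. \<Sum>i\<in>UNIV. c i * (x $ j * subst_index i j (w x) I))
      + (\<Sum>j\<in>UNIV. \<Sum>r\<in>UNIV. c r * (x $ r * subst_index j j (w x) I)))"
    unfolding lie_form_def lie_fun_def 2 3 sum.distrib ..
qed

lemmas fin_gen' [simp] = fin_gen[unfolded app_gen]

text \<open>The order is reversed: the outermost operation on the form is the innermost one on the
  symbol. Thus x_r times x_j times the j-th derivative corresponds to
  \<open>M j * (X j + D j) * (X r + D r)\<close>.\<close>

lemma aop_lie_form:
  assumes "fin v" "smooth_form w"
  shows "aop p v (lie_form (sl_vec a b c) w) x = aop p (app (weyl.act_right a b c) v) w x"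
proof -
  note [simp] = assms smooth_form_sum smooth_form_add fin_add fin_scale fin_sum
  have X: "aop p u (\<lambda>y I. y $ s * w y I) x = aop p (aX s u + aD s u) w x" if "fin u" "smooth_form w" for u s w
    using aop_coord_form[OF that] .
  have F: "aop p u (\<lambda>y I. pd j (\<lambda>z. w z I) y) x = aop p (aM j u) w x" if "fin u" for u j
    using aop_pd_form[OF that assms(2)] .
  have S: "aop p u (\<lambda>y. subst_index i j (w y)) x = aop p (aW j (aI i u)) w x" if "fin u" for u i j
    using aop_WI[OF assms(2) that] .
  show ?thesis
    unfolding lie_form_sl_vec
    by (simp add: aop_form_add aop_form_sum aop_form_cmult X F S weyl.act_right_def app_gen aop_add aop_sum aop_scale
        linear_gen[THEN linear_add])
qed

lemma lie_fun_aop: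
  assumes "fin v" "smooth_form w"
  shows "lie_fun (sl_vec a b c) (aop p v w) x = aop p (app (weyl.act_left a b c) v) w x"
proof -
  note [simp] = assms fin_add fin_scale fin_sum
  have 3: "sl_vec a b c x $ j * g = a j * g + (\<Sum>s\<in>UNIV. b j s * (x $ s * g)) + (\<Sum>r\<in>UNIV. c r * (x $ r * (x $ j * g)))" for j g
    unfolding sl_vec_nth by (simp add: distrib_right sum_distrib_right mult.assoc)
  show ?thesis
    unfolding lie_fun_def aop_pd(1)[OF assms] 3 sum.distrib
    by (simp add: weyl.act_left_def app_gen aop_add aop_sum aop_scale aop_X distrib_left)
qed

lemma aop_diff:
  assumes "fin u" "fin v" "smooth_form w"
  shows "aop p (u - v) w x = aop p u w x - aop p v w x"
proof -
  have "aop p (u + (-1) *\<^sub>R v) w x = aop p u w x + (-1) * aop p v w x"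
    unfolding aop_scale[OF assms(3,2), symmetric] by (intro aop_add fin_scale assms)
  then show ?thesis by simp
qed

section \<open>Stability of p-forms under the Lie derivative\<close>

lemma forms_smooth: "w \<in> forms p \<Longrightarrow> smooth_form w"
  by (simp add: alt_fields_def smooth_form_def)

lemma forms_alt: "w \<in> forms p \<longleftrightarrow> (\<forall>x. alternating (w x)) \<and> (\<forall>x I. length I \<noteq> p \<longrightarrow> w x I = 0) \<and> smooth_form w"
  by (auto simp: alt_fields_def smooth_form_def alt_arrays_iff)

lemma forms_add: "u \<in> forms p \<Longrightarrow> w \<in> forms p \<Longrightarrow> (\<lambda>x I. u x I + w x I) \<in> forms p"
  by (simp add: forms_alt alternating_add smooth_form_add)

lemma forms_cmult: "w \<in> forms p \<Longrightarrow> (\<lambda>x I. c * w x I) \<in> forms p"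
  by (simp add: forms_alt alternating_cmult)

lemma forms_coord: "w \<in> forms p \<Longrightarrow> (\<lambda>x I. x $ j * w x I) \<in> forms p"
  by (simp add: forms_alt alternating_cmult)

lemma forms_sum: "(\<And>i. i \<in> S \<Longrightarrow> w i \<in> forms p) \<Longrightarrow> (\<lambda>x I. \<Sum>i\<in>S. w i x I) \<in> forms p"
  by (simp add: forms_alt alternating_sum smooth_form_sum)

lemma forms_pd: "w \<in> forms p \<Longrightarrow> (\<lambda>x I. pd j (\<lambda>y. w y I) x) \<in> forms p"
proof -
  assume w: "w \<in> forms p"
  \<comment> \<open>As a symbol with the same coefficient at every multi-index, w gets the
    alternation of its derivative from \<open>aP\<close>.\<close>
  let ?u = "Abs_asym (\<lambda>_. w)"
  have "alt_smooth (\<lambda>_ :: 'a \<Rightarrow> nat. w)" using w by (simp add: forms_alt alt_smooth_def smooth_form_def)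
  then have "sym_of ?u \<alpha> = w" for \<alpha> by (simp add: Abs_asym_inverse)
  then have "alternating (\<lambda>I. pd j (\<lambda>y. w y I) x)" for x
    using sym_of_alt_smooth(1)[of "aP j ?u" "\<lambda>_. 0" x] by (simp add: sym_of_P[abs_def])
  moreover have "pd j (\<lambda>y. w y I) x = 0" if "length I \<noteq> p" for x I
    using w that by (simp add: forms_alt)
  ultimately show ?thesis using w by (simp add: forms_alt)
qed

lemma forms_subst: "w \<in> forms p \<Longrightarrow> (\<lambda>x. subst_index i j (w x)) \<in> forms p"
  by (auto simp: forms_alt wedge_contract[symmetric] intro!: alternating_wedge alternating_contract)
    (auto simp: wedge_contract subst_index_def cong: if_cong)

lemma lie_form_forms: "w \<in> forms p \<Longrightarrow> lie_form (sl_vec a b c) w \<in> forms p"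
  unfolding lie_form_sl_vec
  by (intro forms_add forms_sum forms_cmult forms_coord forms_pd forms_subst)

lemma lie_op_sl_vec:
  assumes "fin v"
  shows "lie_op p (sl_vec a b c) (aff_op p (sym_of v)) = aff_op p (sym_of (app (weyl.Lam a b c - weyl.A c - weyl.B c) v))"
proof -
  have "lie_fun (sl_vec a b c) (aop p v w) x - aop p v (lie_form (sl_vec a b c) w) x
      = aop p (app (weyl.Lam a b c - weyl.A c - weyl.B c) v) w x" if "w \<in> forms p" for w x
  proof -
    have f: "fin (app (weyl.act_left a b c) v)" "fin (app (weyl.act_right a b c) v)"
      unfolding weyl.act_left_def weyl.act_right_def by (intro fin_opD[OF _ assms] fin_op_intros)+
    from aop_diff[OF this forms_smooth[OF that]]
    show ?thesis
      unfolding weyl.act_left_right[symmetric]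
      using lie_fun_aop[OF assms forms_smooth[OF that]] aop_lie_form[OF assms forms_smooth[OF that]] by simp
  qed
  then show ?thesis
    unfolding aff_op_sym_of lie_op_def by (intro restrict_ext ext) (simp add: lie_form_forms)
qed

text \<open>The commutator of an operator of symbol \<open>u\<close> with multiplication by \<open>x\<^sub>j\<close> has symbol
  \<open>\<partial>u / \<partial>\<xi>\<^sub>j\<close>, which lowers the order.\<close>

lemma aop_eq_zero:
  assumes "deg_le K v" "of_type p v" "\<And>w x. w \<in> forms p \<Longrightarrow> aop p v w x = 0"
  shows "v = 0"
  using assms
proof (induction K arbitrary: v)
  case 0
  have "sym_of v (\<lambda>_. 0) x I = 0" for x I
  proof (cases "length I = p")
    case True
    \<comment> \<open>The constant form with the components of the coefficient at x: pairing with it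
      yields a sum of squares.\<close>
    let ?A = "sym_of v (\<lambda>_. 0) x"
    have len: "?A I = 0" if "length I \<noteq> p" for I
      using 0(2) that by (simp add: of_type_def degL_eigen)
    have "(\<lambda>_. ?A) \<in> forms p"
      by (simp add: forms_alt smooth_form_def len)
    then have "aop p v (\<lambda>_. ?A) x = 0" by (rule 0)
    moreover have "{\<alpha> :: 'a \<Rightarrow> nat. multi_deg \<alpha> \<le> 0} = {\<lambda>_. 0}"
      by (auto simp: multi_deg_def fun_eq_iff)
    ultimately have "pairing p ?A ?A = 0" by (simp add: aop_bound[OF 0(1)])
    then have "(\<Sum>I | length I = p. ?A I * ?A I) = 0" by (simp add: pairing_def)
    moreover have "finite {I :: 'a list. length I = p}" using finite_lists_length_eq[of "UNIV :: 'a set" p] by simp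
    ultimately have "\<forall>I\<in>{I. length I = p}. ?A I * ?A I = 0"
      by (subst (asm) sum_nonneg_eq_0_iff) auto
    with True show ?thesis by simp
  qed (use 0(2) in \<open>simp add: of_type_def degL_eigen\<close>)
  moreover have "sym_of v \<alpha> x I = 0" if "\<alpha> \<noteq> (\<lambda>_. 0)" for \<alpha> x I
    using that by (intro deg_leD[OF 0(1)]) (rule ccontr, auto simp: multi_deg_def fun_eq_iff)
  ultimately show ?case by (intro asym_eqI) (metis sym_of_simps(1))
next
  case (Suc K)
  have f: "fin v" using Suc.prems(1) fin_deg_le by blast
  have "aD j v = 0" for j
  proof (rule Suc.IH)
    show "deg_le K (aD j v)"
      by (rule deg_leI) (simp add: sym_of_D multi_deg_Suc deg_leD[OF Suc.prems(1)])
    show "of_type p (aD j v)"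
      using Suc.prems(2) by (auto simp: of_type_def degL_eigen sym_of_D)
    fix w :: "real^'a \<Rightarrow> 'a list \<Rightarrow> real" and x assume w: "w \<in> forms p"
    have "0 = aop p (aX j v + aD j v) w x"
      using aop_coord_form[OF f forms_smooth[OF w], of p j x] Suc.prems(3)[OF forms_coord[OF w, of j]] by simp
    also have "\<dots> = aop p (aD j v) w x"
      by (simp add: aop_add f aop_X[OF forms_smooth[OF w]] Suc.prems(3)[OF w])
    finally show "aop p (aD j v) w x = 0" by simp
  qed
  then have D: "sym_of (aD j v) \<alpha> x I = 0" for j \<alpha> x I by simp
  \<comment> \<open>All fibre derivatives vanish, so only the constant term is left and the
    induction hypothesis applies to v itself.\<close>
  have "deg_le 0 v"
  proof (rule deg_leI)
    fix \<alpha> :: "'a \<Rightarrow> nat" and x I assume "0 < multi_deg \<alpha>"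
    then obtain j where "\<alpha> j \<noteq> 0" unfolding multi_deg_def by (metis less_irrefl sum.neutral)
    with D[of j "\<alpha>(j := \<alpha> j - 1)" x I] show "sym_of v \<alpha> x I = 0"
      by (simp add: sym_of_D fun_upd_idem)
  qed
  then show ?case using Suc.IH deg_le_mono Suc.prems by blast
qed

text \<open>Makes \<open>inv_into\<close> in \<open>sigma_aff\<close> a genuine inverse on
  differential operators.\<close>

lemma inj_aff_op: "inj_on (aff_op p) (symbols p)"
proof (rule inj_onI)
  fix f g :: "'a symbol" assume f: "f \<in> symbols p" and g: "g \<in> symbols p" and eq: "aff_op p f = aff_op p g"
  obtain u v where u: "f = sym_of u" "fin u" "of_type p u" and v: "g = sym_of v" "fin v" "of_type p v"
    using symbols_sym_of f g by metis
  have "fin (u - v)" using u v by (simp add: fin_diff)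
  then obtain K where K: "deg_le K (u - v)" unfolding fin_deg_le by blast
  have "u - v = 0"
  proof (rule aop_eq_zero[OF K])
    show "of_type p (u - v)" using u v by (simp add: of_type_def algebra_simps)
    fix w :: "real^'a \<Rightarrow> 'a list \<Rightarrow> real" and x assume w: "w \<in> forms p"
    have "aop p u w = aop p v w" using fun_cong[OF eq, of w] w by (simp add: u v aff_op_sym_of)
    then show "aop p (u - v) w x = 0"
      by (simp add: aop_diff u v forms_smooth[OF w])
  qed
  then show "f = g" by (simp add: u v)
qed

lemma act_symbol_sl_vec:
  assumes "fin v" "of_type p v" "of_type p (app (weyl.Lam a b c - weyl.A c - weyl.B c) v)"
  shows "act_symbol p (sl_vec a b c) (sym_of v) = sym_of (app (weyl.Lam a b c - weyl.A c - weyl.B c) v)"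
  unfolding act_symbol_def lie_op_sl_vec[OF assms(1)] sigma_aff_def
  by (rule inv_into_f_f[OF inj_aff_op])
    (use assms in \<open>auto simp: sym_of_in_symbols simp del: app_simps intro!: fin_opD\<close>)

section \<open>Homogeneous symbols\<close>

lift_definition ahom :: "nat \<Rightarrow> 'n::finite asym \<Rightarrow> 'n asym" is hom_part
  by (auto simp: alt_smooth_def hom_part_def alternating_zero zero_fun_def)

lemma sym_of_ahom: "sym_of (ahom k v) \<alpha> x I = (if multi_deg \<alpha> = k then sym_of v \<alpha> x I else 0)"
  by (simp add: ahom.rep_eq hom_part_def)

lemma ahom_lin [simp]: "ahom k (u + v) = ahom k u + ahom k v" "ahom k (u - v) = ahom k u - ahom k v"
  "ahom k (c *\<^sub>R v) = c *\<^sub>R ahom k v" "ahom k 0 = 0"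
  by (auto intro!: asym_eqI simp: sym_of_ahom)

lemma ahom_sum: "ahom k (sum f S) = (\<Sum>i\<in>S. ahom k (f i))"
  by (induction S rule: infinite_finite_induct) simp_all

text \<open>The bound is strict, so that \<open>below 0\<close> means zero; inductions on the degree
  start there.\<close>

definition below :: "nat \<Rightarrow> 'n::finite asym \<Rightarrow> bool" where
  "below k v \<longleftrightarrow> (\<forall>\<alpha> x I. multi_deg \<alpha> \<ge> k \<longrightarrow> sym_of v \<alpha> x I = 0)"

lemma below_0 [simp]: "below 0 v \<longleftrightarrow> v = 0"
  by (auto simp: below_def intro!: asym_eqI)

lemma below_lin: "below k u \<Longrightarrow> below k v \<Longrightarrow> below k (u + v)" "below k u \<Longrightarrow> below k v \<Longrightarrow> below k (u - v)"
  "below k u \<Longrightarrow> below k (c *\<^sub>R u)" "below k 0"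
  by (auto simp: below_def)

lemma below_sum: "(\<And>i. i \<in> S \<Longrightarrow> below k (f i)) \<Longrightarrow> below k (sum f S)"
  by (induction S rule: infinite_finite_induct) (simp_all add: below_lin)

lemma below_mono: "below k v \<Longrightarrow> k \<le> l \<Longrightarrow> below l v"
  by (auto simp: below_def)

lemma fin_below: "fin v \<longleftrightarrow> (\<exists>k. below k v)"
proof
  assume "fin v"
  then obtain K where "deg_le K v" unfolding fin_deg_le by blast
  then have "below (Suc K) v" by (simp add: below_def deg_leD Suc_le_eq)
  then show "\<exists>k. below k v" ..
next
  assume "\<exists>k. below k v"
  then obtain k where "below k v" ..
  then have "deg_le k v" by (intro deg_leI) (simp add: below_def)
  then show "fin v" unfolding fin_deg_le ..
qed

lemma below_Suc_ahom: "below (Suc k) v \<Longrightarrow> below k (v - ahom k v)"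
  by (auto simp: below_def sym_of_ahom)

lemma below_ahom: "below k v \<Longrightarrow> j \<ge> k \<Longrightarrow> ahom j v = 0"
  by (intro asym_eqI) (auto simp: below_def sym_of_ahom)

lemma ahom_zero_below: "below (Suc k) v \<Longrightarrow> ahom k v = 0 \<Longrightarrow> below k v"
  using below_Suc_ahom[of k v] by simp

text \<open>The degree is real, so that lowering operators always subtract 1; a result of negative
  degree is then zero by \<open>homg_neg\<close>.\<close>

definition homg :: "real \<Rightarrow> nat \<Rightarrow> 'n::finite asym \<Rightarrow> bool" where
  "homg k p v \<longleftrightarrow> app weyl.degS v = k *\<^sub>R v \<and> of_type p v"

lemma degS_ahom: "app weyl.degS (ahom k v) = real k *\<^sub>R ahom k v"
  by (intro asym_eqI) (simp add: sym_of_degS sym_of_ahom)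

lemma degS_below: "app weyl.degS v = c *\<^sub>R v \<Longrightarrow> c < real k \<Longrightarrow> below k v"
  by (auto simp: degS_eigen below_def)

lemma degS_neg: "app weyl.degS v = c *\<^sub>R v \<Longrightarrow> c < 0 \<Longrightarrow> v = 0"
  using degS_below[of v c 0] by simp

lemma degS_ahom_eq: "app weyl.degS v = real k *\<^sub>R v \<Longrightarrow> ahom j v = (if j = k then v else 0)"
  by (intro asym_eqI) (auto simp: degS_eigen sym_of_ahom)

lemma below_decomp: "below K v \<Longrightarrow> v = (\<Sum>k<K. ahom k v)"
proof (intro asym_eqI)
  fix \<alpha> x I assume "below K v"
  then have "sym_of v \<alpha> x I = (if multi_deg \<alpha> < K then sym_of v \<alpha> x I else 0)"
    by (auto simp: below_def)
  also have "\<dots> = sym_of (\<Sum>k<K. ahom k v) \<alpha> x I" by (simp add: sym_of_ahom)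
  finally show "sym_of v \<alpha> x I = sym_of (\<Sum>k<K. ahom k v) \<alpha> x I" .
qed

lemma fin_ahom: "fin (ahom k v)"
  unfolding fin_below using degS_below[OF degS_ahom, of k "Suc k"] by auto

lemma of_type_lin: "of_type p u \<Longrightarrow> of_type p v \<Longrightarrow> of_type p (u + v)" "of_type p u \<Longrightarrow> of_type p v \<Longrightarrow> of_type p (u - v)"
  "of_type p u \<Longrightarrow> of_type p (c *\<^sub>R u)" "of_type p 0"
  by (simp_all add: of_type_def algebra_simps)

lemma of_type_sum: "(\<And>i. i \<in> S \<Longrightarrow> of_type p (f i)) \<Longrightarrow> of_type p (sum f S)"
  by (induction S rule: infinite_finite_induct) (simp_all add: of_type_lin)

lemma of_type_ahom: "of_type p v \<Longrightarrow> of_type p (ahom k v)"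
  by (auto simp: of_type_def degL_eigen sym_of_ahom)

text \<open>An operator commuting with \<open>degS\<close> preserves its eigenspaces. The bound K
  makes v a finite sum of components; f is merely linear and need not respect infinite sums.\<close>

lemma ahom_commute:
  assumes "comm weyl.degS f = 0" "below K v"
  shows "app f (ahom k v) = ahom k (app f v)" and "below K (app f v)"
proof -
  have f: "app weyl.degS (app f (ahom j v)) = real j *\<^sub>R app f (ahom j v)" for j
  proof -
    have "app (weyl.degS * f) (ahom j v) = app (f * weyl.degS) (ahom j v)"
      using assms(1) by (simp only: comm_zero_iff)
    then show ?thesis by (simp add: degS_ahom)
  qed
  have d: "app f v = (\<Sum>j<K. app f (ahom j v))"
    using below_decomp[OF assms(2)] by (metis app_sum_right)
  show "below K (app f v)" unfolding d
    by (intro below_sum degS_below[OF f]) simp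
  have "ahom k (app f v) = (\<Sum>j<K. if k = j then app f (ahom j v) else 0)"
    unfolding d ahom_sum using degS_ahom_eq[OF f] by simp
  also have "\<dots> = app f (ahom k v)"
    using below_ahom[OF assms(2), of k] by auto
  finally show "app f (ahom k v) = ahom k (app f v)" ..
qed

lemma of_type_commute: "comm weyl.degL f = 0 \<Longrightarrow> of_type p v \<Longrightarrow> of_type p (app f v)"
  unfolding of_type_def comm_zero_iff by (metis app_simps(7) app_lin(5))

subsection \<open>Iterating the invariant operators\<close>

lemma degS_N: "comm weyl.N1 weyl.degS = weyl.N1" "comm weyl.N2 weyl.degS = weyl.N2"
   "comm (weyl.A c) weyl.degS = weyl.A c" "comm (weyl.B c) weyl.degS = weyl.B c"
  by (simp_all add: weyl.N1_def weyl.N2_def weyl.A_def weyl.B_def comm_mult_left weyl.comm_dl weyl.comm_ds weyl.comm_dv weyl.Dc_comm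
    distrib_left distrib_right)

lemma degL_N: "comm weyl.degL weyl.N1 = 0" "comm weyl.degL weyl.N2 = 0" "comm weyl.degL (weyl.A c) = 0" "comm weyl.degL (weyl.B c) = 0"
proof -
  have "comm weyl.N1 weyl.degL = 0" "comm weyl.N2 weyl.degL = 0" "comm (weyl.A c) weyl.degL = 0" "comm (weyl.B c) weyl.degL = 0"
    by (simp_all add: weyl.N1_def weyl.N2_def weyl.A_def weyl.B_def comm_mult_left weyl.comm_dl weyl.comm_ds weyl.comm_dv weyl.Dc_comm)
  from this[THEN comm_flip]
  show "comm weyl.degL weyl.N1 = 0" "comm weyl.degL weyl.N2 = 0" "comm weyl.degL (weyl.A c) = 0" "comm weyl.degL (weyl.B c) = 0"
    by simp_all
qed

lemma homg_lower:
  assumes "comm f weyl.degS = f" "comm weyl.degL f = 0" "homg k p v"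
  shows "homg (k - 1) p (app f v)"
proof -
  have "app (f * weyl.degS) v = app (weyl.degS * f + f) v" using assms(1) by (simp only: comm_eq_iff)
  then have "app weyl.degS (app f v) = (k - 1) *\<^sub>R app f v"
    using assms(3) by (simp add: homg_def scaleR_diff_left)
  moreover have "of_type p (app f v)" using assms by (simp add: homg_def of_type_commute)
  ultimately show ?thesis by (simp add: homg_def)
qed

lemmas homg_N = homg_lower[OF degS_N(1) degL_N(1)] homg_lower[OF degS_N(2) degL_N(2)]
  homg_lower[OF degS_N(3) degL_N(3)] homg_lower[OF degS_N(4) degL_N(4)]

lemma homg_power:
  assumes "homg k p v"
  shows "homg (k - real l) p (app (weyl.N1 ^ l) v)" "homg (k - real l) p (app (weyl.N2 ^ l) v)"
proof (induction l)
  case (Suc l)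
  show "homg (k - real (Suc l)) p (app (weyl.N1 ^ Suc l) v)" "homg (k - real (Suc l)) p (app (weyl.N2 ^ Suc l) v)"
    using homg_N(1)[OF Suc(1)] homg_N(2)[OF Suc(2)] by (simp_all add: algebra_simps)
qed (use assms in simp_all)

lemma N_Lam:
  fixes v :: "'n::finite asym"
  assumes "homg k p v"
  shows "app weyl.N1 (app (weyl.Lam a b c) v) = app (weyl.Lam a b c) (app weyl.N1 v) - (2 * k + p + CARD('n)) *\<^sub>R app (weyl.A c) v"
    and "app weyl.N2 (app (weyl.Lam a b c) v) = app (weyl.Lam a b c) (app weyl.N2 v) - (2 * k + p + CARD('n) - 1) *\<^sub>R app (weyl.B c) v"
proof -
  have 1: "app (weyl.N1 * weyl.Lam a b c) v = app (weyl.Lam a b c * weyl.N1 - (2 * weyl.degS + weyl.degL + of_nat (CARD('n) + 2)) * weyl.A c) v"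
    using weyl.comm_N1_Lam[of a b c] by (simp add: comm_eq_iff)
  have 2: "app (weyl.N2 * weyl.Lam a b c) v = app (weyl.Lam a b c * weyl.N2 - (2 * weyl.degS + weyl.degL + of_nat (CARD('n) + 1)) * weyl.B c) v"
    using weyl.comm_N2_Lam[of a b c] by (simp add: comm_eq_iff)
  \<comment> \<open>The degree operators stand to the left of \<open>A c\<close> and
    \<open>B c\<close>, hence act in degree k - 1.\<close>
  have d: "app (2 * weyl.degS + weyl.degL + of_nat m) u = (2 * (k - 1) + p + m) *\<^sub>R u" if "homg (k - 1) p u" for u :: "'n asym" and m
    using that by (simp add: homg_def of_type_def scaleR_add_left del: of_nat_add)
  show "app weyl.N1 (app (weyl.Lam a b c) v) = app (weyl.Lam a b c) (app weyl.N1 v) - (2 * k + p + CARD('n)) *\<^sub>R app (weyl.A c) v"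
    using 1 unfolding app_simps(4,7) d[OF homg_N(3)[OF assms]] by simp
  show "app weyl.N2 (app (weyl.Lam a b c) v) = app (weyl.Lam a b c) (app weyl.N2 v) - (2 * k + p + CARD('n) - 1) *\<^sub>R app (weyl.B c) v"
    using 2 unfolding app_simps(4,7) d[OF homg_N(4)[OF assms]] by (simp add: algebra_simps)
qed

text \<open>Up to the factor \<open>n + 1\<close>, the scalars are the differences \<open>\<alpha>\<^sup>k - \<alpha>\<^sup>k\<^sup>-\<^sup>l\<close> and
  \<open>\<beta>\<^sup>k - \<beta>\<^sup>k\<^sup>-\<^sup>l\<close> with \<open>l = m + 1\<close>.\<close>

lemma N_power_Lam:
  fixes v :: "'n::finite asym"
  assumes "homg k p v"
  shows "app (weyl.N1 ^ Suc m) (app (weyl.Lam a b c) v) = app (weyl.Lam a b c) (app (weyl.N1 ^ Suc m) v)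
      - (real (Suc m) * (2 * k - real (Suc m) + CARD('n) + 1 + p)) *\<^sub>R app (weyl.A c) (app (weyl.N1 ^ m) v)" (is ?A)
    and "app (weyl.N2 ^ Suc m) (app (weyl.Lam a b c) v) = app (weyl.Lam a b c) (app (weyl.N2 ^ Suc m) v)
      - (real (Suc m) * (2 * k - real (Suc m) + CARD('n) + p)) *\<^sub>R app (weyl.B c) (app (weyl.N2 ^ m) v)" (is ?B)
proof -
  have cA: "app weyl.N1 (app (weyl.A c) u) = app (weyl.A c) (app weyl.N1 u)"
    and cB: "app weyl.N2 (app (weyl.B c) u) = app (weyl.B c) (app weyl.N2 u)" for u :: "'n asym"
    by (simp_all add: weyl.AB_N flip: app_simps(7))
  show ?A
  proof (induction m)
    case 0
    then show ?case using N_Lam(1)[OF assms, of a b c] by (simp add: algebra_simps)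
  next
    case (Suc m)
    have "app (weyl.N1 ^ Suc (Suc m)) (app (weyl.Lam a b c) v) = app weyl.N1 (app (weyl.N1 ^ Suc m) (app (weyl.Lam a b c) v))"
      by simp
    also have "\<dots> = app weyl.N1 (app (weyl.Lam a b c) (app (weyl.N1 ^ Suc m) v))
        - (real (Suc m) * (2 * k - real (Suc m) + CARD('n) + 1 + p)) *\<^sub>R app (weyl.A c) (app (weyl.N1 ^ Suc m) v)"
      unfolding Suc by (simp add: cA)
    also have "\<dots> = app (weyl.Lam a b c) (app (weyl.N1 ^ Suc (Suc m)) v)
        - (2 * (k - real (Suc m)) + p + CARD('n) + real (Suc m) * (2 * k - real (Suc m) + CARD('n) + 1 + p)) *\<^sub>R app (weyl.A c) (app (weyl.N1 ^ Suc m) v)"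
      unfolding N_Lam(1)[OF homg_power(1)[OF assms]] by (simp add: scaleR_add_left)
    \<comment> \<open>The scalars 2 (k - i) + p + n for i from 0 to m + 1 form an arithmetic
      progression, and this is its sum.\<close>
    also have "2 * (k - real (Suc m)) + p + CARD('n) + real (Suc m) * (2 * k - real (Suc m) + CARD('n) + 1 + p)
      = real (Suc (Suc m)) * (2 * k - real (Suc (Suc m)) + CARD('n) + 1 + p)"
      by (simp add: algebra_simps)
    finally show ?case .
  qed
  show ?B
  proof (induction m)
    case 0
    then show ?case using N_Lam(2)[OF assms, of a b c] by (simp add: algebra_simps)
  next
    case (Suc m)
    have "app (weyl.N2 ^ Suc (Suc m)) (app (weyl.Lam a b c) v) = app weyl.N2 (app (weyl.N2 ^ Suc m) (app (weyl.Lam a b c) v))"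
      by simp
    also have "\<dots> = app weyl.N2 (app (weyl.Lam a b c) (app (weyl.N2 ^ Suc m) v))
        - (real (Suc m) * (2 * k - real (Suc m) + CARD('n) + p)) *\<^sub>R app (weyl.B c) (app (weyl.N2 ^ Suc m) v)"
      unfolding Suc by (simp add: cB)
    also have "\<dots> = app (weyl.Lam a b c) (app (weyl.N2 ^ Suc (Suc m)) v)
        - (2 * (k - real (Suc m)) + p + CARD('n) - 1 + real (Suc m) * (2 * k - real (Suc m) + CARD('n) + p)) *\<^sub>R app (weyl.B c) (app (weyl.N2 ^ Suc m) v)"
      unfolding N_Lam(2)[OF homg_power(2)[OF assms]] by (simp add: scaleR_add_left)
    also have "2 * (k - real (Suc m)) + p + CARD('n) - 1 + real (Suc m) * (2 * k - real (Suc m) + CARD('n) + p)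
      = real (Suc (Suc m)) * (2 * k - real (Suc (Suc m)) + CARD('n) + p)"
      by (simp add: algebra_simps)
    finally show ?case .
  qed
qed

section \<open>The quantization map\<close>

definition alpha_factor :: "nat \<Rightarrow> nat \<Rightarrow> nat \<Rightarrow> nat \<Rightarrow> real" where
  "alpha_factor n p k l = (1 / (real n + 1)) ^ l * (\<Prod>j=1..l. 1 / (alpha_coeff n p k - alpha_coeff n p (k - j)))"

definition beta_factor :: "nat \<Rightarrow> nat \<Rightarrow> nat \<Rightarrow> nat \<Rightarrow> real" where
  "beta_factor n p k l = (1 / (real n + 1)) ^ l * (\<Prod>j=1..l. 1 / (beta_coeff n p k - beta_coeff n p (k - j)))"

text \<open>The recursion behind the telescoping: the scalar s from the commutator with the power of
  exponent l + 1 cancels the newest factor of the coefficient. In the applications d is n +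
  1.\<close>

lemma coeff_prod_Suc:
  fixes g :: "nat \<Rightarrow> real"
  assumes "g (Suc l) = s / d" "s \<noteq> 0" "d \<noteq> 0"
  shows "(1 / d) ^ Suc l * (\<Prod>j=1..Suc l. 1 / g j) * s = (1 / d) ^ l * (\<Prod>j=1..l. 1 / g j)"
proof -
  have "(1 / d) ^ Suc l * (\<Prod>j=1..Suc l. 1 / g j) * s = (1 / d) ^ l * (\<Prod>j=1..l. 1 / g j) * (1 / d * (1 / g (Suc l)) * s)"
    by (simp add: prod.nat_ivl_Suc')
  also have "1 / d * (1 / g (Suc l)) * s = 1" using assms by simp
  finally show ?thesis by simp
qed

lemma alpha_factor_Suc:
  assumes "Suc l \<le> k"
  shows "alpha_factor n p k (Suc l) * (real (Suc l) * (2 * real k - real (Suc l) + n + 1 + p)) = alpha_factor n p k l"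
proof -
  let ?s = "real (Suc l) * (2 * real k - real (Suc l) + n + 1 + p)"
  have 1: "alpha_coeff n p k - alpha_coeff n p (k - Suc l) = ?s / (real n + 1)"
    using assms by (simp add: alpha_coeff_def of_nat_diff diff_divide_distrib [symmetric]) (simp add: algebra_simps)
  have "?s > 0" using assms by (intro mult_pos_pos) linarith+
  then have ne: "?s \<noteq> 0" by (rule less_imp_neq[symmetric])
  show ?thesis
    unfolding alpha_factor_def by (rule coeff_prod_Suc[where g = "\<lambda>j. alpha_coeff n p k - alpha_coeff n p (k - j)", OF 1 ne]) simp
qed

lemma beta_factor_Suc:
  assumes "Suc l \<le> k" "n > 0"
  shows "beta_factor n p k (Suc l) * (real (Suc l) * (2 * real k - real (Suc l) + n + p)) = beta_factor n p k l"
proof -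
  let ?s = "real (Suc l) * (2 * real k - real (Suc l) + n + p)"
  have 1: "beta_coeff n p k - beta_coeff n p (k - Suc l) = ?s / (real n + 1)"
    using assms by (simp add: beta_coeff_def of_nat_diff diff_divide_distrib [symmetric]) (simp add: algebra_simps)
  have "?s > 0" using assms by (intro mult_pos_pos) linarith+
  then have ne: "?s \<noteq> 0" by (rule less_imp_neq[symmetric])
  show ?thesis
    unfolding beta_factor_def by (rule coeff_prod_Suc[where g = "\<lambda>j. beta_coeff n p k - beta_coeff n p (k - j)", OF 1 ne]) simp
qed

lemma factor_zero [simp]: "alpha_factor n p k 0 = 1" "beta_factor n p k 0 = 1"
  by (simp_all add: alpha_factor_def beta_factor_def)

section \<open>The quantization map on \<open>asym\<close> and its equivariance\<close>

definition quant_term :: "nat \<Rightarrow> nat \<Rightarrow> nat \<Rightarrow> 'n::finite asym \<Rightarrow> 'n asym" where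
  "quant_term p k l v = alpha_factor CARD('n) p k l *\<^sub>R app (weyl.N1 ^ l) v + beta_factor CARD('n) p k l *\<^sub>R app (weyl.N2 ^ l) v"

definition quant_hom_asym :: "nat \<Rightarrow> nat \<Rightarrow> 'n::finite asym \<Rightarrow> 'n asym" where
  "quant_hom_asym p k v = v + (\<Sum>l=1..k. quant_term p k l v)"

definition quant_asym :: "nat \<Rightarrow> 'n::finite asym \<Rightarrow> 'n asym" where
  "quant_asym p v = (\<Sum>k | ahom k v \<noteq> 0. quant_hom_asym p k (ahom k v))"

lemma sym_of_plus: "sym_of (u + v) = sym_of u + sym_of v" and sym_of_zero: "sym_of 0 = 0"
  and sym_of_scale: "sym_of (c *\<^sub>R u) = scale_symbol c (sym_of u)"
  and sym_of_minus: "sym_of (u - v) = sym_of u - sym_of v"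
  by (simp_all add: fun_eq_iff scale_symbol_def)

lemma sym_of_sum_fun: "sym_of (sum f S) = (\<Sum>i\<in>S. sym_of (f i))"
  by (induction S rule: infinite_finite_induct) (simp_all only: sum.infinite sum.empty sum.insert sym_of_zero sym_of_plus simp_thms)

lemma sym_of_N_power:
  "((delta \<circ> symbol_div \<circ> delta_star) ^^ l) (sym_of v) = sym_of (app (weyl.N1 ^ l) v)"
  "((delta_star \<circ> symbol_div \<circ> delta) ^^ l) (sym_of v) = sym_of (app (weyl.N2 ^ l) v)"
  by (induction l) (simp_all add: delta_sym_of delta_star_sym_of symbol_div_sym_of weyl.N1_def weyl.N2_def mult.assoc)

lemma quant_hom_sym_of: "quant_hom p k (sym_of v) = sym_of (quant_hom_asym p k v)"
  by (simp only: quant_hom_def quant_alpha_def quant_beta_def sym_of_N_power quant_hom_asym_def quant_term_def sym_of_plus sym_of_scale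
    sym_of_sum_fun alpha_factor_def beta_factor_def)

lemma quant_sym_of: "quant p (sym_of v) = sym_of (quant_asym p v)"
proof -
  have "hom_part k (sym_of v) = 0 \<longleftrightarrow> ahom k v = 0" for k
    by (simp only: ahom.rep_eq [symmetric] sym_of_zero [symmetric] sym_of_inject)
  then show ?thesis
    by (simp only: quant_def quant_asym_def sym_of_sum_fun quant_hom_sym_of ahom.rep_eq [symmetric])
qed

lemma quant_hom_asym_lin: "quant_hom_asym p k (u + v) = quant_hom_asym p k u + quant_hom_asym p k v" "quant_hom_asym p k (c *\<^sub>R v) = c *\<^sub>R quant_hom_asym p k v" "quant_hom_asym p k 0 = 0"
  by (simp_all add: quant_hom_asym_def quant_term_def sum.distrib scaleR_sum_right algebra_simps)

lemma quant_asym_below: "below K v \<Longrightarrow> quant_asym p v = (\<Sum>k<K. quant_hom_asym p k (ahom k v))"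
  unfolding quant_asym_def
  by (rule sum.mono_neutral_left) (use below_ahom[of K v] in \<open>auto simp: quant_hom_asym_lin not_less [symmetric]\<close>)

lemma quant_hom_asym_triangular:
  assumes "homg (real k) p v"
  shows "below k (quant_hom_asym p k v - v)" "of_type p (quant_hom_asym p k v)" "fin (quant_hom_asym p k v)"
proof -
  have "below k (quant_term p k l v)" if "l \<in> {1..k}" for l
    unfolding quant_term_def using homg_power[OF assms, of l] that
    by (intro below_lin degS_below) (auto simp: homg_def)
  then show "below k (quant_hom_asym p k v - v)" by (auto simp: quant_hom_asym_def intro: below_sum)
  have "of_type p (quant_term p k l v)" for l
    unfolding quant_term_def using homg_power[OF assms, of l]
    by (intro of_type_lin) (auto simp: homg_def)
  then show "of_type p (quant_hom_asym p k v)" using assms by (auto simp: quant_hom_asym_def homg_def intro!: of_type_lin of_type_sum)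
  have "below (Suc k) v" using assms degS_below[of v k "Suc k"] by (simp add: homg_def)
  moreover have "below (Suc k) (quant_hom_asym p k v - v)" using \<open>below k (quant_hom_asym p k v - v)\<close> by (rule below_mono) simp
  ultimately have "below (Suc k) (v + (quant_hom_asym p k v - v))" by (rule below_lin)
  then show "fin (quant_hom_asym p k v)" unfolding fin_below by auto
qed

lemma homg_ahom: "of_type p v \<Longrightarrow> homg (real k) p (ahom k v)"
  by (simp add: homg_def degS_ahom of_type_ahom)

lemma homg_neg: "homg k p v \<Longrightarrow> k < 0 \<Longrightarrow> v = 0"
  using degS_neg by (auto simp: homg_def)

lemma quant_hom_asym_equivariant:
  fixes v :: "'n::finite asym"
  assumes "homg (real k) p v"
  shows "quant_hom_asym p k (app (weyl.Lam a b c) v) = app (weyl.Lam a b c - weyl.A c - weyl.B c) (quant_hom_asym p k v)"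
proof -
  \<comment> \<open>\<open>F m\<close> is the defect of the term of index m + 1, and for positive m
    also the image of the term of index m under \<open>A c + B c\<close>.\<close>
  define F where "F l = alpha_factor CARD('n) p k l *\<^sub>R app (weyl.A c) (app (weyl.N1 ^ l) v)
      + beta_factor CARD('n) p k l *\<^sub>R app (weyl.B c) (app (weyl.N2 ^ l) v)" for l
  have step: "quant_term p k (Suc m) (app (weyl.Lam a b c) v) = app (weyl.Lam a b c) (quant_term p k (Suc m) v) - F m"
    if "Suc m \<le> k" for m
  proof -
    have c: "alpha_factor CARD('n) p k (Suc m) *\<^sub>R (real (Suc m) * (2 * real k - real (Suc m) + CARD('n) + 1 + p)) *\<^sub>R u
        = alpha_factor CARD('n) p k m *\<^sub>R u"
      "beta_factor CARD('n) p k (Suc m) *\<^sub>R (real (Suc m) * (2 * real k - real (Suc m) + CARD('n) + p)) *\<^sub>R u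
        = beta_factor CARD('n) p k m *\<^sub>R u" for u :: "'n asym"
      unfolding scaleR_scaleR alpha_factor_Suc[OF that] beta_factor_Suc[OF that zero_less_card_finite] by simp_all
    show ?thesis
      unfolding quant_term_def N_power_Lam[OF assms] scaleR_diff_right c F_def app_lin by (rule add_diff_add [symmetric])
  qed
  \<comment> \<open>For positive powers the mixed terms contain \<open>A c * N2\<close> or
    \<open>B c * N1\<close> and vanish. At index 0 the term \<open>quant_term p k 0 v\<close> would
    count v twice; \<open>F0\<close> covers this case.\<close>
  have AB: "app (weyl.A c + weyl.B c) (quant_term p k (Suc m) v) = F (Suc m)" for m
  proof -
    have "app (weyl.A c) (app (weyl.N2 ^ Suc m) v) = app (weyl.A c * weyl.N2) (app (weyl.N2 ^ m) v)"
      "app (weyl.B c) (app (weyl.N1 ^ Suc m) v) = app (weyl.B c * weyl.N1) (app (weyl.N1 ^ m) v)"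
      by simp_all
    then show ?thesis
      unfolding weyl.AB_N by (simp add: quant_term_def F_def del: power_Suc)
  qed
  have F0: "F 0 = app (weyl.A c + weyl.B c) v" by (simp add: F_def)
  \<comment> \<open>After k steps the degree is 0, and one more lowering leads to degree -1; this
    closes the telescoping sum.\<close>
  have Fk: "F k = 0"
  proof -
    have "homg (-1) p (app (weyl.A c) (app (weyl.N1 ^ k) v))" "homg (-1) p (app (weyl.B c) (app (weyl.N2 ^ k) v))"
      using homg_N(3)[OF homg_power(1)[OF assms], of k c] homg_N(4)[OF homg_power(2)[OF assms], of k c] by simp_all
    from this[THEN homg_neg] show ?thesis by (simp add: F_def)
  qed
  have sh: "(\<Sum>l=1..k. g l) = (\<Sum>m<k. g (Suc m))" for g :: "nat \<Rightarrow> 'n asym"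
    by (simp add: sum.atLeast1_atMost_eq)
  have "quant_hom_asym p k (app (weyl.Lam a b c) v)
      = app (weyl.Lam a b c) v + (\<Sum>m<k. app (weyl.Lam a b c) (quant_term p k (Suc m) v) - F m)"
    unfolding quant_hom_asym_def sh using step by (intro arg_cong2[where f = "(+)"] refl sum.cong) simp
  also have "\<dots> = app (weyl.Lam a b c) (quant_hom_asym p k v) - (\<Sum>m<k. F m)"
    unfolding quant_hom_asym_def sh by (simp add: sum_subtractf app_sum_right)
  also have "(\<Sum>m<k. F m) = F 0 + (\<Sum>m<k. F (Suc m))"
    using sum.lessThan_Suc_shift[of F k] Fk by simp
  also have "\<dots> = app (weyl.A c + weyl.B c) (quant_hom_asym p k v)"
    unfolding quant_hom_asym_def sh F0 AB[symmetric] by (simp only: app_lin app_sum_right)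
  finally show ?thesis by (simp add: algebra_simps)
qed

lemma quant_asym_equivariant:
  assumes "fin v" "of_type p v"
  shows "quant_asym p (app (weyl.Lam a b c) v) = app (weyl.Lam a b c - weyl.A c - weyl.B c) (quant_asym p v)"
proof -
  obtain K where K: "below K v" using assms unfolding fin_below by blast
  have eq: "quant_hom_asym p k (ahom k (app (weyl.Lam a b c) v)) = app (weyl.Lam a b c - weyl.A c - weyl.B c) (quant_hom_asym p k (ahom k v))" for k
    unfolding ahom_commute(1)[OF weyl.Lam_comm(3) K, symmetric] by (rule quant_hom_asym_equivariant[OF homg_ahom[OF assms(2)]])
  show ?thesis
    unfolding quant_asym_below[OF K] quant_asym_below[OF ahom_commute(2)[OF weyl.Lam_comm(3) K]] app_sum_right eq ..
qed

subsection \<open>Triangular maps\<close>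

definition typed :: "nat \<Rightarrow> 'n::finite asym \<Rightarrow> bool" where
  "typed p v \<longleftrightarrow> fin v \<and> of_type p v"

lemma typed_lin: "typed p u \<Longrightarrow> typed p v \<Longrightarrow> typed p (u + v)" "typed p u \<Longrightarrow> typed p v \<Longrightarrow> typed p (u - v)"
  "typed p u \<Longrightarrow> typed p (c *\<^sub>R u)" "typed p 0"
  by (auto simp: typed_def fin_add fin_diff fin_scale fin_zero of_type_lin)

lemma typed_ahom: "typed p v \<Longrightarrow> typed p (ahom k v)"
  by (simp add: typed_def fin_ahom of_type_ahom)

text \<open>Serves twice: for \<open>quant_asym\<close>, to obtain bijectivity, and for arbitrary
  quantization maps in the proof of uniqueness.\<close>

locale triangular =
  fixes p :: nat and T :: "'n::finite asym \<Rightarrow> 'n asym"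
  assumes typed: "typed p v \<Longrightarrow> typed p (T v)"
    and lin: "typed p u \<Longrightarrow> typed p v \<Longrightarrow> T (a *\<^sub>R u + b *\<^sub>R v) = a *\<^sub>R T u + b *\<^sub>R T v"
    and tri: "typed p v \<Longrightarrow> app weyl.degS v = real k *\<^sub>R v \<Longrightarrow> below k (T v - v)"
begin

lemma T_add: "typed p u \<Longrightarrow> typed p v \<Longrightarrow> T (u + v) = T u + T v"
  and T_diff: "typed p u \<Longrightarrow> typed p v \<Longrightarrow> T (u - v) = T u - T v"
  and T_scale: "typed p u \<Longrightarrow> T (c *\<^sub>R u) = c *\<^sub>R T u"
  using lin[of u v 1 1] lin[of u v 1 "-1"] lin[of u u c 0] by simp_all

lemma T_zero: "T 0 = 0"
  using lin[OF typed_lin(4) typed_lin(4), of 0 0] by simp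

lemma T_sum: "(\<And>i. i \<in> S \<Longrightarrow> typed p (f i)) \<Longrightarrow> T (sum f S) = (\<Sum>i\<in>S. T (f i)) \<and> typed p (sum f S)"
  by (induction S rule: infinite_finite_induct) (simp_all add: T_zero T_add typed_lin)

lemma T_leading: "typed p v \<Longrightarrow> below (Suc k) v \<Longrightarrow> below k (T v - ahom k v)"
proof (induction k arbitrary: v)
  case 0
  have "below 0 (v - ahom 0 v)" using below_Suc_ahom 0 by blast
  then have "v = ahom 0 v" by simp
  then show ?case using tri[OF 0(1), of 0] degS_ahom[of 0 v] by simp
next
  case (Suc k)
  let ?h = "ahom (Suc k) v"
  have r: "below (Suc k) (v - ?h)" "typed p (v - ?h)" and h: "typed p ?h"
    using Suc.prems by (auto intro: below_Suc_ahom typed_lin typed_ahom)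
  have "below k (T (v - ?h) - ahom k (v - ?h))" by (rule Suc.IH) (use r in auto)
  then have "below (Suc k) (T (v - ?h) - ahom k (v - ?h))" by (rule below_mono) simp
  moreover have "below (Suc k) (ahom k (v - ?h))"
    by (rule degS_below[OF degS_ahom]) simp
  ultimately have 1: "below (Suc k) (T (v - ?h) - ahom k (v - ?h) + ahom k (v - ?h))" by (rule below_lin)
  have 2: "below (Suc k) (T ?h - ?h)" by (rule tri[OF h degS_ahom])
  have "T v = T ?h + T (v - ?h)" using T_add[OF h r(2)] by simp
  then have eq: "T v - ?h = (T ?h - ?h) + (T (v - ?h) - ahom k (v - ?h) + ahom k (v - ?h))" by simp
  show ?case unfolding eq by (rule below_lin(1)[OF 2 1])
qed

text \<open>A leading component of v in degree at least k would, by \<open>T_leading\<close>, be the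
  leading component of \<open>T v\<close> as well.\<close>

lemma below_reflect: "typed p v \<Longrightarrow> below k (T v) \<Longrightarrow> below k v"
proof -
  assume v: "typed p v" and k: "below k (T v)"
  have "below (k + l) v \<Longrightarrow> below k v" for l
  proof (induction l)
    case (Suc l)
    have "below (k + l) (T v)" using k by (rule below_mono) simp
    moreover have "below (k + l) (T v - ahom (k + l) v)" using T_leading[OF v] Suc.prems by simp
    ultimately have "below (k + l) (T v - (T v - ahom (k + l) v))" by (rule below_lin)
    then have "ahom (k + l) (ahom (k + l) v) = 0" by (intro below_ahom[of "k + l"]) simp_all
    then have "ahom (k + l) v = 0" using degS_ahom_eq[OF degS_ahom, of "k + l" "k + l" v] by simp
    then show ?case using Suc ahom_zero_below[of "k + l" v] by simp
  qed simp
  moreover obtain K where "below K v" using v by (auto simp: typed_def fin_below)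
  then have "below (k + K) v" by (rule below_mono) simp
  ultimately show ?thesis by blast
qed

lemma T_eq_zero: "typed p v \<Longrightarrow> T v = 0 \<Longrightarrow> v = 0"
  using below_reflect[of v 0] by simp

lemma T_inj: "typed p u \<Longrightarrow> typed p v \<Longrightarrow> T u = T v \<Longrightarrow> u = v"
  using T_eq_zero[of "u - v"] T_diff[of u v] typed_lin(2)[of p u v] by simp

lemma T_surj: "typed p w \<Longrightarrow> \<exists>v. typed p v \<and> T v = w"
proof -
  have "typed p w \<Longrightarrow> below k w \<Longrightarrow> \<exists>v. typed p v \<and> T v = w" for k
  proof (induction k arbitrary: w)
    case 0
    then show ?case using T_zero typed_lin(4) by auto
  next
    case (Suc k)
    let ?h = "ahom k w"
    have h: "typed p ?h" using Suc typed_ahom by blast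
    \<comment> \<open>Subtracting the image of the leading component removes degree k from
      w.\<close>
    have "below k (w - ?h)" "below k (T ?h - ?h)"
      using Suc below_Suc_ahom tri[OF h degS_ahom] by blast+
    then have "below k ((w - ?h) - (T ?h - ?h))" by (rule below_lin)
    then have "below k (w - T ?h)" by simp
    then obtain r where "typed p r" "T r = w - T ?h"
      using Suc.IH[of "w - T ?h"] Suc.prems h typed typed_lin(2) by blast
    then show ?case using h by (intro exI[of _ "?h + r"]) (simp add: T_add typed_lin)
  qed
  then show "typed p w \<Longrightarrow> \<exists>v. typed p v \<and> T v = w" by (auto simp: typed_def fin_below)
qed

end

subsection \<open>Uniqueness\<close>

lemma cas_homg:
  assumes "homg k p v"
  shows "app weyl.cas v = (2 * (k + p) * (k + CARD('n))) *\<^sub>R v + 2 *\<^sub>R app (weyl.dl * weyl.ds) (v :: 'n::finite asym)"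
proof -
  have "app weyl.degS v = k *\<^sub>R v" "app weyl.degL v = p *\<^sub>R v" using assms by (simp_all add: homg_def of_type_def)
  moreover have "(a * (b * 2)) *\<^sub>R v = (a * b) *\<^sub>R v + (a * b) *\<^sub>R v" for a b
    by (simp add: scaleR_2 [symmetric] mult_ac)
  ultimately have "app weyl.cas v = ((2 * CARD('n) + 1) * (k + p) + (k + p) * (k + p) + k * k - k - p * p - p) *\<^sub>R v
      + 2 *\<^sub>R app (weyl.dl * weyl.ds) v"
    unfolding weyl.cas_eq weyl.tot_def by (simp add: algebra_simps)
  also have "(2 * CARD('n) + 1) * (k + p) + (k + p) * (k + p) + k * k - k - p * p - p = 2 * (k + p) * (k + CARD('n))"
    by (simp add: algebra_simps)
  finally show ?thesis .
qed

text \<open>From \<open>dl * ds * dl = tot * dl\<close>. The only possible eigenvalues of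
  \<open>dl * ds\<close> are thus 0 and k + p, which settles those of \<open>cas\<close> by
  \<open>cas_homg\<close>.\<close>

lemma dl_ds_twice:
  fixes v :: "'n::finite asym"
  assumes "homg k p v"
  shows "app (weyl.dl * weyl.ds) (app (weyl.dl * weyl.ds) v) = (k + p) *\<^sub>R app (weyl.dl * weyl.ds) v"
    and "homg k p (app (weyl.dl * weyl.ds) v)"
proof -
  have "comm (weyl.dl * weyl.ds) weyl.degS = 0" "comm (weyl.dl * weyl.ds) weyl.degL = 0"
    by (simp_all add: comm_mult_left weyl.comm_dl weyl.comm_ds)
  from this[THEN comm_flip] have com: "weyl.degS * (weyl.dl * weyl.ds) = (weyl.dl * weyl.ds) * weyl.degS"
    and L: "comm weyl.degL (weyl.dl * weyl.ds :: 'n symop) = 0"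
    by (simp_all add: comm_def)
  have "app (weyl.degS * (weyl.dl * weyl.ds)) v = k *\<^sub>R app (weyl.dl * weyl.ds) v"
    using assms unfolding com by (simp add: homg_def)
  then show h: "homg k p (app (weyl.dl * weyl.ds) v)"
    using assms of_type_commute[OF L] by (simp add: homg_def)
  have "weyl.dl * weyl.ds * (weyl.dl * weyl.ds) = weyl.tot * (weyl.dl * weyl.ds :: 'n symop)"
    by (simp only: mult.assoc [symmetric] weyl.dl_ds_dl)
  then have "app (weyl.dl * weyl.ds) (app (weyl.dl * weyl.ds) v) = app weyl.tot (app (weyl.dl * weyl.ds) v)"
    by (metis app_simps(7))
  with h show "app (weyl.dl * weyl.ds) (app (weyl.dl * weyl.ds) v) = (k + p) *\<^sub>R app (weyl.dl * weyl.ds) v"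
    by (simp add: weyl.tot_def homg_def of_type_def scaleR_add_left del: app_simps(7))
qed

lemma cas_comm: "comm weyl.degS weyl.cas = 0" "comm weyl.degL weyl.cas = 0"
  by (simp_all add: weyl.cas_def comm_bilin comm_mult_right weyl.deg_Lie)

text \<open>c is at least the smaller eigenvalue in degree k. A component of degree j < k would be
  an eigenvector of \<open>dl * ds\<close> with eigenvalue l such that l^2 = (j + p) l, while the
  bound on c forces l > j + p.\<close>

lemma cas_eigen_zero:
  fixes d :: "'n::finite asym"
  assumes "of_type p d" "below k d" "app weyl.cas d = c *\<^sub>R d" "c \<ge> 2 * (real k + p) * (real k + CARD('n))"
  shows "d = 0"
proof -
  let ?q = "app (weyl.dl * weyl.ds)"
  have "ahom j d = 0" if "j < k" for j
  proof -
    let ?e = "ahom j d"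
    let ?m = "real j + p"
    have e: "homg j p ?e" using assms(1) by (rule homg_ahom)
    have "c *\<^sub>R ?e = app weyl.cas ?e"
      using ahom_commute(1)[OF cas_comm(1) assms(2), of j] assms(3) by simp
    then have q: "2 *\<^sub>R ?q ?e = (c - 2 * ?m * (j + CARD('n))) *\<^sub>R ?e"
      unfolding cas_homg[OF e] by (simp add: scaleR_diff_left)
    define l where "l = (c - 2 * ?m * (j + CARD('n))) / 2"
    have q1: "?q ?e = l *\<^sub>R ?e"
    proof -
      have "?q ?e = (1 / 2) *\<^sub>R (2 *\<^sub>R ?q ?e)" by (simp del: app_simps(7))
      also have "\<dots> = l *\<^sub>R ?e" unfolding q by (simp add: l_def)
      finally show ?thesis .
    qed
    have "(l * l) *\<^sub>R ?e = (?m * l) *\<^sub>R ?e"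
      using dl_ds_twice(1)[OF e] unfolding q1 by (simp only: app_lin q1 scaleR_scaleR)
    then have "l = 0 \<or> l = ?m \<or> ?e = 0" by auto
    moreover have "l > ?m"
    proof -
      have n: "real CARD('n) > 0" by simp
      have "?m * (real j + CARD('n) + 1) \<le> (real k + p - 1) * (real k + CARD('n))"
        using that n by (intro mult_mono) linarith+
      also have "\<dots> < (real k + p) * (real k + CARD('n))"
        using n by (intro mult_strict_right_mono) linarith+
      finally have "2 * (?m * (real j + CARD('n) + 1)) < c" using assms(4) by linarith
      moreover have "2 * (?m * (real j + CARD('n) + 1)) = 2 * ?m * (j + CARD('n)) + 2 * ?m" by (simp add: algebra_simps)
      ultimately have "2 * ?m < c - 2 * ?m * (j + CARD('n))" by (simp only: less_diff_eq add.commute)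
      then show ?thesis unfolding l_def by (simp only: less_divide_eq_numeral1 mult.commute)
    qed
    ultimately show ?thesis by auto
  qed
  then show ?thesis using below_decomp[OF assms(2)] by simp
qed

text \<open>\<open>cas\<close> is a polynomial in the generators, whereas equivariance is stated for
  \<open>Lam\<close>; so each generator is written as a special \<open>Lam\<close>.\<close>

lemma Lam_unit:
  "weyl.Tr r = weyl.Lam (\<lambda>i. if i = r then 1 else 0) (\<lambda>_ _. 0) (\<lambda>_. 0)"
  "weyl.Gr r s = weyl.Lam (\<lambda>_. 0) (\<lambda>i j. if i = r \<and> j = s then 1 else 0) (\<lambda>_. 0)"
  "weyl.Zr r = weyl.Lam (\<lambda>_. 0) (\<lambda>_ _. 0) (\<lambda>i. if i = r then 1 else 0)"
proof -
  have "(if i = r \<and> j = s then 1 else 0 :: real) *\<^sub>R weyl.Gr i j = (if i = r then if j = s then weyl.Gr i j else 0 else 0)" for i j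
    by simp
  moreover have "(if i = r then 1 else 0 :: real) *\<^sub>R x = (if i = r then x else 0)" for i and x :: "'a symop"
    by simp
  ultimately show "weyl.Tr r = weyl.Lam (\<lambda>i. if i = r then 1 else 0) (\<lambda>_ _. 0) (\<lambda>_. 0)"
    "weyl.Gr r s = weyl.Lam (\<lambda>_. 0) (\<lambda>i j. if i = r \<and> j = s then 1 else 0) (\<lambda>_. 0)"
    "weyl.Zr r = weyl.Lam (\<lambda>_. 0) (\<lambda>_ _. 0) (\<lambda>i. if i = r then 1 else 0)"
    by (simp_all add: weyl.Lam_def cong: if_cong)
     (subst sum.swap, simp)?
qed

lemma typed_Lam: "typed p v \<Longrightarrow> typed p (app (weyl.Lam a b c) v)"
  by (auto simp: typed_def weyl.Lam_comm intro: fin_opD of_type_commute)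

text \<open>Pairs with \<open>T1 v = T2 w\<close> avoid inverse maps: v is the preimage under
  \<open>T1\<close> of \<open>T2 w\<close>. The transported action drops out, since for two
  quantizations both sides are that action on the common value.\<close>

locale two_triangular = T1: triangular p T1 + T2: triangular p T2
  for p :: nat and T1 T2 :: "'n::finite asym \<Rightarrow> 'n asym" +
  assumes equi: "typed p v \<Longrightarrow> typed p w \<Longrightarrow> T1 v = T2 w \<Longrightarrow>
      T1 (app (weyl.Lam a b c) v) = T2 (app (weyl.Lam a b c) w)"
begin

text \<open>On typed symbols, these operators commute with the inverse of \<open>T1\<close> composed
  with \<open>T2\<close>. They are closed under sums and products, and so include
  \<open>cas\<close>.\<close>

definition intertwining :: "'n symop \<Rightarrow> bool" where
  "intertwining f \<longleftrightarrow> (\<forall>v w. typed p v \<longrightarrow> typed p w \<longrightarrow> T1 v = T2 w \<longrightarrow>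
     T1 (app f v) = T2 (app f w) \<and> typed p (app f v) \<and> typed p (app f w))"

lemma intertwining_intros:
  "intertwining f \<Longrightarrow> intertwining g \<Longrightarrow> intertwining (f + g)" "intertwining f \<Longrightarrow> intertwining g \<Longrightarrow> intertwining (f - g)" "intertwining f \<Longrightarrow> intertwining g \<Longrightarrow> intertwining (f * g)"
  "intertwining f \<Longrightarrow> intertwining (c *\<^sub>R f)" "intertwining 0" "intertwining (weyl.Lam a b c')"
  using equi typed_lin(4)
  by (auto simp: intertwining_def T1.T_add T2.T_add T1.T_diff T2.T_diff T1.T_scale T2.T_scale T1.T_zero T2.T_zero typed_lin typed_Lam)

lemma intertwining_sum: "(\<And>i. i \<in> S \<Longrightarrow> intertwining (f i)) \<Longrightarrow> intertwining (sum f S)"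
  by (induction S rule: infinite_finite_induct) (simp_all add: intertwining_intros)

lemma intertwining_cas: "intertwining weyl.cas"
  unfolding weyl.cas_def
  by (intro intertwining_intros(1-4) intertwining_sum) (simp_all only: Lam_unit intertwining_intros)

text \<open>The preimage v under \<open>T1\<close> of \<open>T2 P\<close> has the same eigenvalue as
  P, because \<open>cas\<close> is intertwining. It differs from P only below degree k, where
  \<open>cas_eigen_zero\<close> excludes this eigenvalue.\<close>

lemma eq_on_eigen:
  assumes P: "homg (real k) p P" and e: "app weyl.cas P = c *\<^sub>R P" "c \<ge> 2 * (real k + p) * (real k + CARD('n))"
  shows "T1 P = T2 P"
proof -
  have bP: "below (Suc k) P" using P degS_below[of P k "Suc k"] by (simp add: homg_def)
  then have tP: "typed p P" using P by (auto simp: typed_def homg_def fin_below)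
  then obtain v where v: "typed p v" "T1 v = T2 P" using T1.T_surj[OF T2.typed] by blast
  have "T1 (app weyl.cas v) = T2 (app weyl.cas P)" and tc: "typed p (app weyl.cas v)"
    using intertwining_cas v tP by (auto simp: intertwining_def)
  then have "T1 (app weyl.cas v) = T1 (c *\<^sub>R v)"
    using v tP e(1) by (simp add: T1.T_scale T2.T_scale)
  then have ev: "app weyl.cas v = c *\<^sub>R v"
    using T1.T_inj tc v typed_lin(3) by blast
  have T2P: "below k (T2 P - P)" using T2.tri[OF tP] P by (simp add: homg_def)
  have "typed p (v - P)" using v tP by (simp add: typed_lin)
  have "below k (T1 (v - P))"
  proof -
    have "T1 (v - P) = (T2 P - P) - (T1 P - P)"
      using v tP by (simp add: T1.T_diff)
    moreover have "below k (T1 P - P)" using T1.tri[OF tP] P by (simp add: homg_def)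
    ultimately show ?thesis using T2P below_lin(2) by metis
  qed
  then have "below k (v - P)" using \<open>typed p (v - P)\<close> by (rule T1.below_reflect[rotated])
  moreover have "app weyl.cas (v - P) = c *\<^sub>R (v - P)" using ev e(1) by (simp add: scaleR_diff_right)
  moreover have "of_type p (v - P)" using \<open>typed p (v - P)\<close> by (simp add: typed_def)
  ultimately have "v - P = 0" using e(2) by (intro cas_eigen_zero)
  then show ?thesis using v by simp
qed

lemma eq_on_homg:
  assumes P: "homg (real k) p P"
  shows "T1 P = T2 P"
proof (cases "k = 0")
  \<comment> \<open>In degree 0 the number k + p may be zero and cannot be divided by, but there
    both maps fix P.\<close>
  case True
  have "typed p P" using P degS_below[of P k "Suc k"] by (auto simp: typed_def homg_def fin_below)
  then have "below 0 (T1 P - P)" "below 0 (T2 P - P)"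
    using P True T1.tri[of P 0] T2.tri[of P 0] by (simp_all add: homg_def)
  then show ?thesis by simp
next
  case False
  let ?q = "app (weyl.dl * weyl.ds)"
  let ?m = "real k + p"
  have m: "?m > 0" using False by simp
  \<comment> \<open>\<open>P1\<close> and \<open>P2\<close> are the components of P in the
    eigenspaces of \<open>dl * ds\<close> for k + p and for 0.\<close>
  define P1 where "P1 = (1 / ?m) *\<^sub>R ?q P"
  define P2 where "P2 = P - P1"
  have h1: "homg (real k) p P1" and h2: "homg (real k) p P2"
    using dl_ds_twice(2)[OF P] P
    by (simp_all add: P2_def P1_def homg_def of_type_lin scaleR_diff_right del: app_simps(7))
  have q1: "?q P1 = ?m *\<^sub>R P1"
    using m dl_ds_twice(1)[OF P] by (simp add: P1_def del: app_simps(7))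
  have q2: "?q P2 = 0"
    using m dl_ds_twice(1)[OF P] by (simp add: P2_def P1_def del: app_simps(7))
  have "T1 P1 = T2 P1"
  proof (rule eq_on_eigen[OF h1])
    show "app weyl.cas P1 = (2 * ?m * (real k + CARD('n)) + 2 * ?m) *\<^sub>R P1"
      unfolding cas_homg[OF h1] q1 by (simp only: scaleR_add_left [symmetric] scaleR_scaleR)
  qed (use m in simp)
  moreover have "T1 P2 = T2 P2"
    by (rule eq_on_eigen[OF h2, of "2 * ?m * (real k + CARD('n))"]) (unfold cas_homg[OF h2] q2, simp_all)
  moreover have "typed p P1" "typed p P2"
    using h1 h2 degS_below[of _ k "Suc k"] by (auto simp: typed_def homg_def fin_below)
  moreover have "P = P1 + P2" by (simp add: P2_def)
  ultimately show ?thesis by (simp add: T1.T_add T2.T_add)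
qed

lemma eq_on_typed: "typed p v \<Longrightarrow> T1 v = T2 v"
proof -
  assume v: "typed p v"
  then obtain K where "below K v" by (auto simp: typed_def fin_below)
  then have d: "v = (\<Sum>k<K. ahom k v)" by (rule below_decomp)
  have "T1 (\<Sum>k<K. ahom k v) = (\<Sum>k<K. T1 (ahom k v))" "T2 (\<Sum>k<K. ahom k v) = (\<Sum>k<K. T2 (ahom k v))"
    using T1.T_sum[of "{..<K}" "\<lambda>k. ahom k v"] T2.T_sum[of "{..<K}" "\<lambda>k. ahom k v"] typed_ahom[OF v] by simp_all
  moreover have "T1 (ahom k v) = T2 (ahom k v)" for k
    using v eq_on_homg[OF homg_ahom] by (simp add: typed_def)
  ultimately show ?thesis using d by simp
qed

end

section \<open>Return from \<open>asym\<close> to \<open>symbols p\<close>\<close>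

lemma typed_symbols: "sym_of v \<in> symbols p \<longleftrightarrow> typed p v"
  by (simp add: typed_def sym_of_in_symbols)

lemma symbols_typed: "u \<in> symbols p \<Longrightarrow> u = sym_of (Abs_asym u) \<and> typed p (Abs_asym u)"
  using symbols_sym_of[of u p] by (auto simp: typed_def sym_of_inverse)

lemma sym_of_symbols_hom: "sym_of v \<in> symbols_hom p k \<longleftrightarrow> typed p v \<and> app weyl.degS v = real k *\<^sub>R v"
  by (auto simp: sym_of_in_symbols_hom typed_def)

lemma sym_of_symbols_below: "sym_of v \<in> symbols_below p k \<longleftrightarrow> typed p v \<and> below k v"
  by (auto simp: symbols_below_def typed_symbols below_def fun_eq_iff)

text \<open>\<open>Abs_asym\<close> can be undone only on alternating smooth symbols; Q is known to
  produce these on \<open>symbols p\<close>, hence the restriction to typed v.\<close>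

lemma triangular_of_quantization:
  assumes "sl_quantization p Q"
  shows "triangular p (\<lambda>v. Abs_asym (Q (sym_of v)))" (is "triangular p ?T")
    and "typed p v \<Longrightarrow> sym_of (Abs_asym (Q (sym_of v))) = Q (sym_of v)"
proof -
  have maps: "Q (sym_of v) \<in> symbols p" if "typed p v" for v
    using assms that by (auto simp: sl_quantization_def typed_symbols[symmetric] dest: bij_betwE)
  have T: "sym_of (?T v) = Q (sym_of v)" if "typed p v" for v
    using symbols_typed[OF maps[OF that]] by simp
  then show "typed p v \<Longrightarrow> sym_of (?T v) = Q (sym_of v)" .
  show "triangular p ?T"
  proof
    show "typed p (?T v)" if "typed p v" for v
      using symbols_typed[OF maps[OF that]] by simp
    show "?T (a *\<^sub>R u + b *\<^sub>R v) = a *\<^sub>R ?T u + b *\<^sub>R ?T v" if "typed p u" "typed p v" for u v a b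
    proof -
      have "Q (sym_of (a *\<^sub>R u + b *\<^sub>R v)) = scale_symbol a (Q (sym_of u)) + scale_symbol b (Q (sym_of v))"
        using assms that unfolding sl_quantization_def linear_on_symbols_def sym_of_plus sym_of_scale
        by (simp add: typed_symbols)
      also have "\<dots> = sym_of (a *\<^sub>R ?T u + b *\<^sub>R ?T v)"
        by (simp only: sym_of_plus sym_of_scale T that)
      finally show ?thesis by (simp only: sym_of_inverse)
    qed
    show "below k (?T v - v)" if "typed p v" "app weyl.degS v = real k *\<^sub>R v" for v k
    proof -
      have "Q (sym_of v) - sym_of v \<in> symbols_below p k"
        using assms that by (auto simp: sl_quantization_def sym_of_symbols_hom)
      then have "sym_of (?T v - v) \<in> symbols_below p k" by (simp only: sym_of_minus T that)
      then show ?thesis by (simp only: sym_of_symbols_below)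
    qed
  qed
qed

lemma quant_unique:
  assumes "sl_quantization p Q1" "sl_quantization p Q2" "u \<in> symbols p"
  shows "Q1 u = Q2 (u :: 'n::finite symbol)"
proof -
  let ?T1 = "\<lambda>v. Abs_asym (Q1 (sym_of v))" and ?T2 = "\<lambda>v. Abs_asym (Q2 (sym_of v))"
  interpret T1: triangular p ?T1 by (rule triangular_of_quantization[OF assms(1)])
  interpret T2: triangular p ?T2 by (rule triangular_of_quantization[OF assms(2)])
  note T = triangular_of_quantization(2)[OF assms(1)] triangular_of_quantization(2)[OF assms(2)]
  have eq: "Q (sym_of (app (weyl.Lam a b c) v)) = act_symbol p (sl_vec a b c) (Q (sym_of v))"
    if "sl_quantization p Q" "typed p v" for Q and v :: "'n asym" and a b c
  proof -
    have "sl_vec a b c \<in> sl_fields" by (auto simp: sl_fields_eq)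
    with that show ?thesis
      unfolding lie_symbol_sl_vec[symmetric] sl_quantization_def typed_symbols[symmetric] by blast
  qed
  interpret two_triangular p ?T1 ?T2
  proof
    fix v w :: "'n asym" and a b c assume "typed p v" "typed p w" "?T1 v = ?T2 w"
    then have "Q1 (sym_of v) = Q2 (sym_of w)" using T by metis
    then show "?T1 (app (weyl.Lam a b c) v) = ?T2 (app (weyl.Lam a b c) w)"
      using \<open>typed p v\<close> \<open>typed p w\<close> by (simp add: eq assms)
  qed
  have "u = sym_of (Abs_asym u)" "typed p (Abs_asym u)" using symbols_typed[OF assms(3)] by auto
  then show ?thesis using T eq_on_typed[of "Abs_asym u"] by metis
qed

lemma triangular_quant_asym: "triangular p (quant_asym p)"
proof
  show "typed p (quant_asym p v)" if "typed p v" for v :: "'a asym"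
  proof -
    from that obtain K where K: "below K v" by (auto simp: typed_def fin_below)
    have "homg (real k) p (ahom k v)" for k using that by (simp add: homg_ahom typed_def)
    from quant_hom_asym_triangular(2,3)[OF this] show ?thesis
      unfolding quant_asym_below[OF K] typed_def by (intro conjI fin_sum of_type_sum)
  qed
  show "quant_asym p (a *\<^sub>R u + b *\<^sub>R v) = a *\<^sub>R quant_asym p u + b *\<^sub>R quant_asym p v" if "typed p u" "typed p v" for u v :: "'a asym" and a b
  proof -
    from that obtain K L where "below K u" "below L v" by (auto simp: typed_def fin_below)
    then have u: "below (max K L) u" and v: "below (max K L) v" by (auto intro: below_mono)
    have "below (max K L) (a *\<^sub>R u + b *\<^sub>R v)" using u v by (intro below_lin)
    from quant_asym_below[OF this] show ?thesis
      unfolding quant_asym_below[OF u] quant_asym_below[OF v] by (simp add: quant_hom_asym_lin sum.distrib scaleR_sum_right)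
  qed
  show "below k (quant_asym p v - v)" if "typed p v" "app weyl.degS v = real k *\<^sub>R v" for v :: "'a asym" and k
  proof -
    have h: "homg (real k) p v" using that by (simp add: homg_def typed_def)
    have "below (Suc k) v" using degS_below[OF that(2), of "Suc k"] by simp
    from quant_asym_below[OF this, of p] have "quant_asym p v = (\<Sum>j<Suc k. if j = k then quant_hom_asym p k v else 0)"
      by (simp add: degS_ahom_eq[OF that(2)] quant_hom_asym_lin if_distrib cong: if_cong)
    then have "quant_asym p v = quant_hom_asym p k v" by simp
    then show ?thesis using quant_hom_asym_triangular(1)[OF h] by simp
  qed
qed

lemma quant_is_quantization: "sl_quantization p (quant p :: 'n::finite symbol \<Rightarrow> 'n symbol)"
proof -
  interpret triangular p "quant_asym p :: 'n asym \<Rightarrow> 'n asym" by (rule triangular_quant_asym)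
  note st = symbols_typed
  have "linear_on_symbols p (quant p :: 'n symbol \<Rightarrow> 'n symbol)"
    unfolding linear_on_symbols_def
  proof (intro ballI allI)
    fix u v :: "'n symbol" and a b assume "u \<in> symbols p" "v \<in> symbols p"
    then obtain u' v' where "u = sym_of u'" "v = sym_of v'" "typed p u'" "typed p v'" using st by blast
    then show "quant p (scale_symbol a u + scale_symbol b v) = scale_symbol a (quant p u) + scale_symbol b (quant p v)"
      by (simp only: sym_of_scale[symmetric] sym_of_plus[symmetric] quant_sym_of lin)
  qed
  moreover have "bij_betw (quant p :: 'n symbol \<Rightarrow> 'n symbol) (symbols p) (symbols p)"
    unfolding bij_betw_def
  proof
    show "inj_on (quant p :: 'n symbol \<Rightarrow> 'n symbol) (symbols p)"
    proof (rule inj_onI)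
      fix u v :: "'n symbol" assume "u \<in> symbols p" "v \<in> symbols p" and eq: "quant p u = quant p v"
      then obtain u' v' where "u = sym_of u'" "v = sym_of v'" "typed p u'" "typed p v'" using st by blast
      with eq show "u = v" using T_inj[of u' v'] by (simp add: quant_sym_of sym_of_inject)
    qed
    show "quant p ` symbols p = (symbols p :: 'n symbol set)"
    proof (intro set_eqI iffI)
      fix u :: "'n symbol" assume "u \<in> quant p ` symbols p"
      then obtain v where "v \<in> symbols p" "u = quant p v" by blast
      with st[of v] show "u \<in> symbols p" by (metis quant_sym_of typed typed_symbols)
    next
      fix u :: "'n symbol" assume "u \<in> symbols p"
      with st[of u] obtain u' where u: "u = sym_of u'" "typed p u'" by blast
      then obtain v where "typed p v" "quant_asym p v = u'" using T_surj by blast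
      then show "u \<in> quant p ` symbols p"
        using u by (metis imageI quant_sym_of typed_symbols)
    qed
  qed
  moreover have "quant p (lie_symbol X u) = act_symbol p X (quant p u)" if "X \<in> sl_fields" "u \<in> symbols p" for X and u :: "'n symbol"
  proof -
    from that(1) obtain a b c where X: "X = sl_vec a b c" by (auto simp: sl_fields_eq)
    from st[OF that(2)] obtain v where v: "u = sym_of v" "typed p v" by blast
    then have "typed p (quant_asym p v)" by (simp add: typed)
    \<comment> \<open>By equivariance the image under \<open>Lam a b c - A c - B c\<close> is itself
      a value of \<open>quant_asym p\<close>; this supplies the type that
      \<open>act_symbol_sl_vec\<close> asks for.\<close>
    moreover have "typed p (quant_asym p (app (weyl.Lam a b c) v))" using v by (simp add: typed typed_Lam)
    ultimately show ?thesis
      unfolding X v lie_symbol_sl_vec quant_sym_of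
      using v quant_asym_equivariant[of v p a b c] by (subst act_symbol_sl_vec) (simp_all add: typed_def del: app_simps)
  qed
  moreover have "quant p P - P \<in> symbols_below p k" if "P \<in> symbols_hom p k" for k and P :: "'n symbol"
  proof -
    have "P \<in> symbols p" using that by (simp add: symbols_hom_def)
    then obtain v where v: "P = sym_of v" using st by blast
    with that have "typed p v" "app weyl.degS v = real k *\<^sub>R v" by (simp_all add: sym_of_symbols_hom)
    then show ?thesis
      unfolding v quant_sym_of sym_of_minus[symmetric] sym_of_symbols_below
      using tri[of v k] typed typed_lin(2) by blast
  qed
  ultimately show ?thesis unfolding sl_quantization_def by blast
qed

theorem theorem4:
  fixes p :: nat
  assumes "CARD('n::finite) \<ge> 2" and "p \<le> CARD('n)"
  shows "sl_quantization p (quant p :: 'n symbol \<Rightarrow> 'n symbol) \<and>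
    (\<forall>Q :: 'n symbol \<Rightarrow> 'n symbol. sl_quantization p Q \<longrightarrow> (\<forall>u\<in>symbols p. Q u = quant p u))"
  using quant_is_quantization quant_unique by blast

end
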